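(* Let $X\in L^2(\mathbb{P})$ be a real random variable with distribution $\mathbb{P}_X=\varphi\cdot\lambda$ ($\lambda$ the Lebesgue measure on $\mathbb{R}$) whose support is connected, and assume that the probability density $\varphi$ is positive and Lipschitz continuous on every compact subset of the interior $(\underline m,\overline m)$ of $\mathrm{supp}(\mathbb{P}_X)$. For every $N\ge 1$ let $\widehat X^N$ be a quadratic optimal quantization of $X$ at level $N$. Let $f:\mathbb{R}\to\mathbb{R}$ be a continuous function with $f(X)\in L^2(\mathbb{P})$, and let $-\infty=a_0<a_1<\dots<a_K<a_{K+1}=+\infty$ be such that $f$ is differentiable on each $(a_k,a_{k+1})$, $k=0,\dots,K$. (a) Suppose that for every $k=0,\dots,K$ there are a constant $[f']_{k,Lip,loc}\ge 0$, a real number $q_k>3$ and a function $g_k:(a_k,a_{k+1})\to\mathbb{R}_+$ such that $g_k^{q_k}$ is convex, $\mathbb{E}\big[g_k(X)^{q_k}\mathbf 1_{\{X\in(a_k,a_{k+1})\}}\big]<+\infty$ and $$\forall x,y\in(a_k,a_{k+1}),\quad |f'(x)-f'(y)|\le [f']_{k,Lip,loc}\,|x-y|\,\big(g_k(x)+g_k(y)\big).$$ Let $p=\max_k \frac{q_k}{q_k-1}$ and suppose that $X\in L^{\frac{s}{3-s}+\delta}(\mathbb{P})$ for some $\delta>0$ and some $s\in(2,3)$ with $s\ge 2p$. Then there exists a real constant $C_{f,X}>0$ such that $$\limsup_N N^2\,\big|\mathbb{E}[f(X)]-\mathbb{E}[f(\widehat X^N)]\big|\le C_{f,X}<+\infty.$$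 (b) Let $\alpha\in(0,1)$. Suppose that for every $k=0,\dots,K$ there are a constant $[f']_{k,\alpha,loc}\ge 0$, a real number $q_k>\frac{3}{2-\alpha}$ and a function $g_k:(a_k,a_{k+1})\to\mathbb{R}_+$ such that $g_k^{q_k}$ is convex, $\mathbb{E}\big[g_k(X)^{q_k}\mathbf 1_{\{X\in(a_k,a_{k+1})\}}\big]<+\infty$ and $$\forall x,y\in(a_k,a_{k+1}),\quad |f'(x)-f'(y)|\le [f']_{k,\alpha,loc}\,|x-y|^{\alpha}\,\big(g_k(x)+g_k(y)\big).$$ Let $p=\max_k \frac{q_k}{q_k-1}$ and suppose that $X\in L^{\frac{s}{3-s}+\delta}(\mathbb{P})$ for some $\delta>0$ and some $s\in(2,3)$ with $s\ge(1+\alpha)p$. Then there exists a real constant $C_{f,X}>0$ such that $$\limsup_N N^{1+\alpha}\,\big|\mathbb{E}[f(X)]-\mathbb{E}[f(\widehat X^N)]\big|\le C_{f,X}<+\infty.$$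
   Context: For a finite set (grid) $\Gamma_N=\{x_1^N,\dots,x_N^N\}\subset\mathbb{R}$ with $x_1^N<\dots<x_N^N$, the Voronoi cells are $C_i(\Gamma_N)=(x_{i-1/2}^N,x_{i+1/2}^N]$ for $i<N$ and $C_N(\Gamma_N)=(x_{N-1/2}^N,x_{N+1/2}^N)$, where $x_{i-1/2}^N=(x_{i-1}^N+x_i^N)/2$ for $2\le i\le N$, $x_{1/2}^N=\inf\mathrm{supp}(\mathbb{P}_X)$ and $x_{N+1/2}^N=\sup\mathrm{supp}(\mathbb{P}_X)$. The quantization of $X$ by $\Gamma_N$ is the nearest-neighbour projection $\widehat X^N=\sum_{i=1}^N x_i^N\mathbf 1_{\{X\in C_i(\Gamma_N)\}}$. The grid $\Gamma_N$ (and $\widehat X^N$) is called quadratic optimal ($L^2$-optimal) at level $N$ if it minimizes $\mathbb{E}[\min_{i}|X-x_i|^2]$ over all $N$-tuples $(x_1,\dots,x_N)\in\mathbb{R}^N$. *)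

theory Defs
  imports "HOL-Probability.Probability"
begin

definition measure_support :: "real measure \<Rightarrow> real set" where
  "measure_support \<mu> = {x. \<forall>U. open U \<and> x \<in> U \<longrightarrow> emeasure \<mu> U > 0}"

text \<open>
  A grid of size \<open>N\<close> is a map \<open>x :: nat \<Rightarrow> real\<close> of which only the values \<open>x 1, \<dots>, x N\<close> matter.
  \<open>voronoi_edge S N x j\<close> is the point \<open>x\<close> with index \<open>j + 1/2\<close>, for \<open>j = 0, \<dots>, N\<close>; the two outer
  edges are the extended-real endpoints of the support \<open>S\<close>, which may be infinite.
\<close>

definition voronoi_edge :: "real set \<Rightarrow> nat \<Rightarrow> (nat \<Rightarrow> real) \<Rightarrow> nat \<Rightarrow> ereal" where
  "voronoi_edge S N x j =
     (if j = 0 then Inf (ereal ` S)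
      else if j = N then Sup (ereal ` S)
      else ereal ((x j + x (j + 1)) / 2))"

definition voronoi_cell :: "real set \<Rightarrow> nat \<Rightarrow> (nat \<Rightarrow> real) \<Rightarrow> nat \<Rightarrow> real set" where
  "voronoi_cell S N x i =
     (if i < N
      then {u. voronoi_edge S N x (i - 1) < ereal u \<and> ereal u \<le> voronoi_edge S N x i}
      else {u. voronoi_edge S N x (i - 1) < ereal u \<and> ereal u < voronoi_edge S N x i})"

definition quantization ::
    "'w measure \<Rightarrow> ('w \<Rightarrow> real) \<Rightarrow> nat \<Rightarrow> (nat \<Rightarrow> real) \<Rightarrow> 'w \<Rightarrow> real" where
  "quantization M X N x \<omega> =
     (\<Sum>i = 1..N. x i *
        indicator (voronoi_cell (measure_support (distr M borel X)) N x i) (X \<omega>))"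

definition quadratic_distortion ::
    "'w measure \<Rightarrow> ('w \<Rightarrow> real) \<Rightarrow> nat \<Rightarrow> (nat \<Rightarrow> real) \<Rightarrow> real" where
  "quadratic_distortion M X N x = (\<integral>\<omega>. (MIN i\<in>{1..N}. \<bar>X \<omega> - x i\<bar>\<^sup>2) \<partial>M)"

text \<open>The grid itself is increasing, but it competes against arbitrary \<open>N\<close>-tuples.\<close>

definition quadratic_optimal_grid ::
    "'w measure \<Rightarrow> ('w \<Rightarrow> real) \<Rightarrow> nat \<Rightarrow> (nat \<Rightarrow> real) \<Rightarrow> bool" where
  "quadratic_optimal_grid M X N x \<longleftrightarrow>
     strict_mono_on {1..N} x \<and>
     (\<forall>y. quadratic_distortion M X N x \<le> quadratic_distortion M X N y)"

end

theory Submission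
  imports Defs
begin

text \<open>
  Write \<open>d\<close> for the distance to an optimal grid of size \<open>N\<close>. The optimal distortion is \<open>O(1 / N\<^sup>2)\<close>, so a fixed
  compact interval inside the support contains three grid points within distance \<open>O(1 / N)\<close>. Moving
  the middle one to an arbitrary point \<open>y\<close> cannot decrease the distortion, which gives
  \<open>d(y)\<^sup>2 \<mu>(B(y, d(y) / 4)) = O(1 / N\<^sup>3)\<close> uniformly in \<open>y\<close>. This inequality yields both that cells around a
  given interior point have size \<open>O(1 / N)\<close> and, after integration in \<open>y\<close> against
  \<open>d(y)\<close> to the power \<open>s - 3\<close>, that \<open>N d(X)\<close> is bounded in \<open>L\<^sup>s\<close> for \<open>s < 3\<close>.

  On a cell without breakpoints of \<open>f\<close>, stationarity of the grid removes the first-order Taylor term, and the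
  remainder is controlled by Young's inequality, the \<open>L\<^sup>s\<close> bound and Jensen's inequality for \<open>g powr q\<close>.
  A cell that contains a breakpoint \<open>a\<close> has mass \<open>O(1 / N)\<close>, and there \<open>f u - f a = O(\<bar>u - a\<bar> powr \<alpha>)\<close>,
  because convexity and integrability of \<open>g powr q\<close> limit the growth of \<open>g\<close> at \<open>a\<close>.
  Part (a) is the case \<open>\<alpha> = 1\<close> of part (b).
\<close>

section \<open>Optimal grids and the cost of a point\<close>

text \<open>Near the ends of the support the density has no positive lower bound and cells may be
  large, so no uniform estimate of single cells is available there. The tails therefore enter
  through an inequality valid at every \<open>y\<close>, which is integrated. Since the line has
  infinite length this needs a weight decaying faster than 1/|y|; the condition
  \<open>s / (3 - s) < \<tau>\<close> is what allows the weight to be removed again at the price of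
  a slightly larger exponent still below 3. Young's inequality with the conjugate exponent q/(q - 1)
  produces the power (1 + \<alpha>) q/(q - 1) of the distance, which \<open>s\<close> has to
  dominate. Its other term contains \<open>g powr q\<close> at the grid point itself, about which
  integrability says nothing; convexity, and the fact that a grid point is the barycentre of its
  cell, turn this value into an integral over the cell. Neither device applies to a cell containing
  a breakpoint. At most \<open>K\<close> cells do, so mass times oscillation is a sufficient bound,
  being of order 1/N times N^(-\<alpha>).\<close>

definition distortion :: "real measure \<Rightarrow> real set \<Rightarrow> real" where
  "distortion \<mu> B = (\<integral>u. (infdist u B)\<^sup>2 \<partial>\<mu>)"

text \<open>Grids are sets of at most \<open>N\<close> points: deleting a point and inserting one
  that may already be present stays admissible, and the values of an arbitrary
  \<open>N\<close>-tuple, possibly repeated, form such a set.\<close>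

definition optimal_set :: "real measure \<Rightarrow> nat \<Rightarrow> real set \<Rightarrow> bool" where
  "optimal_set \<mu> N \<Gamma> \<longleftrightarrow> finite \<Gamma> \<and> \<Gamma> \<noteq> {} \<and> card \<Gamma> \<le> N \<and>
     (\<forall>B. finite B \<and> B \<noteq> {} \<and> card B \<le> N \<longrightarrow> distortion \<mu> \<Gamma> \<le> distortion \<mu> B)"

text \<open>The error analysis sees the density only through such bounds on compact subintervals of
  the support. The lower bound is imposed on open and the upper one on closed intervals, the
  stronger choice in each case, so endpoints never need attention.\<close>

definition density_bounds :: "real measure \<Rightarrow> real \<Rightarrow> real \<Rightarrow> real \<Rightarrow> real \<Rightarrow> bool" where
  "density_bounds \<mu> c d m b \<longleftrightarrow> c < d \<and> 0 < m \<and> 0 \<le> b \<and>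
     (\<forall>e f. c \<le> e \<and> e \<le> f \<and> f \<le> d \<longrightarrow>
        m * (f - e) \<le> measure \<mu> {e<..<f} \<and> measure \<mu> {e..f} \<le> b * (f - e))"

lemma infdist_greatest:
  assumes "B \<noteq> {}" "\<And>b. b \<in> B \<Longrightarrow> r \<le> dist x b"
  shows "r \<le> infdist x B"
  using assms by (simp add: infdist_notempty cINF_greatest)

lemma infdist_finite_attained:
  fixes B :: "real set"
  assumes "finite B" "B \<noteq> {}"
  obtains b where "b \<in> B" "infdist x B = dist x b"
  using infdist_attains_inf[OF finite_imp_closed[OF assms(1)] assms(2)] by blast

lemma borel_measurable_infdist [measurable]: "(\<lambda>u::real. infdist u B) \<in> borel_measurable borel"
  by (intro borel_measurable_continuous_onI continuous_intros)

text \<open>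
  The points are quantiles of a Pareto law of index \<open>1 / b\<close>. With \<open>w = (1 + \<bar>u\<bar>) powr (1 / b)\<close>, the grid point of
  index \<open>\<lceil>n / w\<rceil>\<close> is close enough to \<open>u\<close>, by Bernoulli's inequality.
\<close>

lemma infdist_pareto_grid:
  fixes n b :: nat and u :: real
  assumes "0 < n" "0 < b"
  defines "B \<equiv> (\<lambda>k. (real n / real k) ^ b - 1) ` {1..n} \<union> (\<lambda>k. 1 - (real n / real k) ^ b) ` {1..n}"
  shows "infdist u B \<le> real b / real n * (1 + \<bar>u\<bar>) powr (1 + 1 / real b)"
proof -
  define v where "v = 1 + \<bar>u\<bar>"
  have v: "1 \<le> v" by (simp add: v_def)
  define w where "w = v powr (1 / real b)"
  have w: "1 \<le> w" using v by (simp add: w_def ge_one_powr_ge_zero)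
  have wb: "w ^ b = v" using v \<open>0 < b\<close> by (simp add: w_def powr_powr flip: powr_realpow)
  define k where "k = nat \<lceil>real n / w\<rceil>"
  have "0 < real n / w" using w \<open>0 < n\<close> by simp
  then have k1: "real n / w \<le> real k" "real k < real n / w + 1" "0 < k"
    unfolding k_def by linarith+
  have "real n / w \<le> real n" using w \<open>0 < n\<close> by (simp add: divide_le_eq)
  then have kn: "k \<le> n" unfolding k_def by linarith
  define z where "z = real n / real k"
  have z0: "0 < z" using k1 \<open>0 < n\<close> by (simp add: z_def)
  have zw: "z \<le> w" using k1 w \<open>0 < n\<close> by (simp add: z_def field_simps)
  have kz: "real k * z = real n" using k1 by (simp add: z_def)
  have "real n < z * (real n / w + 1)"
    using mult_strict_left_mono[OF k1(2) z0] kz by (simp add: mult.commute)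
  then have "real n * w < z * (real n + w)" using w by (simp add: field_simps)
  then have "(w - z) * real n \<le> z * w" by (simp add: algebra_simps)
  also have "\<dots> \<le> w * w" using zw w by (intro mult_right_mono) auto
  finally have wz: "w - z \<le> w * w / real n" using \<open>0 < n\<close> by (simp add: field_simps)
  have "1 + real b * (z / w - 1) \<le> (1 + (z / w - 1)) ^ b"
    using z0 w by (intro Bernoulli_inequality) auto
  then have "w ^ b * (1 + real b * (z / w - 1)) \<le> w ^ b * (z / w) ^ b"
    using w by (intro mult_left_mono) auto
  also have "\<dots> = z ^ b" using w by (simp add: power_divide)
  finally have "v - z ^ b \<le> v * real b * (w - z) / w"
    using w by (simp add: wb field_simps)
  also have "\<dots> \<le> v * real b * (w * w / real n) / w"
    using wz v w by (intro divide_right_mono mult_left_mono) auto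
  also have "\<dots> = real b / real n * (v * w)" using w by simp
  also have "v * w = v powr (1 + 1 / real b)" using v by (simp add: w_def powr_add)
  finally have *: "v - z ^ b \<le> real b / real n * v powr (1 + 1 / real b)" .
  have zb: "z ^ b \<le> v" using zw z0 wb by (metis less_imp_le power_mono)
  have mem: "z ^ b - 1 \<in> B" "1 - z ^ b \<in> B" using kn k1 by (auto simp: B_def z_def)
  show ?thesis
  proof (cases "0 \<le> u")
    case True
    then have "infdist u B \<le> v - z ^ b"
      using infdist_le[OF mem(1), of u] zb by (simp add: v_def dist_real_def)
    then show ?thesis using * v_def by simp
  next
    case False
    then have "infdist u B \<le> v - z ^ b"
      using infdist_le[OF mem(2), of u] zb by (simp add: v_def dist_real_def)
    then show ?thesis using * v_def by simp
  qed
qed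

section \<open>Upper bound on the optimal distortion and exchange of one grid point\<close>

context real_distribution
begin

lemma integrable_infdist_sq:
  assumes "integrable M (\<lambda>u. u\<^sup>2)" "B \<noteq> {}"
  shows "integrable M (\<lambda>u. (infdist u B)\<^sup>2)"
proof -
  obtain b where b: "b \<in> B" using assms(2) by blast
  have "integrable M (\<lambda>u. 2 * u\<^sup>2 + 2 * b\<^sup>2)" using assms(1) by auto
  then show ?thesis
  proof (rule Bochner_Integration.integrable_bound)
    show "(\<lambda>u. (infdist u B)\<^sup>2) \<in> borel_measurable M" by simp
    have "(infdist u B)\<^sup>2 \<le> 2 * u\<^sup>2 + 2 * b\<^sup>2" for u
    proof -
      have "(infdist u B)\<^sup>2 \<le> (dist u b)\<^sup>2"
        using infdist_le[OF b] infdist_nonneg by (intro power_mono) auto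
      also have "\<dots> = (u - b)\<^sup>2" by (simp add: dist_real_def)
      also have "\<dots> \<le> 2 * u\<^sup>2 + 2 * b\<^sup>2" 
        using zero_le_power2[of "u + b"] by (simp add: power2_eq_square algebra_simps)
      finally show ?thesis .
    qed
    then show "AE u in M. norm ((infdist u B)\<^sup>2) \<le> norm (2 * u\<^sup>2 + 2 * b\<^sup>2)"
      by (auto intro!: AE_I2 order_trans[OF _ abs_ge_self])
  qed
qed

lemma integrable_powr_mono:
  assumes "integrable M (\<lambda>u. \<bar>u\<bar> powr \<tau>)" "0 \<le> r" "r \<le> \<tau>"
  shows "integrable M (\<lambda>u. (1 + \<bar>u\<bar>) powr r)"
proof -
  have "integrable M (\<lambda>u. 2 powr \<tau> * (1 + \<bar>u\<bar> powr \<tau>))" using assms(1) by auto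
  then show ?thesis
  proof (rule Bochner_Integration.integrable_bound)
    show "(\<lambda>u. (1 + \<bar>u\<bar>) powr r) \<in> borel_measurable M" by simp
    have "(1 + \<bar>u\<bar>) powr r \<le> 2 powr \<tau> * (1 + \<bar>u\<bar> powr \<tau>)" for u :: real
    proof -
      have "(1 + \<bar>u\<bar>) powr r \<le> (1 + \<bar>u\<bar>) powr \<tau>" using assms by (intro powr_mono) auto
      also have "\<dots> \<le> (2 * max 1 \<bar>u\<bar>) powr \<tau>" using assms by (intro powr_mono2) auto
      also have "\<dots> = 2 powr \<tau> * max 1 \<bar>u\<bar> powr \<tau>" by (simp add: powr_mult)
      also have "max 1 \<bar>u\<bar> powr \<tau> \<le> 1 + \<bar>u\<bar> powr \<tau>" by (auto simp: max_def)
      finally show ?thesis by (simp add: algebra_simps)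
    qed
    then show "AE u in M. norm ((1 + \<bar>u\<bar>) powr r) \<le> norm (2 powr \<tau> * (1 + \<bar>u\<bar> powr \<tau>))"
      by auto
  qed
qed

text \<open>Integrating the square of the Pareto grid bound requires the moment of order 2 (1 +
  1/b), which is at most \<tau> once \<open>b\<close> is at least 2/(\<tau> - 2). Hence any moment
  of order above 2 gives the rate.\<close>

lemma distortion_le_inverse_square:
  assumes \<tau>: "2 < \<tau>" and int: "integrable M (\<lambda>u. \<bar>u\<bar> powr \<tau>)"
  obtains C where "0 \<le> C"
    "\<And>N. 2 \<le> N \<Longrightarrow> \<exists>B. finite B \<and> B \<noteq> {} \<and> card B \<le> N \<and> distortion M B \<le> C / (real N)\<^sup>2"
proof -
  obtain b :: nat where b: "2 / (\<tau> - 2) < real b" using reals_Archimedean2 by blast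
  have "0 < 2 / (\<tau> - 2)" using \<tau> by simp
  then have b0: "0 < b" using b by (metis of_nat_0_less_iff order_less_trans)
  have r: "2 * (1 + 1 / real b) \<le> \<tau>" using b b0 \<tau> by (simp add: field_simps)
  define r where "r = 2 * (1 + 1 / real b)"
  have intr: "integrable M (\<lambda>u. (1 + \<bar>u\<bar>) powr r)"
    using integrable_powr_mono[OF int, of r] r b0 by (simp add: r_def)
  define C where "C = 9 * (real b)\<^sup>2 * (\<integral>u. (1 + \<bar>u\<bar>) powr r \<partial>M)"
  have "0 \<le> C" by (simp add: C_def)
  moreover have "\<exists>B. finite B \<and> B \<noteq> {} \<and> card B \<le> N \<and> distortion M B \<le> C / (real N)\<^sup>2" if N: "2 \<le> N" for N
  proof -
    \<comment> \<open>The grid has two mirrored halves of \<open>n\<close> points each. The 9 in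
      \<open>C\<close> is the square of the 3 in N \<le> 3 n, attained at N = 3.\<close>
    define n where "n = N div 2"
    have n: "0 < n" "2 * n \<le> N" "N \<le> 3 * n" using N by (auto simp: n_def)
    define B where "B = (\<lambda>k. (real n / real k) ^ b - 1) ` {1..n} \<union> (\<lambda>k. 1 - (real n / real k) ^ b) ` {1..n}"
    have "card B \<le> card {1..n} + card {1..n}"
      unfolding B_def by (intro order_trans[OF card_Un_le] add_mono card_image_le) auto
    then have cB: "card B \<le> N" using n by simp
    have Bne: "B \<noteq> {}" using n by (auto simp: B_def)
    have "distortion M B \<le> (\<integral>u. (real b / real n)\<^sup>2 * (1 + \<bar>u\<bar>) powr r \<partial>M)"
      unfolding distortion_def
    proof (rule integral_mono_AE')
      show "integrable M (\<lambda>u. (real b / real n)\<^sup>2 * (1 + \<bar>u\<bar>) powr r)" using intr by simp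
      have "(infdist u B)\<^sup>2 \<le> (real b / real n)\<^sup>2 * (1 + \<bar>u\<bar>) powr r" for u
      proof -
        have "(infdist u B)\<^sup>2 \<le> (real b / real n * (1 + \<bar>u\<bar>) powr (1 + 1 / real b))\<^sup>2"
          unfolding B_def using n b0 by (intro power_mono infdist_pareto_grid infdist_nonneg)
        also have "\<dots> = (real b / real n)\<^sup>2 * (1 + \<bar>u\<bar>) powr r"
          by (simp add: power_mult_distrib r_def power2_eq_square flip: powr_add)
        finally show ?thesis .
      qed
      then show "AE u in M. (infdist u B)\<^sup>2 \<le> (real b / real n)\<^sup>2 * (1 + \<bar>u\<bar>) powr r" by simp
    qed auto
    also have "\<dots> = C / (9 * (real n)\<^sup>2)" by (simp add: C_def power_divide)
    also have "\<dots> \<le> C / (real N)\<^sup>2"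
    proof -
      have "(real N)\<^sup>2 \<le> (3 * real n)\<^sup>2" using n by (intro power_mono) auto
      then show ?thesis using n \<open>0 \<le> C\<close> by (intro divide_left_mono) (auto simp: power_mult_distrib)
    qed
    finally show ?thesis using cB Bne by (intro exI[of _ B]) (auto simp: B_def)
  qed
  ultimately show ?thesis using that by blast
qed

text \<open>Cut [c, d] into \<open>J\<close> intervals of length \<open>h\<close> and each of them
  into thirds. Three occupied thirds would yield the three points, so otherwise every interval has a
  third free of \<open>G\<close>. Its middle part, of length h/6, is at distance at least h/12 from
  \<open>G\<close>, and \<open>J\<close> such parts force a distortion of at least J (h/12)^2 m h/6;
  864 is 144 times 6.\<close>

lemma three_grid_points:
  assumes sq: "integrable M (\<lambda>u. u\<^sup>2)"
    and db: "density_bounds M c d m b"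
    and G: "G \<noteq> {}"
    and J: "0 < J"
    and small: "distortion M G < m * (d - c) ^ 3 / (864 * (real J)\<^sup>2)"
  obtains p1 p2 p3 where "p1 \<in> G" "p2 \<in> G" "p3 \<in> G" "c \<le> p1" "p1 < p2" "p2 < p3" "p3 \<le> d"
    "p3 - p1 \<le> (d - c) / real J"
proof (rule ccontr)
  assume no: "\<not> thesis"
  note found = that
  have cd: "c < d" and m: "0 < m" using db by (auto simp: density_bounds_def)
  define h where "h = (d - c) / real J"
  have h: "0 < h" "real J * h = d - c" using cd J by (auto simp: h_def)
  define e where "e j = c + real j * h" for j
  have ee: "c \<le> e j" "e j + h \<le> d" if "j < J" for j
  proof -
    show "c \<le> e j" using h by (simp add: e_def)
    have "(real j + 1) * h \<le> real J * h" using that h by (intro mult_right_mono) auto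
    then show "e j + h \<le> d" using h by (simp add: e_def algebra_simps)
  qed
  have "\<exists>t. e j \<le> t \<and> t + h / 3 \<le> e j + h \<and> G \<inter> {t..<t + h / 3} = {}" if j: "j < J" for j
  proof (rule ccontr)
    assume "\<not> ?thesis"
    then have c: "G \<inter> {t..<t + h / 3} \<noteq> {}" if "e j \<le> t" "t + h / 3 \<le> e j + h" for t using that by blast
    have "G \<inter> {e j..<e j + h / 3} \<noteq> {}" by (rule c) (use h in auto)
    then obtain p1 where p1: "p1 \<in> G" "e j \<le> p1" "p1 < e j + h / 3" by auto
    have "G \<inter> {e j + h / 3..<e j + h / 3 + h / 3} \<noteq> {}" by (rule c) (use h in auto)
    then obtain p2 where p2: "p2 \<in> G" "e j + h / 3 \<le> p2" "p2 < e j + h / 3 + h / 3" by auto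
    have "G \<inter> {e j + 2 * h / 3..<e j + 2 * h / 3 + h / 3} \<noteq> {}" by (rule c) (use h in auto)
    then obtain p3 where p3: "p3 \<in> G" "e j + 2 * h / 3 \<le> p3" "p3 < e j + 2 * h / 3 + h / 3" by auto
    show False
    proof -
      have "p3 - p1 \<le> h" "c \<le> p1" "p1 < p2" "p2 < p3" "p3 \<le> d"
        using p1 p2 p3 ee[OF j] by linarith+
      then show False using found[of p1 p2 p3] p1(1) p2(1) p3(1) no by (simp add: h_def)
    qed
  qed
  then obtain t where t: "\<And>j. j < J \<Longrightarrow> e j \<le> t j" "\<And>j. j < J \<Longrightarrow> t j + h / 3 \<le> e j + h"
    "\<And>j. j < J \<Longrightarrow> G \<inter> {t j..<t j + h / 3} = {}"
    by metis
  define A where "A j = {t j + h / 12<..<t j + h / 4}" for j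
  have disj: "disjoint_family_on A {..<J}"
  proof -
    have aux: "A i \<inter> A j = {}" if "i < j" "j < J" for i j
    proof -
      have "(real i + 1) * h \<le> real j * h" using that h by (intro mult_right_mono) auto
      then have "e i + h \<le> e j" by (simp add: e_def algebra_simps)
      then show ?thesis using t(1)[of j] t(2)[of i] that h by (auto simp: A_def)
    qed
    show ?thesis unfolding disjoint_family_on_def
      using aux by (metis inf_commute lessThan_iff linorder_neqE_nat)
  qed
  define U where "U = (\<Union>j<J. A j)"
  have "measure M U = (\<Sum>j<J. measure M (A j))"
    unfolding U_def by (intro finite_measure_finite_Union disj) (auto simp: A_def)
  moreover have "m * (h / 6) \<le> measure M (A j)" if "j < J" for j
  proof -
    have "m * ((t j + h / 4) - (t j + h / 12)) \<le> measure M (A j)"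
    proof -
      have "c \<le> t j + h / 12" "t j + h / 12 \<le> t j + h / 4" "t j + h / 4 \<le> d"
        using t(1,2)[OF that] ee[OF that] h by linarith+
      then show ?thesis using db unfolding density_bounds_def A_def by blast
    qed
    then show ?thesis by (simp add: algebra_simps)
  qed
  ultimately have mU: "real J * (m * (h / 6)) \<le> measure M U"
    using sum_bounded_below[of "{..<J}" "m * (h / 6)" "\<lambda>j. measure M (A j)"] by simp
  have Um [measurable]: "U \<in> sets borel" unfolding U_def A_def by auto
  have "(h / 12)\<^sup>2 * measure M U = (\<integral>u. (h / 12)\<^sup>2 * indicator U u \<partial>M)" by simp
  also have "\<dots> \<le> distortion M G"
    unfolding distortion_def
  proof (rule integral_mono)
    show "integrable M (\<lambda>u. (infdist u G)\<^sup>2)" using integrable_infdist_sq sq G .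
    show "integrable M (\<lambda>u. (h / 12)\<^sup>2 * indicator U u)" by (simp add: integrable_real_indicator emeasure_eq_measure)
    show "(h / 12)\<^sup>2 * indicator U u \<le> (infdist u G)\<^sup>2" for u
    proof (cases "u \<in> U")
      case True
      then obtain j where j: "j < J" "u \<in> A j" by (auto simp: U_def)
      have "h / 12 \<le> infdist u G"
      proof (rule infdist_greatest[OF G])
        fix g assume "g \<in> G"
        then have "g < t j \<or> t j + h / 3 \<le> g" using t(3)[OF j(1)] by force
        then show "h / 12 \<le> dist u g" using j(2) h by (auto simp: A_def dist_real_def)
      qed
      then show ?thesis using True h by (auto intro: power_mono)
    qed auto
  qed
  finally have "(h / 12)\<^sup>2 * (real J * (m * (h / 6))) \<le> distortion M G"
    using mult_left_mono[OF mU, of "(h / 12)\<^sup>2"] by simp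
  moreover have "(h / 12)\<^sup>2 * (real J * (m * (h / 6))) = m * (d - c) ^ 3 / (864 * (real J)\<^sup>2)"
    using J by (simp add: h_def power2_eq_square power3_eq_cube)
  ultimately show False using small by simp
qed

text \<open>A point of [p1, p3] is within p3 - p1 of the surviving p1. A point outside is closer to
  p1 or to p3 than to p2 and loses nothing.\<close>

lemma distortion_remove:
  assumes sq: "integrable M (\<lambda>u. u\<^sup>2)"
    and p: "p1 \<in> G" "p3 \<in> G" "p1 < p2" "p2 < p3"
  shows "distortion M (G - {p2}) \<le> distortion M G + (p3 - p1)\<^sup>2 * measure M {p1..p3}"
proof -
  have ne: "G \<noteq> {}" "G - {p2} \<noteq> {}" using p by auto
  have pt: "(infdist u (G - {p2}))\<^sup>2 \<le> (infdist u G)\<^sup>2 + (p3 - p1)\<^sup>2 * indicator {p1..p3} u" for u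
  proof (cases "u \<in> {p1..p3}")
    case True
    have "infdist u (G - {p2}) \<le> dist u p1" using p by (intro infdist_le) auto
    also have "\<dots> \<le> p3 - p1" using True by (auto simp: dist_real_def)
    finally have "(infdist u (G - {p2}))\<^sup>2 \<le> (p3 - p1)\<^sup>2" by (intro power_mono infdist_nonneg)
    then show ?thesis using True by (simp add: add_increasing)
  next
    case False
    have "infdist u (G - {p2}) \<le> infdist u G"
    proof (rule infdist_greatest[OF ne(1)])
      fix g assume g: "g \<in> G"
      show "infdist u (G - {p2}) \<le> dist u g"
      proof (cases "g = p2")
        case True
        have "infdist u (G - {p2}) \<le> dist u p1" "infdist u (G - {p2}) \<le> dist u p3"
          using p by (auto intro: infdist_le)
        then show ?thesis using True False p by (auto simp: dist_real_def abs_real_def split: if_splits)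
      qed (use g in \<open>auto intro: infdist_le\<close>)
    qed
    then show ?thesis using False by (simp add: power_mono infdist_nonneg)
  qed
  have i: "integrable M (indicator {p1..p3} :: real \<Rightarrow> real)" by (simp add: integrable_real_indicator emeasure_eq_measure)
  have "distortion M (G - {p2}) \<le> (\<integral>u. (infdist u G)\<^sup>2 + (p3 - p1)\<^sup>2 * indicator {p1..p3} u \<partial>M)"
    unfolding distortion_def
    by (rule integral_mono) (use pt integrable_infdist_sq[OF sq] ne i in auto)
  also have "\<dots> = distortion M G + (p3 - p1)\<^sup>2 * measure M {p1..p3}"
    unfolding distortion_def using integrable_infdist_sq[OF sq ne(1)] i by (subst Bochner_Integration.integral_add) auto
  finally show ?thesis .
qed

text \<open>Within r/4 of the new point the distance drops from at least 3r/4 to at most r/4, and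
  9/16 - 1/16 = 1/2. Only r \<le> \<open>infdist y G\<close> is asked, because in the exchange
  \<open>r\<close> is the distance to the full grid whereas \<open>G\<close> has already lost a
  point.\<close>

lemma distortion_insert:
  assumes sq: "integrable M (\<lambda>u. u\<^sup>2)" and G: "G \<noteq> {}" 
    and r: "r \<le> infdist y G" "0 \<le> r"
  shows "distortion M (insert y G) \<le> distortion M G - r\<^sup>2 / 2 * measure M {y - r / 4<..<y + r / 4}"
proof -
  define A where "A = {y - r / 4<..<y + r / 4}"
  have Am [measurable]: "A \<in> sets borel" by (simp add: A_def)
  have pt: "(infdist u (insert y G))\<^sup>2 \<le> (infdist u G)\<^sup>2 - r\<^sup>2 / 2 * indicator A u" for u
  proof (cases "u \<in> A")
    case True
    have "infdist u (insert y G) \<le> dist u y" by (intro infdist_le) auto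
    also have "dist u y \<le> r / 4" using True unfolding A_def dist_real_def greaterThanLessThan_iff by linarith
    finally have "(infdist u (insert y G))\<^sup>2 \<le> (r / 4)\<^sup>2" by (intro power_mono infdist_nonneg)
    moreover have "infdist y G \<le> infdist u G + dist y u" by (rule infdist_triangle)
    then have "3 * r / 4 \<le> infdist u G" using r \<open>dist u y \<le> r / 4\<close> by (simp add: dist_commute)
    then have "(3 * r / 4)\<^sup>2 \<le> (infdist u G)\<^sup>2" using r by (intro power_mono) auto
    ultimately show ?thesis using True by (simp add: power_divide power_mult_distrib)
  next
    case False
    then show ?thesis by (simp add: power_mono infdist_nonneg infdist_mono[OF _ G] subset_insertI)
  qed
  have i: "integrable M (indicator A :: real \<Rightarrow> real)" by (simp add: integrable_real_indicator emeasure_eq_measure)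
  have "distortion M (insert y G) \<le> (\<integral>u. (infdist u G)\<^sup>2 - r\<^sup>2 / 2 * indicator A u \<partial>M)"
    unfolding distortion_def
    by (rule integral_mono) (use pt integrable_infdist_sq[OF sq] G i in auto)
  also have "\<dots> = distortion M G - r\<^sup>2 / 2 * measure M A"
    unfolding distortion_def using integrable_infdist_sq[OF sq G] i by (subst Bochner_Integration.integral_diff) auto
  finally show ?thesis by (simp add: A_def)
qed

text \<open>
  Removing the middle of three grid points that are \<open>O(1 / N)\<close> apart costs \<open>O(1 / N ^ 3)\<close>. Optimality says that
  putting the freed point at an arbitrary \<open>y\<close> gains no more than that.
\<close>

lemma optimal_set_local_mass:
  assumes \<tau>: "2 < \<tau>" and int: "integrable M (\<lambda>u. \<bar>u\<bar> powr \<tau>)"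
    and sq: "integrable M (\<lambda>u. u\<^sup>2)"
    and db: "density_bounds M c d m b"
  obtains C N0 where "0 \<le> C" "0 < N0"
    "\<And>N G y. N0 \<le> N \<Longrightarrow> optimal_set M N G \<Longrightarrow>
       (infdist y G)\<^sup>2 * measure M {y - infdist y G / 4<..<y + infdist y G / 4} \<le> C / real N ^ 3"
    "\<And>N G. N0 \<le> N \<Longrightarrow> optimal_set M N G \<Longrightarrow> G \<inter> {c..d} \<noteq> {}"
proof -
  obtain C1 where C1: "0 \<le> C1"
    "\<And>N. 2 \<le> N \<Longrightarrow> \<exists>B. finite B \<and> B \<noteq> {} \<and> card B \<le> N \<and> distortion M B \<le> C1 / (real N)\<^sup>2"
    using distortion_le_inverse_square[OF \<tau> int] by blast
  have cd: "c < d" and m: "0 < m" and b: "0 \<le> b" using db by (auto simp: density_bounds_def)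
  \<comment> \<open>With J \<le> N / sqrt R subintervals the threshold of
    \<open>three_grid_points\<close> is at least (C1 + 1) / N^2; the added 1 makes it strictly
    larger than the distortion of an optimal grid.\<close>
  define R where "R = 864 * (C1 + 1) / (m * (d - c) ^ 3)"
  have R: "0 < R" using C1 m cd by (simp add: R_def)
  define \<kappa> where "\<kappa> = 1 / sqrt R"
  have \<kappa>: "0 < \<kappa>" "\<kappa>\<^sup>2 = 1 / R" using R by (auto simp: \<kappa>_def power_divide)
  \<comment> \<open>Once \<kappa> N > 2, rounding down loses at most half, J \<ge> \<kappa> N / 2.
    This is the 2 in \<open>A\<close>.\<close>
  obtain N1 :: nat where N1: "2 / \<kappa> < real N1" using reals_Archimedean2 by blast
  define N0 where "N0 = max N1 2"
  define A where "A = 2 * (d - c) / \<kappa>"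
  have A: "0 \<le> A" using cd \<kappa> by (simp add: A_def)
  define C where "C = 2 * b * A ^ 3"
  have "0 \<le> C" using b A by (simp add: C_def)
  have key: "\<exists>p1 p2 p3. p1 \<in> G \<and> p2 \<in> G \<and> p3 \<in> G \<and> c \<le> p1 \<and> p1 < p2 \<and> p2 < p3 \<and> p3 \<le> d \<and> p3 - p1 \<le> A / real N"
    if N: "N0 \<le> N" and opt: "optimal_set M N G" for N G
  proof -
    have N2: "2 \<le> N" and "N1 \<le> N" using N by (auto simp: N0_def)
    then have "2 / \<kappa> < real N" using N1 by linarith
    then have kN: "2 < \<kappa> * real N" using \<kappa> by (simp add: field_simps)
    define J where "J = nat \<lfloor>\<kappa> * real N\<rfloor>"
    have J: "0 < J" "real J \<le> \<kappa> * real N" "\<kappa> * real N / 2 \<le> real J"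
      using kN unfolding J_def by linarith+
    have "distortion M G \<le> C1 / (real N)\<^sup>2"
      using C1(2)[OF N2] opt unfolding optimal_set_def by (meson order_trans)
    also have "\<dots> < (C1 + 1) / (real N)\<^sup>2" using N2 by (intro divide_strict_right_mono) auto
    also have "\<dots> = m * (d - c) ^ 3 / (864 * (\<kappa> * real N)\<^sup>2)"
      using m cd C1(1) by (simp add: power_mult_distrib \<kappa> R_def) (use N2 in \<open>simp add: field_simps\<close>)
    also have "\<dots> \<le> m * (d - c) ^ 3 / (864 * (real J)\<^sup>2)"
      using J kN m cd N2 \<kappa> by (intro divide_left_mono mult_left_mono power_mono mult_pos_pos zero_less_power) auto
    finally obtain p1 p2 p3 where p: "p1 \<in> G" "p2 \<in> G" "p3 \<in> G" "c \<le> p1" "p1 < p2" "p2 < p3" "p3 \<le> d"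
      "p3 - p1 \<le> (d - c) / real J"
      using three_grid_points[OF sq db _ J(1)] opt unfolding optimal_set_def by metis
    have "(d - c) / real J \<le> (d - c) / (\<kappa> * real N / 2)"
      using J kN cd \<kappa> by (intro divide_left_mono) auto
    also have "\<dots> = A / real N" by (simp add: A_def)
    finally show ?thesis using p by (meson order_trans)
  qed
  have main: "(infdist y G)\<^sup>2 * measure M {y - infdist y G / 4<..<y + infdist y G / 4} \<le> C / real N ^ 3"
    if N: "N0 \<le> N" and opt: "optimal_set M N G" for N G y
  proof -
    obtain p1 p2 p3 where p: "p1 \<in> G" "p2 \<in> G" "p3 \<in> G" "c \<le> p1" "p1 < p2" "p2 < p3" "p3 \<le> d"
      "p3 - p1 \<le> A / real N" using key[OF N opt] by blast
    define r where "r = infdist y G"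
    define B where "B = insert y (G - {p2})"
    have fin: "finite G" and card: "card G \<le> N" using opt by (auto simp: optimal_set_def)
    have "card B \<le> Suc (card (G - {p2}))" unfolding B_def by (rule card_insert_le_m1) (use fin in auto)
    also have "\<dots> = card G" using card_Suc_Diff1[OF fin p(2)] .
    finally have "card B \<le> N" using card by simp
    then have "distortion M G \<le> distortion M B" using opt fin by (auto simp: optimal_set_def B_def)
    also have "\<dots> \<le> distortion M (G - {p2}) - r\<^sup>2 / 2 * measure M {y - r / 4<..<y + r / 4}"
      unfolding B_def
    proof (rule distortion_insert[OF sq])
      show "G - {p2} \<noteq> {}" using p by auto
      then show "r \<le> infdist y (G - {p2})" unfolding r_def by (intro infdist_mono) auto
    qed (simp add: r_def infdist_nonneg)
    also have "distortion M (G - {p2}) \<le> distortion M G + (p3 - p1)\<^sup>2 * measure M {p1..p3}"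
      using distortion_remove[OF sq] p by blast
    finally have "r\<^sup>2 * measure M {y - r / 4<..<y + r / 4} \<le> 2 * ((p3 - p1)\<^sup>2 * measure M {p1..p3})" by simp
    also have "\<dots> \<le> 2 * ((p3 - p1)\<^sup>2 * (b * (p3 - p1)))"
      using db p unfolding density_bounds_def by (intro mult_left_mono) auto
    also have "\<dots> = 2 * b * (p3 - p1) ^ 3" by (simp add: power2_eq_square power3_eq_cube)
    also have "\<dots> \<le> 2 * b * (A / real N) ^ 3"
      using p b by (intro mult_left_mono power_mono) auto
    also have "\<dots> = C / real N ^ 3" by (simp add: C_def power_divide)
    finally show ?thesis by (simp add: r_def)
  qed
  \<comment> \<open>A grid point in a fixed interval later bounds \<open>infdist u G\<close> by |u|
    plus a constant, uniformly over all optimal grids.\<close>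
  have "G \<inter> {c..d} \<noteq> {}" if "N0 \<le> N" "optimal_set M N G" for N G
    using key[OF that] by fastforce
  then show ?thesis using that[of C N0] \<open>0 \<le> C\<close> main by (auto simp: N0_def)
qed

end

section \<open>Local cell size and distortion mismatch\<close>

lemma nn_integral_powr_symmetric:
  fixes \<epsilon> \<eta> g :: real
  assumes "\<eta> < 1" "0 < \<epsilon>"
  shows "(\<integral>\<^sup>+y. ennreal (\<bar>y - g\<bar> powr (-\<eta>) * indicator {-\<epsilon>..\<epsilon>} (y - g)) \<partial>lborel)
           \<le> ennreal (2 * \<epsilon> powr (1 - \<eta>) / (1 - \<eta>))"
proof -
  define h where "h = (\<lambda>t::real. t powr (-\<eta>) * indicator {0..\<epsilon>} t)"
  have h [measurable]: "h \<in> borel_measurable borel" by (simp add: h_def)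
  have "((\<lambda>t. t powr (-\<eta>)) has_integral (\<epsilon> powr (-\<eta> + 1) / (-\<eta> + 1))) {0..\<epsilon>}"
    using assms by (intro has_integral_powr_from_0) auto
  then have "((\<lambda>t. if t \<in> {0..\<epsilon>} then t powr (-\<eta>) else 0) has_integral (\<epsilon> powr (-\<eta> + 1) / (-\<eta> + 1))) UNIV"
    by (subst has_integral_restrict_UNIV)
  also have "(\<lambda>t. if t \<in> {0..\<epsilon>} then t powr (-\<eta>) else 0) = h" by (auto simp: h_def fun_eq_iff)
  finally have hI: "(\<integral>\<^sup>+t. ennreal (h t) \<partial>lborel) = ennreal (\<epsilon> powr (1 - \<eta>) / (1 - \<eta>))"
    by (subst nn_integral_has_integral_lborel) (auto simp: h_def add.commute)
  have shift: "(\<integral>\<^sup>+t. ennreal (h (c * (t - g))) \<partial>lborel) = ennreal (\<epsilon> powr (1 - \<eta>) / (1 - \<eta>))"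
    if "c = 1 \<or> c = -1" for c
  proof -
    have "(\<integral>\<^sup>+t. ennreal (h (c * (t - g))) \<partial>lborel) = (\<integral>\<^sup>+t. ennreal (h (c * ((g + c * t) - g))) \<partial>lborel)"
      by (subst nn_integral_real_affine[where c = c and t = g]) (use that in auto)
    then show ?thesis using hI that by auto
  qed
  have "(\<integral>\<^sup>+y. ennreal (\<bar>y - g\<bar> powr (-\<eta>) * indicator {-\<epsilon>..\<epsilon>} (y - g)) \<partial>lborel)
      \<le> (\<integral>\<^sup>+y. ennreal (h (1 * (y - g))) + ennreal (h (-1 * (y - g))) \<partial>lborel)"
  proof (rule nn_integral_mono)
    fix y
    have "\<bar>y - g\<bar> powr (-\<eta>) * indicator {-\<epsilon>..\<epsilon>} (y - g) \<le> h (1 * (y - g)) + h (-1 * (y - g))"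
      by (cases "g \<le> y") (auto simp: h_def indicator_def abs_real_def)
    moreover have "0 \<le> h t" for t by (simp add: h_def)
    ultimately show "ennreal (\<bar>y - g\<bar> powr (-\<eta>) * indicator {-\<epsilon>..\<epsilon>} (y - g))
        \<le> ennreal (h (1 * (y - g))) + ennreal (h (-1 * (y - g)))"
      by (metis ennreal_leI ennreal_plus)
  qed
  also have "\<dots> = (\<integral>\<^sup>+y. ennreal (h (1 * (y - g))) \<partial>lborel) + (\<integral>\<^sup>+y. ennreal (h (-1 * (y - g))) \<partial>lborel)"
    by (subst nn_integral_add) auto
  also have "\<dots> = ennreal (2 * \<epsilon> powr (1 - \<eta>) / (1 - \<eta>))"
    using assms by (subst (1 2) shift) (auto simp flip: ennreal_plus)
  finally show ?thesis .
qed

lemma nn_integral_weight: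
  assumes "1 < \<kappa>"
  obtains W :: real where "0 \<le> W" "(\<integral>\<^sup>+y. ennreal ((1 + \<bar>y\<bar>) powr (-\<kappa>)) \<partial>lborel) \<le> ennreal W"
proof -
  define h where "h = (\<lambda>t::real. t powr (-\<kappa>) * indicator {1..} t)"
  have h [measurable]: "h \<in> borel_measurable borel" by (simp add: h_def)
  define I where "I = - (1 powr (-\<kappa> + 1)) / (-\<kappa> + 1)"
  have I0: "0 \<le> I" using assms by (simp add: I_def divide_nonpos_neg)
  have "((\<lambda>t. t powr (-\<kappa>)) has_integral I) {1..}"
    unfolding I_def using assms by (intro has_integral_powr_to_inf) auto
  then have "((\<lambda>t. if t \<in> {1..} then t powr (-\<kappa>) else 0) has_integral I) UNIV"
    by (subst has_integral_restrict_UNIV)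
  also have "(\<lambda>t. if t \<in> {1..} then t powr (-\<kappa>) else 0) = h" by (auto simp: h_def fun_eq_iff)
  finally have hI: "(\<integral>\<^sup>+t. ennreal (h t) \<partial>lborel) = ennreal I"
    by (subst nn_integral_has_integral_lborel) (auto simp: h_def)
  have shift: "(\<integral>\<^sup>+t. ennreal (h (1 + c * t)) \<partial>lborel) = ennreal I" if "c = 1 \<or> c = -1" for c
    using hI that by (subst (asm) nn_integral_real_affine[where c = c and t = 1]) auto
  have "(\<integral>\<^sup>+y. ennreal ((1 + \<bar>y\<bar>) powr (-\<kappa>)) \<partial>lborel)
      \<le> (\<integral>\<^sup>+y. ennreal (h (1 + 1 * y)) + ennreal (h (1 + -1 * y)) \<partial>lborel)"
  proof (rule nn_integral_mono)
    fix y :: real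
    have "(1 + \<bar>y\<bar>) powr (-\<kappa>) \<le> h (1 + 1 * y) + h (1 + -1 * y)"
      by (cases "0 \<le> y") (auto simp: h_def indicator_def abs_real_def)
    moreover have "0 \<le> h t" for t by (simp add: h_def)
    ultimately show "ennreal ((1 + \<bar>y\<bar>) powr (-\<kappa>)) \<le> ennreal (h (1 + 1 * y)) + ennreal (h (1 + -1 * y))"
      by (metis ennreal_leI ennreal_plus)
  qed
  also have "\<dots> = (\<integral>\<^sup>+y. ennreal (h (1 + 1 * y)) \<partial>lborel) + (\<integral>\<^sup>+y. ennreal (h (1 + -1 * y)) \<partial>lborel)"
    by (subst nn_integral_add) auto
  also have "\<dots> = ennreal (2 * I)"
    using I0 by (subst (1 2) shift) (auto simp flip: ennreal_plus)
  finally show ?thesis using that[of "2 * I"] I0 by simp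
qed

text \<open>Farther than \<epsilon> from the grid the singular factor is at most
  \<epsilon>^(-\<eta>); closer, it is dominated by a sum of at most \<open>N\<close> single
  singularities, each of integral 2 \<epsilon>^(1 - \<eta>) / (1 - \<eta>). The choice \<epsilon> =
  1/N gives both parts the order N^\<eta>.\<close>

lemma nn_integral_infdist_weight:
  assumes "0 < N" "finite G" "G \<noteq> {}" "card G \<le> N" "0 < \<eta>" "\<eta> < 1" "0 \<le> \<kappa>" "0 \<le> W"
    and W: "(\<integral>\<^sup>+y. ennreal ((1 + \<bar>y\<bar>) powr (-\<kappa>)) \<partial>lborel) \<le> ennreal W"
  shows "(\<integral>\<^sup>+y. ennreal (infdist y G powr (-\<eta>) * (1 + \<bar>y\<bar>) powr (-\<kappa>)) \<partial>lborel)
           \<le> ennreal (real N powr \<eta> * (W + 2 / (1 - \<eta>)))"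
proof -
  define \<epsilon> where "\<epsilon> = 1 / real N"
  have \<epsilon>: "0 < \<epsilon>" using assms by (simp add: \<epsilon>_def)
  define F where "F g y = \<bar>y - g\<bar> powr (-\<eta>) * indicator {-\<epsilon>..\<epsilon>} (y - g)" for g y :: real
  have F0: "0 \<le> F g y" for g y by (simp add: F_def)
  have Fm [measurable]: "F g \<in> borel_measurable borel" for g
    unfolding F_def by measurable
  have pt: "infdist y G powr (-\<eta>) * (1 + \<bar>y\<bar>) powr (-\<kappa>) \<le> real N powr \<eta> * (1 + \<bar>y\<bar>) powr (-\<kappa>) + (\<Sum>g\<in>G. F g y)"
    for y :: real
  proof -
    have w: "0 \<le> (1 + \<bar>y\<bar>) powr (-\<kappa>)" "(1 + \<bar>y\<bar>) powr (-\<kappa>) \<le> 1"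
      using assms by (auto simp: powr_minus inverse_le_1_iff ge_one_powr_ge_zero)
    obtain g where g: "g \<in> G" "infdist y G = dist y g"
      using infdist_finite_attained assms by blast
    show ?thesis
    proof (cases "infdist y G \<le> \<epsilon>")
      case True
      then have "infdist y G powr (-\<eta>) = F g y" by (auto simp: F_def g(2) dist_real_def indicator_def)
      also have "\<dots> \<le> (\<Sum>g\<in>G. F g y)" using g assms F0 by (intro member_le_sum) auto
      finally have "infdist y G powr (-\<eta>) * (1 + \<bar>y\<bar>) powr (-\<kappa>) \<le> (\<Sum>g\<in>G. F g y) * 1"
        using w by (intro mult_mono sum_nonneg F0) auto
      then show ?thesis using w by (simp add: add_increasing)
    next
      case False
      then have "infdist y G powr (-\<eta>) \<le> \<epsilon> powr (-\<eta>)" using \<epsilon> assms by (intro powr_mono2') auto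
      also have "\<dots> = real N powr \<eta>" using assms by (simp add: \<epsilon>_def powr_minus powr_divide)
      finally show ?thesis using w by (simp add: add_increasing2 mult_right_mono sum_nonneg F0)
    qed
  qed
  have "(\<integral>\<^sup>+y. ennreal (infdist y G powr (-\<eta>) * (1 + \<bar>y\<bar>) powr (-\<kappa>)) \<partial>lborel)
     \<le> (\<integral>\<^sup>+y. ennreal (real N powr \<eta>) * ennreal ((1 + \<bar>y\<bar>) powr (-\<kappa>)) + (\<Sum>g\<in>G. ennreal (F g y)) \<partial>lborel)"
  proof (rule nn_integral_mono)
    fix y
    have "ennreal (infdist y G powr (-\<eta>) * (1 + \<bar>y\<bar>) powr (-\<kappa>))
        \<le> ennreal (real N powr \<eta> * (1 + \<bar>y\<bar>) powr (-\<kappa>) + (\<Sum>g\<in>G. F g y))"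
      by (intro ennreal_leI pt)
    also have "\<dots> = ennreal (real N powr \<eta>) * ennreal ((1 + \<bar>y\<bar>) powr (-\<kappa>)) + (\<Sum>g\<in>G. ennreal (F g y))"
      by (simp add: F0 sum_nonneg ennreal_mult)
    finally show "ennreal (infdist y G powr (-\<eta>) * (1 + \<bar>y\<bar>) powr (-\<kappa>)) \<le> \<dots>" .
  qed
  also have "\<dots> = ennreal (real N powr \<eta>) * (\<integral>\<^sup>+y. ennreal ((1 + \<bar>y\<bar>) powr (-\<kappa>)) \<partial>lborel)
       + (\<Sum>g\<in>G. \<integral>\<^sup>+y. ennreal (F g y) \<partial>lborel)"
    by (subst nn_integral_add) (auto simp: nn_integral_cmult nn_integral_sum)
  also have "\<dots> \<le> ennreal (real N powr \<eta>) * ennreal W + (\<Sum>g\<in>G. ennreal (2 * \<epsilon> powr (1 - \<eta>) / (1 - \<eta>)))"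
    unfolding F_def using assms \<epsilon> by (intro add_mono mult_left_mono W sum_mono nn_integral_powr_symmetric) auto
  also have "\<dots> = ennreal (real N powr \<eta> * W + real (card G) * (2 * \<epsilon> powr (1 - \<eta>) / (1 - \<eta>)))"
  proof -
    have "(\<Sum>g\<in>G. ennreal c) = ennreal (real (card G) * c)" if "0 \<le> c" for c
      using that by (subst sum_ennreal) auto
    then have 1: "(\<Sum>g\<in>G. ennreal (2 * \<epsilon> powr (1 - \<eta>) / (1 - \<eta>))) = ennreal (real (card G) * (2 * \<epsilon> powr (1 - \<eta>) / (1 - \<eta>)))"
      using assms by simp
    have 2: "ennreal (real N powr \<eta> * W) = ennreal (real N powr \<eta>) * ennreal W"
      using assms by (intro ennreal_mult) auto
    show ?thesis unfolding 1 2[symmetric] using assms by (intro ennreal_plus[symmetric]) auto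
  qed
  also have "\<dots> \<le> ennreal (real N powr \<eta> * (W + 2 / (1 - \<eta>)))"
  proof (rule ennreal_leI)
    have "real (card G) * (2 * \<epsilon> powr (1 - \<eta>) / (1 - \<eta>)) \<le> real N * (2 * \<epsilon> powr (1 - \<eta>) / (1 - \<eta>))"
      using assms by (intro mult_right_mono) auto
    also have "\<dots> = real N * \<epsilon> powr (1 - \<eta>) * (2 / (1 - \<eta>))" by simp
    also have "real N * \<epsilon> powr (1 - \<eta>) = real N powr \<eta>"
      using assms by (simp add: \<epsilon>_def powr_divide powr_diff)
    finally show "real N powr \<eta> * W + real (card G) * (2 * \<epsilon> powr (1 - \<eta>) / (1 - \<eta>)) \<le> real N powr \<eta> * (W + 2 / (1 - \<eta>))"
      by (simp add: algebra_simps)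
  qed
  finally show ?thesis .
qed

text \<open>The split is at x = v^(\<tau>/s). Below it x^s is at most v^\<tau>; above it the surplus
  power x^(s' - s) is at least v^(\<tau> (s' - s)/s) and pays for the weight.\<close>

lemma powr_le_weighted:
  fixes x v s s' \<tau> :: real
  assumes "0 \<le> x" "1 \<le> v" "0 < s" "s < s'" "0 < \<tau>"
  shows "x powr s \<le> x powr s' * v powr (-(\<tau> * (s' - s) / s)) + v powr \<tau>"
proof (cases "x \<le> v powr (\<tau> / s)")
  case True
  then have "x powr s \<le> (v powr (\<tau> / s)) powr s" using assms by (intro powr_mono2) auto
  also have "\<dots> = v powr \<tau>" using assms by (simp add: powr_powr)
  finally show ?thesis by (simp add: add_increasing)
next
  case False
  then have x: "0 < x" using assms by (metis less_eq_real_def not_le powr_ge_zero order_trans)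
  have "v powr (\<tau> * (s' - s) / s) = (v powr (\<tau> / s)) powr (s' - s)" by (simp add: powr_powr)
  also have "\<dots> \<le> x powr (s' - s)" using False assms by (intro powr_mono2) auto
  finally have "x powr s * v powr (\<tau> * (s' - s) / s) \<le> x powr s * x powr (s' - s)"
    by (intro mult_left_mono) auto
  also have "\<dots> = x powr s'" by (simp flip: powr_add)
  finally have "x powr s \<le> x powr s' * v powr (-(\<tau> * (s' - s) / s))"
    using assms by (simp add: powr_minus field_simps)
  then show ?thesis by (simp add: add_increasing2)
qed

section \<open>Pointwise and integrated consequences of the local mass inequality\<close>

context real_distribution
begin

text \<open>A ball of radius r/4 inside [c, d] has mass at least m r / 2, so the mass inequality
  becomes m r^3 / 2 \<le> C / N^3. Taking A = 2 C / m + 1 \<ge> 1 gives A^3 \<ge> 2 C / m without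
  cube roots.\<close>

lemma infdist_le_of_local_mass:
  assumes db: "density_bounds M c d m b" and \<rho>: "0 < \<rho>" and C: "0 \<le> C" and N: "0 < N"
    and mass: "(infdist y G)\<^sup>2 * measure M {y - infdist y G / 4<..<y + infdist y G / 4} \<le> C / real N ^ 3"
    and y: "c + \<rho> \<le> y" "y \<le> d - \<rho>" and big: "2 * C / m + 1 < \<rho> * real N"
  shows "infdist y G \<le> (2 * C / m + 1) / real N"
proof (rule ccontr)
  assume neg: "\<not> ?thesis"
  define A where "A = 2 * C / m + 1"
  have m: "0 < m" using db by (simp add: density_bounds_def)
  have A: "1 \<le> A" using C m by (simp add: A_def)
  \<comment> \<open>Truncation at \<rho> keeps the ball inside [c, d]. By \<open>big\<close>, A / N
    < \<rho>, so the truncated radius still exceeds A / N.\<close>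
  define r where "r = min (infdist y G) \<rho>"
  have r: "A / real N < r" "r \<le> infdist y G" "r \<le> \<rho>"
    using neg big N by (auto simp: r_def A_def field_simps)
  have r0: "0 < r" using A N r(1) by (meson divide_pos_pos less_trans of_nat_0_less_iff zero_less_one less_le_trans)
  have "c \<le> y - r / 4" "y - r / 4 \<le> y + r / 4" "y + r / 4 \<le> d"
    using r r0 y \<rho> by linarith+
  then have "m * ((y + r / 4) - (y - r / 4)) \<le> measure M {y - r / 4<..<y + r / 4}"
    using db unfolding density_bounds_def by blast
  then have "m * (r / 2) \<le> measure M {y - r / 4<..<y + r / 4}" by simp
  also have "\<dots> \<le> measure M {y - infdist y G / 4<..<y + infdist y G / 4}"
    using r by (intro finite_measure_mono) auto
  finally have "r\<^sup>2 * (m * (r / 2)) \<le> (infdist y G)\<^sup>2 * measure M {y - infdist y G / 4<..<y + infdist y G / 4}"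
    using r r0 m by (intro mult_mono power_mono) auto
  also note mass
  finally have "m * r ^ 3 / 2 \<le> C / real N ^ 3" by (simp add: power2_eq_square power3_eq_cube algebra_simps)
  then have "r ^ 3 * m \<le> 2 * (C / real N ^ 3)" by (simp add: mult.commute)
  then have "r ^ 3 \<le> 2 * (C / real N ^ 3) / m" using m by (simp only: pos_le_divide_eq)
  also have "\<dots> = (2 * C / m) / real N ^ 3" by simp
  finally have "r ^ 3 \<le> (2 * C / m) / real N ^ 3" .
  also have "\<dots> \<le> A ^ 3 / real N ^ 3"
  proof (rule divide_right_mono)
    have "2 * C / m \<le> A * 1" by (simp add: A_def)
    also have "\<dots> \<le> A ^ 3" using A by (simp add: self_le_power)
    finally show "2 * C / m \<le> A ^ 3" .
  qed simp
  also have "\<dots> = (A / real N) ^ 3" by (simp add: power_divide)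
  also have "\<dots> < r ^ 3" using r A N by (intro power_strict_mono) auto
  finally show False by simp
qed

text \<open>With t = A/N there are grid points within t of a, of a + 3t and of a - 3t. The last two
  lie on opposite sides of \<open>p\<close>, because |a - p| \<le> t, and a point for which
  \<open>p\<close> is nearest cannot pass the midpoints towards them.\<close>

lemma optimal_set_local_cell:
  assumes db: "density_bounds M c d m b" and a: "c < a" "a < d" and C: "0 \<le> C"
    and mass: "\<And>N G y. N0 \<le> N \<Longrightarrow> optimal_set M N G \<Longrightarrow>
       (infdist y G)\<^sup>2 * measure M {y - infdist y G / 4<..<y + infdist y G / 4} \<le> C / real N ^ 3"
  obtains A N1 where "0 < A" "\<And>N G p u. N1 \<le> N \<Longrightarrow> optimal_set M N G \<Longrightarrow> p \<in> G \<Longrightarrow>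
     \<bar>a - p\<bar> = infdist a G \<Longrightarrow> \<bar>u - p\<bar> = infdist u G \<Longrightarrow> \<bar>u - a\<bar> \<le> A / real N"
proof -
  \<comment> \<open>The margin 2\<rho> around \<open>a\<close> is spent twice: one \<rho> for the
    shift by 3t, one for the distance to the ends required by
    \<open>infdist_le_of_local_mass\<close>.\<close>
  define \<rho> where "\<rho> = min (a - c) (d - a) / 2"
  have \<rho>: "0 < \<rho>" "c + 2 * \<rho> \<le> a" "a \<le> d - 2 * \<rho>" using a by (auto simp: \<rho>_def)
  have m: "0 < m" using db by (simp add: density_bounds_def)
  define A where "A = 2 * C / m + 1"
  have A: "1 \<le> A" using C m by (simp add: A_def)
  obtain N2 :: nat where N2: "3 * A / \<rho> < real N2" using reals_Archimedean2 by blast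
  define N1 where "N1 = max (max N0 N2) 1"
  have "\<bar>u - a\<bar> \<le> 4 * A / real N"
    if N: "N1 \<le> N" and opt: "optimal_set M N G" and p: "p \<in> G" "\<bar>a - p\<bar> = infdist a G" "\<bar>u - p\<bar> = infdist u G" for N G p u
  proof -
    have N': "N0 \<le> N" "0 < N" "N2 \<le> N" using N by (auto simp: N1_def)
    have "3 * A / \<rho> < real N" using N2 N' by linarith
    then have big: "3 * A < \<rho> * real N" using \<rho> by (simp add: field_simps)
    define t where "t = A / real N"
    have t: "0 < t" "3 * t \<le> \<rho>" using A N' big by (auto simp: t_def field_simps)
    have ne: "finite G" "G \<noteq> {}" using opt by (auto simp: optimal_set_def)
    have near: "infdist y G \<le> t" if "c + \<rho> \<le> y" "y \<le> d - \<rho>" for y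
      unfolding t_def A_def
      using infdist_le_of_local_mass[OF db \<rho>(1) C N'(2) mass[OF N'(1) opt] that] big A by (simp add: A_def)
    have pa: "\<bar>a - p\<bar> \<le> t" using near[of a] \<rho> p by simp
    have "infdist (a + 3 * t) G \<le> t" using near[of "a + 3 * t"] t \<rho> by linarith
    then obtain q where q: "q \<in> G" "\<bar>a + 3 * t - q\<bar> \<le> t"
      using infdist_finite_attained[OF ne, of "a + 3 * t"] by (metis dist_real_def)
    have "infdist (a - 3 * t) G \<le> t" using near[of "a - 3 * t"] t \<rho> by linarith
    then obtain q' where q': "q' \<in> G" "\<bar>a - 3 * t - q'\<bar> \<le> t"
      using infdist_finite_attained[OF ne, of "a - 3 * t"] by (metis dist_real_def)
    have "\<bar>u - p\<bar> \<le> \<bar>u - q\<bar>" "\<bar>u - p\<bar> \<le> \<bar>u - q'\<bar>"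
      using infdist_le[OF q(1), of u] infdist_le[OF q'(1), of u] p(3) by (auto simp: dist_real_def)
    then have "\<bar>u - a\<bar> \<le> 4 * t" using q(2) q'(2) pa t(1) by linarith
    then show ?thesis by (simp add: t_def)
  qed
  then show ?thesis using that[of "4 * A" N1] A by simp
qed

text \<open>
  The hypothesis on the balls is multiplied by \<open>infdist y G powr (s - 3) * (1 + \<bar>y\<bar>) powr (-\<kappa>)\<close> and integrated
  over \<open>y\<close>. By Fubini the left side dominates the weighted moment, since \<open>infdist\<close> varies little on
  a ball of radius \<open>infdist u G / 5\<close> around \<open>u\<close>; the right side converges because \<open>s - 3 > -1\<close>.
\<close>

lemma weighted_mismatch:
  assumes s: "2 < s" "s < 3" and \<kappa>: "1 < \<kappa>" and C: "0 \<le> C" and c0: "0 \<le> c0"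
  obtains C' where "0 \<le> C'"
    "\<And>N G. 0 < N \<Longrightarrow> finite G \<Longrightarrow> G \<noteq> {} \<Longrightarrow> card G \<le> N \<Longrightarrow> (\<And>u. infdist u G \<le> \<bar>u\<bar> + c0) \<Longrightarrow>
      (\<And>y. (infdist y G)\<^sup>2 * measure M {y - infdist y G / 4<..<y + infdist y G / 4} \<le> C / real N ^ 3) \<Longrightarrow>
      (\<integral>\<^sup>+u. ennreal ((real N * infdist u G) powr s * (1 + \<bar>u\<bar>) powr (-\<kappa>)) \<partial>M) \<le> ennreal C'"
proof -
  obtain W where W: "0 \<le> W" "(\<integral>\<^sup>+y. ennreal ((1 + \<bar>y\<bar>) powr (-\<kappa>)) \<partial>lborel) \<le> ennreal W"
    using nn_integral_weight[OF \<kappa>] by blast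
  \<comment> \<open>The factors come from comparing \<open>y\<close> with \<open>u\<close> when |u -
    y| < D u / 5: D y \<ge> 4/5 D u, 1 + |y| \<le> (2 + c0) (1 + |u|), and 2/5 D u is the length of
    the interval of such \<open>y\<close>.\<close>
  define k where "k = (4 / 5) powr (s - 1) * (2 + c0) powr (-\<kappa>) * (2 / 5)"
  have k: "0 < k" using c0 by (simp add: k_def)
  define C' where "C' = C * (W + 2 / (s - 2)) / k"
  have "0 \<le> C'" using C W s k by (simp add: C'_def)
  moreover have "(\<integral>\<^sup>+u. ennreal ((real N * infdist u G) powr s * (1 + \<bar>u\<bar>) powr (-\<kappa>)) \<partial>M) \<le> ennreal C'"
    if N: "0 < N" and G: "finite G" "G \<noteq> {}" "card G \<le> N" and lin: "\<And>u. infdist u G \<le> \<bar>u\<bar> + c0"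
      and mass: "\<And>y. (infdist y G)\<^sup>2 * measure M {y - infdist y G / 4<..<y + infdist y G / 4} \<le> C / real N ^ 3"
    for N :: nat and G
  proof -
    define D where "D u = infdist u G" for u
    have D0: "0 \<le> D u" for u by (simp add: D_def infdist_nonneg)
    have Dm [measurable]: "D \<in> borel_measurable borel" unfolding D_def by measurable
    define w where "w u = (1 + \<bar>u\<bar>) powr (-\<kappa>)" for u :: real
    have w0: "0 \<le> w u" for u by (simp add: w_def)
    have wm [measurable]: "w \<in> borel_measurable borel" unfolding w_def by measurable
    \<comment> \<open>The exponent s - 1 is the 2 of the mass inequality plus the s - 3 of the
      multiplier. The same kernel is integrated in \<open>u\<close> for an upper bound and in
      \<open>y\<close> for a lower bound.\<close>
    define \<Phi> where "\<Phi> y u = (if \<bar>u - y\<bar> < D y / 4 then ennreal (D y powr (s - 1) * w y) else 0)" for y u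
    interpret P: pair_sigma_finite lborel M ..
    have \<Phi>m [measurable]: "(\<lambda>(y, u). \<Phi> y u) \<in> borel_measurable (lborel \<Otimes>\<^sub>M M)"
      unfolding \<Phi>_def by measurable
    have inner_y: "(\<integral>\<^sup>+u. \<Phi> y u \<partial>M) \<le> ennreal (C / real N ^ 3) * ennreal (D y powr (-(3 - s)) * w y)" for y
    proof -
      have "(\<integral>\<^sup>+u. \<Phi> y u \<partial>M) = (\<integral>\<^sup>+u. ennreal (D y powr (s - 1) * w y) * indicator {y - D y / 4<..<y + D y / 4} u \<partial>M)"
      proof (rule nn_integral_cong)
        fix u
        have "u \<in> {y - D y / 4<..<y + D y / 4} \<longleftrightarrow> \<bar>u - y\<bar> < D y / 4"
          unfolding greaterThanLessThan_iff by linarith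
        then show "\<Phi> y u = ennreal (D y powr (s - 1) * w y) * indicator {y - D y / 4<..<y + D y / 4} u"
          by (simp add: \<Phi>_def indicator_def)
      qed
      also have "\<dots> = ennreal (D y powr (s - 1) * w y) * emeasure M {y - D y / 4<..<y + D y / 4}"
        by (subst nn_integral_cmult_indicator) auto
      also have "\<dots> = ennreal (D y powr (s - 1) * w y * measure M {y - D y / 4<..<y + D y / 4})"
        by (simp add: emeasure_eq_measure ennreal_mult w0)
      also have "\<dots> \<le> ennreal (C / real N ^ 3 * (D y powr (-(3 - s)) * w y))"
      proof (rule ennreal_leI)
        show "D y powr (s - 1) * w y * measure M {y - D y / 4<..<y + D y / 4} \<le> C / real N ^ 3 * (D y powr (-(3 - s)) * w y)"
        proof (cases "D y = 0")
          case False
          then have "0 < D y" using D0[of y] by linarith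
          then have "(D y)\<^sup>2 * D y powr (-(3 - s)) = D y powr 2 * D y powr (-(3 - s))" by simp
          also have "\<dots> = D y powr (s - 1)" unfolding powr_add[symmetric] by simp
          finally have "D y powr (s - 1) = (D y)\<^sup>2 * D y powr (-(3 - s))" ..
          then have "D y powr (s - 1) * w y * measure M {y - D y / 4<..<y + D y / 4}
             = ((D y)\<^sup>2 * measure M {y - D y / 4<..<y + D y / 4}) * (D y powr (-(3 - s)) * w y)" by simp
          also have "\<dots> \<le> C / real N ^ 3 * (D y powr (-(3 - s)) * w y)"
            using mass[of y] by (intro mult_right_mono) (auto simp: D_def w0)
          finally show ?thesis .
        qed auto
      qed
      also have "\<dots> = ennreal (C / real N ^ 3) * ennreal (D y powr (-(3 - s)) * w y)"
        using C w0 by (intro ennreal_mult) auto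
      finally show ?thesis .
    qed
    have inner_u: "ennreal (k * (D u powr s * w u)) \<le> (\<integral>\<^sup>+y. \<Phi> y u \<partial>lborel)" for u
    proof -
      \<comment> \<open>\<open>v\<close> bounds the kernel from below for |u - y| < D u / 5. The
        distance is 1-Lipschitz, so there D y > 4/5 D u and hence |u - y| < D y / 4: radius 1/5 seen
        from \<open>u\<close> corresponds to 1/4 seen from \<open>y\<close>.\<close>
      define v where "v = (4 / 5 * D u) powr (s - 1) * ((2 + c0) powr (-\<kappa>) * w u)"
      have v0: "0 \<le> v" by (simp add: v_def w0)
      have "ennreal (k * (D u powr s * w u)) = ennreal (v * (2 / 5 * D u))"
      proof -
        have "D u powr s = D u powr (s - 1) * D u"
          using D0[of u] by (cases "D u = 0") (auto simp: powr_diff)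
        moreover have "(4 / 5 * D u) powr (s - 1) = (4 / 5) powr (s - 1) * D u powr (s - 1)"
          by (rule powr_mult)
        ultimately show ?thesis unfolding k_def v_def by (simp only: mult_ac)
      qed
      also have "\<dots> = (\<integral>\<^sup>+y. ennreal v * indicator {u - D u / 5<..<u + D u / 5} y \<partial>lborel)"
      proof -
        have "emeasure lborel {u - D u / 5<..<u + D u / 5} = ennreal (2 / 5 * D u)"
          using D0[of u] by simp
        then show ?thesis
          using v0 D0[of u] by (subst nn_integral_cmult_indicator) (auto simp only: ennreal_mult sets_lborel borel_open open_greaterThanLessThan zero_le_mult_iff zero_le_divide_iff zero_le_numeral simp_thms)
      qed
      also have "\<dots> \<le> (\<integral>\<^sup>+y. \<Phi> y u \<partial>lborel)"
      proof (rule nn_integral_mono)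
        fix y
        show "ennreal v * indicator {u - D u / 5<..<u + D u / 5} y \<le> \<Phi> y u"
        proof (cases "y \<in> {u - D u / 5<..<u + D u / 5}")
          case True
          then have yu: "\<bar>u - y\<bar> < D u / 5" unfolding greaterThanLessThan_iff by linarith
          have "D u \<le> D y + \<bar>u - y\<bar>"
            unfolding D_def using infdist_triangle[of u G y] by (simp add: dist_real_def)
          then have Dy: "4 / 5 * D u \<le> D y" "\<bar>u - y\<bar> < D y / 4" using yu by linarith+
          have "1 + \<bar>y\<bar> \<le> (2 + c0) * (1 + \<bar>u\<bar>)"
          proof -
            have "\<bar>y\<bar> \<le> \<bar>u\<bar> + (\<bar>u\<bar> + c0) / 5"
            proof -
              have "\<bar>y\<bar> \<le> \<bar>u\<bar> + \<bar>u - y\<bar>" by linarith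
              moreover have "\<bar>u - y\<bar> < (\<bar>u\<bar> + c0) / 5" using yu lin[of u] unfolding D_def by simp
              ultimately show ?thesis by (metis add_left_mono less_imp_le order_trans)
            qed
            moreover have "0 \<le> c0 * \<bar>u\<bar>" using c0 by simp
            moreover have "1 + Y \<le> (2 + c0) * (1 + U)" if "Y \<le> U + (U + c0) / 5" "0 \<le> U" "0 \<le> c0 * U" for Y U
            proof -
              have "(2 + c0) * (1 + U) = 2 + 2 * U + c0 + c0 * U" by (simp add: algebra_simps)
              moreover have "5 * Y \<le> 6 * U + c0" using that(1) by (simp add: field_simps)
              moreover have "1 + Y \<le> 2 + 2 * U + c0 + P" if "5 * Y \<le> 6 * U + c0" "0 \<le> U" "0 \<le> P" for P
                using that c0 by linarith
              ultimately show ?thesis using that by metis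
            qed
            ultimately show ?thesis by simp
          qed
          then have "((2 + c0) * (1 + \<bar>u\<bar>)) powr (-\<kappa>) \<le> w y"
            unfolding w_def using \<kappa> by (intro powr_mono2') auto
          then have "(2 + c0) powr (-\<kappa>) * w u \<le> w y" by (simp add: w_def powr_mult c0)
          then have "v \<le> D y powr (s - 1) * w y"
            unfolding v_def using s Dy D0[of u] w0 by (intro mult_mono powr_mono2) auto
          then show ?thesis using True Dy(2) by (auto simp: \<Phi>_def intro: ennreal_leI)
        qed auto
      qed
      finally show ?thesis .
    qed
    have "(\<integral>\<^sup>+u. ennreal (k * (D u powr s * w u)) \<partial>M) \<le> (\<integral>\<^sup>+u. (\<integral>\<^sup>+y. \<Phi> y u \<partial>lborel) \<partial>M)"
      by (intro nn_integral_mono inner_u)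
    also have "\<dots> = (\<integral>\<^sup>+y. (\<integral>\<^sup>+u. \<Phi> y u \<partial>M) \<partial>lborel)" using P.Fubini'[OF \<Phi>m] .
    also have "\<dots> \<le> (\<integral>\<^sup>+y. ennreal (C / real N ^ 3) * ennreal (D y powr (-(3 - s)) * w y) \<partial>lborel)"
      by (intro nn_integral_mono inner_y)
    also have "\<dots> = ennreal (C / real N ^ 3) * (\<integral>\<^sup>+y. ennreal (D y powr (-(3 - s)) * w y) \<partial>lborel)"
      by (rule nn_integral_cmult) simp
    also have "\<dots> \<le> ennreal (C / real N ^ 3) * ennreal (real N powr (3 - s) * (W + 2 / (1 - (3 - s))))"
      unfolding D_def w_def using s \<kappa> W
      by (intro mult_left_mono nn_integral_infdist_weight N G) auto
    \<comment> \<open>N^(-3) from the mass inequality times N^(3 - s) from the singular integral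
      leaves N^(-s), which is cancelled by scaling the distance with \<open>N\<close>.\<close>
    also have "\<dots> = ennreal (k * (C' * real N powr (-s)))"
    proof -
      have "real N powr (3 - s) = real N ^ 3 * real N powr (-s)"
        using N by (simp add: powr_diff powr_minus field_simps)
      then have "C / real N ^ 3 * (real N powr (3 - s) * (W + 2 / (1 - (3 - s)))) = k * (C' * real N powr (-s))"
        using N k by (simp add: C'_def)
      then show ?thesis using C W s by (simp flip: ennreal_mult)
    qed
    finally have *: "(\<integral>\<^sup>+u. ennreal (k * (D u powr s * w u)) \<partial>M) \<le> ennreal (k * (C' * real N powr (-s)))" .
    have "(\<integral>\<^sup>+u. ennreal ((real N * D u) powr s * w u) \<partial>M)
        = (\<integral>\<^sup>+u. ennreal (real N powr s / k) * ennreal (k * (D u powr s * w u)) \<partial>M)"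
      using k by (intro nn_integral_cong) (simp add: powr_mult D0 w0 flip: ennreal_mult)
    also have "\<dots> = ennreal (real N powr s / k) * (\<integral>\<^sup>+u. ennreal (k * (D u powr s * w u)) \<partial>M)"
      by (rule nn_integral_cmult) simp
    also have "\<dots> \<le> ennreal (real N powr s / k) * ennreal (k * (C' * real N powr (-s)))"
      by (intro mult_left_mono *) auto
    also have "\<dots> = ennreal C'"
      using k N \<open>0 \<le> C'\<close> by (simp add: powr_minus flip: ennreal_mult)
    finally show ?thesis by (simp add: D_def w_def)
  qed
  ultimately show ?thesis using that by blast
qed

text \<open>The weighted bound is applied with an exponent s' > s, and
  \<open>powr_le_weighted\<close> trades the excess for the weight with \<kappa> = \<tau> (s' -
  s)/s. The requirement \<kappa> > 1 means s' > s + s/\<tau>, which is compatible with s' < 3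
  precisely when \<tau> > s/(3 - s).\<close>

lemma optimal_set_mismatch:
  assumes s: "2 < s" "s < 3" and \<tau>: "s / (3 - s) < \<tau>"
    and int: "integrable M (\<lambda>u. \<bar>u\<bar> powr \<tau>)"
    and C: "0 \<le> C" "0 < N0"
    and mass: "\<And>N G y. N0 \<le> N \<Longrightarrow> optimal_set M N G \<Longrightarrow>
       (infdist y G)\<^sup>2 * measure M {y - infdist y G / 4<..<y + infdist y G / 4} \<le> C / real N ^ 3"
    and meet: "\<And>N G. N0 \<le> N \<Longrightarrow> optimal_set M N G \<Longrightarrow> G \<inter> {c..d} \<noteq> {}"
  obtains C' where "0 \<le> C'"
    "\<And>N G. N0 \<le> N \<Longrightarrow> optimal_set M N G \<Longrightarrow> integrable M (\<lambda>u. (real N * infdist u G) powr s)"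
    "\<And>N G. N0 \<le> N \<Longrightarrow> optimal_set M N G \<Longrightarrow> (\<integral>u. (real N * infdist u G) powr s \<partial>M) \<le> C'"
proof -
  have "s < \<tau>" using s \<tau> by (smt (verit) divide_le_eq_1_pos frac_le div_by_1)
  then have \<tau>0: "0 < \<tau>" "s / \<tau> < 3 - s" using s \<tau> by (auto simp: field_simps)
  define s' where "s' = (3 + (s + s / \<tau>)) / 2"
  have s': "s + s / \<tau> < s'" "s' < 3"
  proof -
    have "x < (3 + x) / 2 \<and> (3 + x) / 2 < 3" if "x < 3" for x :: real using that by simp
    moreover have "s + s / \<tau> < 3" using \<tau>0(2) by (simp add: less_diff_eq add.commute)
    ultimately show "s + s / \<tau> < s'" "s' < 3" unfolding s'_def by blast+
  qed
  have "0 < s / \<tau>" using s \<tau>0 by simp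
  then have s'2: "s < s'" using s' by linarith
  define \<kappa> where "\<kappa> = \<tau> * (s' - s) / s"
  have \<kappa>: "1 < \<kappa>" using s' s \<tau>0 by (simp add: \<kappa>_def field_simps)
  \<comment> \<open>Every point of [c, d] has absolute value at most \<open>c0\<close>, and by
    \<open>meet\<close> the grid has a point there.\<close>
  define c0 where "c0 = \<bar>c\<bar> + \<bar>d\<bar>"
  obtain C1 where C1: "0 \<le> C1" "\<And>N G. 0 < N \<Longrightarrow> finite G \<Longrightarrow> G \<noteq> {} \<Longrightarrow> card G \<le> N \<Longrightarrow> (\<And>u. infdist u G \<le> \<bar>u\<bar> + c0) \<Longrightarrow>
      (\<And>y. (infdist y G)\<^sup>2 * measure M {y - infdist y G / 4<..<y + infdist y G / 4} \<le> C / real N ^ 3) \<Longrightarrow>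
      (\<integral>\<^sup>+u. ennreal ((real N * infdist u G) powr s' * (1 + \<bar>u\<bar>) powr (-\<kappa>)) \<partial>M) \<le> ennreal C1"
    using weighted_mismatch[of s' \<kappa> C c0] s s' s'2 \<kappa> C by (auto simp: c0_def)
  have it: "integrable M (\<lambda>u. (1 + \<bar>u\<bar>) powr \<tau>)" using integrable_powr_mono[OF int, of \<tau>] \<tau>0 by simp
  define T where "T = (\<integral>u. (1 + \<bar>u\<bar>) powr \<tau> \<partial>M)"
  have T0: "0 \<le> T" by (simp add: T_def)
  have TI: "(\<integral>\<^sup>+u. ennreal ((1 + \<bar>u\<bar>) powr \<tau>) \<partial>M) = ennreal T"
    unfolding T_def using it by (intro nn_integral_eq_integral) auto
  have main: "(\<integral>\<^sup>+u. ennreal ((real N * infdist u G) powr s) \<partial>M) \<le> ennreal (C1 + T)"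
    if N: "N0 \<le> N" and opt: "optimal_set M N G" for N G
  proof -
    obtain p where p: "p \<in> G" "c \<le> p" "p \<le> d" using meet[OF N opt] by auto
    have lin: "infdist u G \<le> \<bar>u\<bar> + c0" for u
      using infdist_le[OF p(1), of u] p(2,3) by (simp add: dist_real_def c0_def)
    have "(\<integral>\<^sup>+u. ennreal ((real N * infdist u G) powr s) \<partial>M)
      \<le> (\<integral>\<^sup>+u. ennreal ((real N * infdist u G) powr s' * (1 + \<bar>u\<bar>) powr (-\<kappa>)) + ennreal ((1 + \<bar>u\<bar>) powr \<tau>) \<partial>M)"
    proof (rule nn_integral_mono)
      fix u :: real
      have "(real N * infdist u G) powr s \<le> (real N * infdist u G) powr s' * (1 + \<bar>u\<bar>) powr (-\<kappa>) + (1 + \<bar>u\<bar>) powr \<tau>"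
        unfolding \<kappa>_def using s s'2 \<tau>0 by (intro powr_le_weighted) (auto simp: infdist_nonneg)
      then show "ennreal ((real N * infdist u G) powr s) \<le> ennreal ((real N * infdist u G) powr s' * (1 + \<bar>u\<bar>) powr (-\<kappa>)) + ennreal ((1 + \<bar>u\<bar>) powr \<tau>)"
        by (simp flip: ennreal_plus add: ennreal_leI)
    qed
    also have "\<dots> = (\<integral>\<^sup>+u. ennreal ((real N * infdist u G) powr s' * (1 + \<bar>u\<bar>) powr (-\<kappa>)) \<partial>M) + ennreal T"
      by (subst nn_integral_add) (auto simp: TI)
    also have "\<dots> \<le> ennreal C1 + ennreal T"
      using opt N C(2) by (intro add_right_mono C1(2) lin mass[OF N opt]) (auto simp: optimal_set_def)
    finally show ?thesis using C1 T0 by (simp add: ennreal_plus)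
  qed
  have I: "integrable M (\<lambda>u. (real N * infdist u G) powr s)" if "N0 \<le> N" "optimal_set M N G" for N G
    using main[OF that] by (intro integrableI_bounded) (auto intro: le_less_trans)
  have "(\<integral>u. (real N * infdist u G) powr s \<partial>M) \<le> C1 + T" if "N0 \<le> N" "optimal_set M N G" for N G
  proof -
    have "ennreal (\<integral>u. (real N * infdist u G) powr s \<partial>M) \<le> ennreal (C1 + T)"
      using main[OF that] nn_integral_eq_integral[OF I[OF that]] by simp
    then show ?thesis using C1(1) T0 by (subst (asm) ennreal_le_iff) auto
  qed
  then show ?thesis using that[of "C1 + T"] I C1 T0 by simp
qed

end

section \<open>Weighted Hoelder pieces\<close>

text \<open>
  The function \<open>t \<mapsto> \<bar>F' t\<bar> * t powr (1 - \<alpha>) + B * t powr (1 - \<beta>)\<close> does not decrease when \<open>t\<close> is doubled,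
  so it is bounded near \<open>0\<close>; hence \<open>\<bar>F' t\<bar> = O(t powr (\<alpha> - 1))\<close>.
\<close>

lemma holder_at_endpoint:
  fixes F F' g :: "real \<Rightarrow> real"
  assumes b: "0 < b" and \<alpha>: "0 < \<alpha>" "\<alpha> \<le> 1" and \<beta>: "0 \<le> \<beta>" "\<beta> < 1" and L: "0 \<le> L" and C: "0 \<le> C"
    and cont: "continuous_on {0..<b} F"
    and der: "\<And>t. 0 < t \<Longrightarrow> t < b \<Longrightarrow> (F has_real_derivative F' t) (at t)"
    and hol: "\<And>s t. 0 < s \<Longrightarrow> s < b \<Longrightarrow> 0 < t \<Longrightarrow> t < b \<Longrightarrow> \<bar>F' s - F' t\<bar> \<le> L * \<bar>s - t\<bar> powr \<alpha> * (g s + g t)"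
    and g: "\<And>t. 0 < t \<Longrightarrow> t < b \<Longrightarrow> g t \<le> C * t powr (-\<beta>)"
    and g0: "\<And>t. 0 < t \<Longrightarrow> t < b \<Longrightarrow> 0 \<le> g t"
  obtains K where "0 \<le> K" "\<And>t. 0 \<le> t \<Longrightarrow> t < b / 2 \<Longrightarrow> \<bar>F t - F 0\<bar> \<le> K * t powr \<alpha>"
proof -
  define D where "D = 2 * L * C"
  have D: "0 \<le> D" using L C by (simp add: D_def)
  have "(2::real) powr 0 < 2 powr (1 - \<beta>)" using \<beta> by (intro powr_less_mono) auto
  then have two: "1 < (2::real) powr (1 - \<beta>)" by simp
  \<comment> \<open>\<open>B\<close> solves B 2^(1 - \<beta>) = B + D: doubling \<open>t\<close>
    raises the second term of \<sigma> by exactly D t^(1 - \<beta>), the loss allowed by the Hoelder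
    condition between t and 2t. Here \<beta> < 1 makes the denominator positive.\<close>
  define B where "B = D / (2 powr (1 - \<beta>) - 1)"
  have B: "0 \<le> B" "B * 2 powr (1 - \<beta>) = B + D" 
  proof -
    show "0 \<le> B" using D two by (simp add: B_def)
    have "B * (2 powr (1 - \<beta>) - 1) = D" using two \<beta> by (simp add: B_def)
    then show "B * 2 powr (1 - \<beta>) = B + D" by (simp add: right_diff_distrib)
  qed
  define \<sigma> where "\<sigma> t = \<bar>F' t\<bar> * t powr (1 - \<alpha>) + B * t powr (1 - \<beta>)" for t
  have step: "\<sigma> t \<le> \<sigma> (2 * t)" if t: "0 < t" "2 * t < b" for t
  proof -
    have "\<bar>F' t - F' (2 * t)\<bar> \<le> L * \<bar>t - 2 * t\<bar> powr \<alpha> * (g t + g (2 * t))" using t by (intro hol) auto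
    also have "\<dots> \<le> L * t powr \<alpha> * (C * t powr (-\<beta>) + C * t powr (-\<beta>))"
    proof (intro mult_mono)
      have "g t \<le> C * t powr (-\<beta>)" using t by (intro g) auto
      have "g (2 * t) \<le> C * (2 * t) powr (-\<beta>)" using t by (intro g) auto
      also have "\<dots> \<le> C * t powr (-\<beta>)" using t \<beta> C by (intro mult_left_mono powr_mono2') auto
      finally show "g t + g (2 * t) \<le> C * t powr (-\<beta>) + C * t powr (-\<beta>)" using \<open>g t \<le> C * t powr (-\<beta>)\<close> by simp
    qed (use t L C g0 in auto)
    also have "\<dots> = D * t powr (\<alpha> - \<beta>)" 
    proof -
      have "t powr (\<alpha> - \<beta>) = t powr \<alpha> * t powr (-\<beta>)" unfolding powr_add[symmetric] by simp
      then show ?thesis by (simp add: D_def)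
    qed
    finally have "\<bar>F' t\<bar> \<le> \<bar>F' (2 * t)\<bar> + D * t powr (\<alpha> - \<beta>)" by linarith
    then have "\<bar>F' t\<bar> * t powr (1 - \<alpha>) \<le> (\<bar>F' (2 * t)\<bar> + D * t powr (\<alpha> - \<beta>)) * t powr (1 - \<alpha>)"
      by (intro mult_right_mono) auto
    also have "\<dots> = \<bar>F' (2 * t)\<bar> * t powr (1 - \<alpha>) + D * (t powr (\<alpha> - \<beta>) * t powr (1 - \<alpha>))"
      by (simp add: algebra_simps)
    also have "t powr (\<alpha> - \<beta>) * t powr (1 - \<alpha>) = t powr (1 - \<beta>)" unfolding powr_add[symmetric] by simp
    also have "\<bar>F' (2 * t)\<bar> * t powr (1 - \<alpha>) \<le> \<bar>F' (2 * t)\<bar> * (2 * t) powr (1 - \<alpha>)"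
      using t \<alpha> by (intro mult_left_mono powr_mono2) auto
    finally have "\<sigma> t \<le> \<bar>F' (2 * t)\<bar> * (2 * t) powr (1 - \<alpha>) + (B + D) * t powr (1 - \<beta>)"
      by (simp add: \<sigma>_def algebra_simps)
    also have "(B + D) * t powr (1 - \<beta>) = B * (2 * t) powr (1 - \<beta>)"
      using B(2) by (simp add: powr_mult)
    finally show ?thesis by (simp add: \<sigma>_def)
  qed
  \<comment> \<open>A bound for \<sigma> on [b/4, b/2), from comparison with the single point b/4.
    Every smaller positive t enters this block after finitely many doublings.\<close>
  define S where "S = (\<bar>F' (b / 4)\<bar> + L * b powr \<alpha> * (2 * (C * (b / 4) powr (-\<beta>)))) * b powr (1 - \<alpha>) + B * b powr (1 - \<beta>)"
  have base: "\<sigma> t \<le> S" if t: "b / 4 \<le> t" "t < b / 2" for t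
  proof -
    have "\<bar>F' t - F' (b / 4)\<bar> \<le> L * \<bar>t - b / 4\<bar> powr \<alpha> * (g t + g (b / 4))" using t b by (intro hol) auto
    also have "\<dots> \<le> L * \<bar>t - b / 4\<bar> powr \<alpha> * (2 * (C * (b / 4) powr (-\<beta>)))"
    proof (rule mult_left_mono)
      have "g t \<le> C * t powr (-\<beta>)" using t b by (intro g) auto
      also have "\<dots> \<le> C * (b / 4) powr (-\<beta>)" using t b \<beta> C by (intro mult_left_mono powr_mono2') auto
      finally show "g t + g (b / 4) \<le> 2 * (C * (b / 4) powr (-\<beta>))" using g[of "b / 4"] b by simp
    qed (use L in auto)
    also have "\<dots> \<le> L * b powr \<alpha> * (2 * (C * (b / 4) powr (-\<beta>)))"
      using t b L C \<alpha> by (intro mult_right_mono mult_left_mono powr_mono2) auto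
    finally have "\<bar>F' t\<bar> \<le> \<bar>F' (b / 4)\<bar> + L * b powr \<alpha> * (2 * (C * (b / 4) powr (-\<beta>)))" by linarith
    then show ?thesis
      unfolding \<sigma>_def S_def using t b B \<alpha> \<beta> L C by (intro add_mono mult_mono powr_mono2) auto
  qed
  have S0: "0 \<le> S" using L C B by (simp add: S_def)
  have dyadic: "\<forall>t. b / 4 * (1 / 2) ^ n \<le> t \<and> t < b / 2 \<longrightarrow> \<sigma> t \<le> S" for n
  proof (induction n)
    case (Suc n)
    show ?case
    proof (intro allI impI)
      fix t assume t: "b / 4 * (1 / 2) ^ Suc n \<le> t \<and> t < b / 2"
      have "0 < b / 4 * (1 / 2) ^ Suc n" using b by simp
      then have t0: "0 < t" using t by linarith
      show "\<sigma> t \<le> S"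
      proof (cases "b / 4 \<le> t")
        case False
        then have "\<sigma> (2 * t) \<le> S" using t by (intro Suc.IH[rule_format]) auto
        then show ?thesis using step[of t] t0 False b by auto
      qed (use base t in auto)
    qed
  qed (use base in auto)
  have \<sigma>S: "\<sigma> t \<le> S" if t: "0 < t" "t < b / 2" for t
  proof -
    obtain n where "(1 / 2) ^ n < t / (b / 4)" using real_arch_pow_inv[of "t / (b / 4)" "1 / 2"] t b by auto
    then have "b / 4 * (1 / 2) ^ n \<le> t" using b by (simp add: field_simps)
    then show ?thesis using dyadic[of n] t by blast
  qed
  have dF: "\<bar>F' t\<bar> \<le> S * t powr (\<alpha> - 1)" if t: "0 < t" "t < b / 2" for t
  proof -
    have "\<bar>F' t\<bar> * t powr (1 - \<alpha>) \<le> S"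
      using \<sigma>S[OF t] B unfolding \<sigma>_def by (smt (verit) mult_nonneg_nonneg powr_ge_zero)
    then have "\<bar>F' t\<bar> * t powr (1 - \<alpha>) * t powr (\<alpha> - 1) \<le> S * t powr (\<alpha> - 1)" by (intro mult_right_mono) auto
    moreover have "t powr (1 - \<alpha>) * t powr (\<alpha> - 1) = 1" unfolding powr_add[symmetric] using t by simp
    ultimately show ?thesis by (simp add: mult.assoc)
  qed
  have "\<bar>F t - F 0\<bar> \<le> S / \<alpha> * t powr \<alpha>" if t: "0 \<le> t" "t < b / 2" for t
  proof -
    \<comment> \<open>The derivative bound is integrated by monotonicity: S/\<alpha> x^\<alpha> + F
      and S/\<alpha> x^\<alpha> - F are both nondecreasing, and only continuity of \<open>F\<close>
      is available at 0.\<close>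
    have mono: "S / \<alpha> * 0 powr \<alpha> + \<tau> * F 0 \<le> S / \<alpha> * t powr \<alpha> + \<tau> * F t" if \<tau>: "\<tau> = 1 \<or> \<tau> = -1" for \<tau>
    proof (rule DERIV_nonneg_imp_increasing_open[OF t(1)])
      fix x assume x: "0 < x" "x < t"
      have "((\<lambda>x. S / \<alpha> * x powr \<alpha> + \<tau> * F x) has_real_derivative S / \<alpha> * (\<alpha> * x powr (\<alpha> - 1)) + \<tau> * F' x) (at x)"
        using x t b by (intro DERIV_add DERIV_cmult der has_real_derivative_powr) auto
      moreover have "0 \<le> S / \<alpha> * (\<alpha> * x powr (\<alpha> - 1)) + \<tau> * F' x"
        using dF[of x] x t \<alpha> \<tau> by (auto simp: abs_le_iff)
      ultimately show "\<exists>y. ((\<lambda>x. S / \<alpha> * x powr \<alpha> + \<tau> * F x) has_real_derivative y) (at x) \<and> 0 \<le> y" by blast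
    next
      have "continuous_on {0..t} F" using cont by (rule continuous_on_subset) (use t b in auto)
      then show "continuous_on {0..t} (\<lambda>x. S / \<alpha> * x powr \<alpha> + \<tau> * F x)"
        using \<alpha> by (intro continuous_intros continuous_on_powr') auto
    qed
    show ?thesis using mono[of 1] mono[of "-1"] by (simp add: abs_le_iff)
  qed
  then show ?thesis using that[of "S / \<alpha>"] S0 \<alpha> by simp
qed

text \<open>One open interval between consecutive breakpoints. \<open>convex_on\<close> includes
  convexity of its domain, so \<open>I\<close> is an interval, and q > 1 provides a conjugate
  exponent.\<close>

locale weighted_holder =
  fixes I :: "real set" and f :: "real \<Rightarrow> real" and \<alpha> L q :: real and g :: "real \<Rightarrow> real"
  assumes open_I: "open I" and \<alpha>: "0 < \<alpha>" "\<alpha> \<le> 1" and L: "0 \<le> L" and q: "1 < q"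
    and g_nonneg: "\<And>u. u \<in> I \<Longrightarrow> 0 \<le> g u"
    and g_convex: "convex_on I (\<lambda>u. g u powr q)"
    and diff: "\<And>u. u \<in> I \<Longrightarrow> f differentiable (at u)"
    and hol: "\<And>u v. u \<in> I \<Longrightarrow> v \<in> I \<Longrightarrow> \<bar>deriv f u - deriv f v\<bar> \<le> L * \<bar>u - v\<bar> powr \<alpha> * (g u + g v)"
begin

lemma convex_I: "convex I"
  using g_convex by (rule convex_on_imp_convex)

lemma deriv_f: "u \<in> I \<Longrightarrow> (f has_real_derivative deriv f u) (at u)"
  using diff by (simp add: DERIV_deriv_iff_real_differentiable)

text \<open>The slope is the infimum of the difference quotients to the right. It serves twice: as
  Jensen's inequality at the barycentre of a cell, and to bound \<open>g powr q\<close> from below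
  on one side of a point near a breakpoint.\<close>

lemma subgradient:
  assumes "u \<in> I"
  obtains k where "\<And>v. v \<in> I \<Longrightarrow> g u powr q + k * (v - u) \<le> g v powr q"
proof (rule that)
  have "u \<in> interior I" using assms open_I by (simp add: interior_open)
  then show "g u powr q + Inf ((\<lambda>t. (g u powr q - g t powr q) / (u - t)) ` ({u<..} \<inter> I)) * (v - u) \<le> g v powr q"
    if "v \<in> I" for v
    using convex_le_Inf_differential[OF g_convex _ that] by simp
qed

text \<open>Convexity of the power makes \<open>g\<close> itself quasiconvex. This removes the
  unknown intermediate point of the mean value theorem from the Taylor remainder.\<close>

lemma g_le_max:
  assumes "x \<in> I" "y \<in> I" "z \<in> closed_segment x y"
  shows "g z \<le> max (g x) (g y)"
proof -
  obtain t where t: "0 \<le> t" "t \<le> 1" "z = (1 - t) *\<^sub>R x + t *\<^sub>R y"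
    using assms(3) by (auto simp: closed_segment_def)
  have "g z powr q \<le> (1 - t) * g x powr q + t * g y powr q"
    unfolding t(3) by (rule convex_onD[OF g_convex t(1,2) assms(1,2)])
  also have "\<dots> \<le> (1 - t) * max (g x) (g y) powr q + t * max (g x) (g y) powr q"
    using t q g_nonneg assms by (intro add_mono mult_left_mono powr_mono2) auto
  also have "\<dots> = max (g x) (g y) powr q" by (simp add: algebra_simps)
  finally have "g z powr q \<le> max (g x) (g y) powr q" .
  then show ?thesis using powr_less_mono2[of q "max (g x) (g y)" "g z"] q g_nonneg[OF assms(1)] 
    by (meson leD le_max_iff_disj less_trans not_le zero_less_one)
qed

lemma taylor:
  assumes p: "p \<in> I" and u: "u \<in> I"
  shows "\<bar>f u - f p - deriv f p * (u - p)\<bar> \<le> L * \<bar>u - p\<bar> powr (1 + \<alpha>) * (2 * g p + g u)"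
proof (cases "u = p")
  case False
  have seg: "closed_segment p u \<subseteq> I" using closed_segment_subset[OF p u convex_I] .
  obtain \<xi> where \<xi>: "\<xi> \<in> closed_segment p u" "f u - f p = (u - p) * deriv f \<xi>"
  proof (cases "p < u")
    case True
    then have seg': "{p..u} \<subseteq> I" using seg by (simp add: closed_segment_eq_real_ivl)
    obtain z where "p < z" "z < u" "f u - f p = (u - p) * deriv f z"
      using MVT2[OF True, of f "deriv f"] seg' deriv_f by (metis atLeastAtMost_iff subsetD)
    then show ?thesis using that[of z] True by (simp add: closed_segment_eq_real_ivl)
  next
    case F: False
    then have up: "u < p" using False by simp
    then have seg': "{u..p} \<subseteq> I" using seg by (simp add: closed_segment_eq_real_ivl)
    obtain z where "u < z" "z < p" "f p - f u = (p - u) * deriv f z"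
      using MVT2[OF up, of f "deriv f"] seg' deriv_f by (metis atLeastAtMost_iff subsetD)
    then show ?thesis using that[of z] up by (simp add: closed_segment_eq_real_ivl algebra_simps)
  qed
  have \<xi>I: "\<xi> \<in> I" using \<xi> seg by auto
  have dist: "\<bar>\<xi> - p\<bar> \<le> \<bar>u - p\<bar>" using \<xi>(1) by (auto simp: closed_segment_eq_real_ivl split: if_splits)
  have "f u - f p - deriv f p * (u - p) = (u - p) * (deriv f \<xi> - deriv f p)"
    using \<xi>(2) by (simp add: algebra_simps)
  then have "\<bar>f u - f p - deriv f p * (u - p)\<bar> = \<bar>u - p\<bar> * \<bar>deriv f \<xi> - deriv f p\<bar>"
    by (simp add: abs_mult)
  also have "\<dots> \<le> \<bar>u - p\<bar> * (L * \<bar>\<xi> - p\<bar> powr \<alpha> * (g \<xi> + g p))"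
    by (intro mult_left_mono hol \<xi>I p) auto
  also have "\<dots> \<le> \<bar>u - p\<bar> * (L * \<bar>u - p\<bar> powr \<alpha> * (2 * g p + g u))"
  proof (intro mult_left_mono mult_mono)
    have "g \<xi> \<le> max (g p) (g u)" using g_le_max[OF p u \<xi>(1)] .
    then show "g \<xi> + g p \<le> 2 * g p + g u" using g_nonneg[OF p] g_nonneg[OF u] by auto
    show "\<bar>\<xi> - p\<bar> powr \<alpha> \<le> \<bar>u - p\<bar> powr \<alpha>" using dist \<alpha> by (intro powr_mono2) auto
    show "0 \<le> g \<xi> + g p" using g_nonneg \<xi>I p by simp
  qed (use L in auto)
  also have "\<dots> = L * \<bar>u - p\<bar> powr (1 + \<alpha>) * (2 * g p + g u)"
    using False by (simp add: powr_add)
  finally show ?thesis .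
qed simp

text \<open>Young's inequality with exponents q/(q - 1) and q separates the distance from
  \<open>g\<close>; since (1 + \<alpha>) q/(q - 1) \<le> s, the distance term is at most 1 + x^s.
  The right side is linear in \<open>g powr q\<close>, the form in which convexity can be
  used.\<close>

lemma scaled_taylor:
  assumes p: "p \<in> I" and u: "u \<in> I" and N: "0 \<le> N" and s: "(1 + \<alpha>) * (q / (q - 1)) \<le> s"
  shows "N powr (1 + \<alpha>) * \<bar>f u - f p - deriv f p * (u - p)\<bar>
      \<le> L * (3 * (1 + (N * \<bar>u - p\<bar>) powr s) + (2 * g p powr q + g u powr q))"
proof -
  define x where "x = N * \<bar>u - p\<bar>"
  have x: "0 \<le> x" using N by (simp add: x_def)
  have young: "x powr (1 + \<alpha>) * c \<le> 1 + x powr s + c powr q" if c: "0 \<le> c" for c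
  proof -
    define q' where "q' = q / (q - 1)"
    have q': "1 < q'" "1 / q' + 1 / q = 1" using q by (auto simp: q'_def field_simps)
    have "x powr (1 + \<alpha>) * c \<le> (x powr (1 + \<alpha>)) powr q' / q' + c powr q / q"
      using q' q c by (intro Youngs_inequality) auto
    also have "\<dots> \<le> (x powr (1 + \<alpha>)) powr q' + c powr q"
    proof (rule add_mono)
      show "(x powr (1 + \<alpha>)) powr q' / q' \<le> (x powr (1 + \<alpha>)) powr q'"
        using q' by (simp add: divide_le_eq mult_left_mono[of 1 q', simplified])
      show "c powr q / q \<le> c powr q" using q by (simp add: divide_le_eq mult_left_mono[of 1 q, simplified])
    qed
    also have "(x powr (1 + \<alpha>)) powr q' \<le> 1 + x powr s"
    proof (cases "x \<le> 1")
      case True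
      then have "(x powr (1 + \<alpha>)) powr q' \<le> 1" using x \<alpha> q' by (simp add: powr_powr powr_le1)
      then show ?thesis by (simp add: add_increasing2)
    next
      case False
      then have "(x powr (1 + \<alpha>)) powr q' \<le> x powr s"
        using s by (simp add: powr_powr q'_def powr_mono)
      then show ?thesis by simp
    qed
    finally show ?thesis by simp
  qed
  have "N powr (1 + \<alpha>) * \<bar>f u - f p - deriv f p * (u - p)\<bar>
      \<le> N powr (1 + \<alpha>) * (L * \<bar>u - p\<bar> powr (1 + \<alpha>) * (2 * g p + g u))"
    by (intro mult_left_mono taylor p u) auto
  also have "\<dots> = L * (2 * (x powr (1 + \<alpha>) * g p) + x powr (1 + \<alpha>) * g u)"
    by (simp add: x_def powr_mult algebra_simps)
  also have "\<dots> \<le> L * (2 * (1 + x powr s + g p powr q) + (1 + x powr s + g u powr q))"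
    using L p u by (intro mult_left_mono add_mono young g_nonneg) auto
  also have "\<dots> = L * (3 * (1 + x powr s) + (2 * g p powr q + g u powr q))" by (simp add: algebra_simps)
  finally show ?thesis by (simp add: x_def)
qed

lemma measurable_g: "(\<lambda>u. g u powr q * indicator I u) \<in> borel_measurable borel"
proof -
  have "continuous_on I (\<lambda>u. g u powr q)" using convex_on_continuous[OF open_I g_convex] .
  then have "(\<lambda>u. indicator I u *\<^sub>R (g u powr q)) \<in> borel_measurable borel"
    by (intro borel_measurable_continuous_on_indicator) (use open_I in auto)
  then show ?thesis by (simp add: mult.commute)
qed

end

section \<open>The pieces under the law: growth at a breakpoint and regular cells\<close>

context real_distribution
begin

text \<open>At distance t from \<open>a\<close>, convexity keeps \<open>g powr q\<close> above its
  current value on an interval of length t, whose mass is at least m t. Hence g^q = O(1/t), so g =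
  O(t^(-1/q)), and \<open>holder_at_endpoint\<close> applies with \<beta> = 1/q < 1. The sign
  \<sigma> selects the side of \<open>a\<close>.\<close>

lemma weighted_holder_breakpoint:
  assumes wh: "weighted_holder I f \<alpha> L q g"
    and db: "density_bounds M c d m b" and a: "c < a" "a < d"
    and \<sigma>: "\<sigma> = 1 \<or> \<sigma> = -1" and e: "0 < e" "\<And>t. 0 < t \<Longrightarrow> t < e \<Longrightarrow> a + \<sigma> * t \<in> I"
    and f: "continuous_on UNIV f"
    and gi: "integrable M (\<lambda>u. g u powr q * indicator I u)"
  obtains K e' where "0 \<le> K" "0 < e'" "\<And>t. 0 \<le> t \<Longrightarrow> t < e' \<Longrightarrow> \<bar>f (a + \<sigma> * t) - f a\<bar> \<le> K * t powr \<alpha>"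
proof -
  interpret weighted_holder I f \<alpha> L q g by (rule wh)
  have m: "0 < m" using db by (simp add: density_bounds_def)
  define E where "E = (\<integral>u. g u powr q * indicator I u \<partial>M)"
  have E: "0 \<le> E" unfolding E_def by (intro integral_nonneg_AE) auto
  \<comment> \<open>For t < r the window (u - t, u + t) around u = a + \<sigma> t reaches at most 2t
    from \<open>a\<close>, so it stays in \<open>I\<close> and in [c, d].\<close>
  define r where "r = min e (min (a - c) (d - a)) / 2"
  have r: "0 < r" "2 * r \<le> e" "2 * r \<le> a - c" "2 * r \<le> d - a" using e a by (auto simp: r_def)
  have gt: "g (a + \<sigma> * t) \<le> (E / m) powr (1 / q) * t powr (-(1 / q))" if t: "0 < t" "t < r" for t
  proof -
    define u where "u = a + \<sigma> * t"
    have uI: "u \<in> I" unfolding u_def using t r by (intro e) auto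
    have nbhd: "v \<in> I" if "\<bar>v - u\<bar> < t" for v
    proof -
      have "0 < \<sigma> * (v - a)" "\<sigma> * (v - a) < e"
        using \<sigma> that t r by (auto simp: u_def)
      then have "a + \<sigma> * (\<sigma> * (v - a)) \<in> I" using e by blast
      then show ?thesis using \<sigma> by auto
    qed
    have sub: "c \<le> u - t" "u + t \<le> d" using \<sigma> t r by (auto simp: u_def)
    obtain k where k: "\<And>v. v \<in> I \<Longrightarrow> g u powr q + k * (v - u) \<le> g v powr q" using subgradient[OF uI] by blast
    \<comment> \<open>On one side of \<open>u\<close> the convex function \<open>g powr q\<close> stays above its value at \<open>u\<close>.\<close>
    define A where "A = (if 0 \<le> k then {u<..<u + t} else {u - t<..<u})"
    have mA: "m * t \<le> measure M A"
    proof -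
      have *: "m * (f - e) \<le> measure M {e<..<f}" if "c \<le> e" "e \<le> f" "f \<le> d" for e f
        using db that unfolding density_bounds_def by blast
      show ?thesis using *[of u "u + t"] *[of "u - t" u] sub t by (simp add: A_def)
    qed
    have pt: "g u powr q * indicator A v \<le> g v powr q * indicator I v" for v
    proof (cases "v \<in> A")
      case True
      then have vI: "v \<in> I" using nbhd[of v] t by (auto simp: A_def split: if_splits)
      have "0 \<le> k * (v - u)" using True by (auto simp: A_def zero_le_mult_iff split: if_splits)
      then show ?thesis using k[OF vI] True vI by simp
    qed auto
    have Am [measurable]: "A \<in> sets borel" by (simp add: A_def)
    have "g u powr q * (m * t) \<le> g u powr q * measure M A" by (intro mult_left_mono mA) auto
    also have "\<dots> = (\<integral>v. g u powr q * indicator A v \<partial>M)" by simp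
    also have "\<dots> \<le> E" unfolding E_def
      by (rule integral_mono) (use pt gi in \<open>auto simp: integrable_real_indicator emeasure_eq_measure\<close>)
    finally have "g u powr q \<le> E / (m * t)" using m t by (subst pos_le_divide_eq) auto
    then have "g u powr q \<le> E / m * (1 / t)" by simp
    then have "(g u powr q) powr (1 / q) \<le> (E / m * (1 / t)) powr (1 / q)"
      using q by (intro powr_mono2) auto
    also have "(g u powr q) powr (1 / q) = g u" using q g_nonneg[OF uI] by (simp add: powr_powr)
    also have "(E / m * (1 / t)) powr (1 / q) = (E / m) powr (1 / q) * t powr (-(1 / q))"
      using t by (simp only: powr_mult) (simp add: powr_divide powr_minus_divide)
    finally show ?thesis by (simp add: u_def)
  qed
  obtain K where K: "0 \<le> K" "\<And>t. 0 \<le> t \<Longrightarrow> t < r / 2 \<Longrightarrow> \<bar>f (a + \<sigma> * t) - f (a + \<sigma> * 0)\<bar> \<le> K * t powr \<alpha>"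
  proof (rule holder_at_endpoint[where b = r and \<alpha> = \<alpha> and \<beta> = "1 / q" and L = L and C = "(E / m) powr (1 / q)"
        and F = "\<lambda>t. f (a + \<sigma> * t)" and F' = "\<lambda>t. deriv f (a + \<sigma> * t) * \<sigma>" and g = "\<lambda>t. g (a + \<sigma> * t)"])
    show "continuous_on {0..<r} (\<lambda>t. f (a + \<sigma> * t))"
      by (rule continuous_on_compose2[OF f]) (auto intro!: continuous_intros)
    fix t assume t: "0 < t" "t < r"
    then have tI: "a + \<sigma> * t \<in> I" using r by (intro e) auto
    show "((\<lambda>t. f (a + \<sigma> * t)) has_real_derivative deriv f (a + \<sigma> * t) * \<sigma>) (at t)"
      by (rule DERIV_chain2[where f = f and g = "\<lambda>t. a + \<sigma> * t"]) (auto intro!: derivative_eq_intros deriv_f tI)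
    fix s assume s: "0 < s" "s < r"
    then have sI: "a + \<sigma> * s \<in> I" using r by (intro e) auto
    have "\<bar>deriv f (a + \<sigma> * s) * \<sigma> - deriv f (a + \<sigma> * t) * \<sigma>\<bar> = \<bar>deriv f (a + \<sigma> * s) - deriv f (a + \<sigma> * t)\<bar>"
      using \<sigma> by auto
    also have "\<dots> \<le> L * \<bar>(a + \<sigma> * s) - (a + \<sigma> * t)\<bar> powr \<alpha> * (g (a + \<sigma> * s) + g (a + \<sigma> * t))"
      by (rule hol[OF sI tI])
    also have "\<bar>(a + \<sigma> * s) - (a + \<sigma> * t)\<bar> = \<bar>s - t\<bar>" using \<sigma> by auto
    finally show "\<bar>deriv f (a + \<sigma> * s) * \<sigma> - deriv f (a + \<sigma> * t) * \<sigma>\<bar>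
        \<le> L * \<bar>s - t\<bar> powr \<alpha> * (g (a + \<sigma> * s) + g (a + \<sigma> * t))" .
  qed (use r \<alpha> q L gt g_nonneg e in auto)
  then show ?thesis using that[of K "r / 2"] r by simp
qed

text \<open>Stationarity is used twice: it cancels the linear Taylor term of \<open>f\<close>, and
  it cancels the linear term of the subgradient inequality for \<open>g powr q\<close> at
  \<open>p\<close>. The second use is Jensen's inequality without dividing by the mass of the
  cell.\<close>

lemma integral_cell_regular:
  fixes N :: real
  assumes wh: "weighted_holder I f \<alpha> L q g"
    and A [measurable]: "A \<in> sets borel" and AI: "A \<subseteq> I"
    and stat: "(\<integral>u. (u - p) * indicator A u \<partial>M) = 0"
    and N: "0 \<le> N" and s: "(1 + \<alpha>) * (q / (q - 1)) \<le> s"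
    and int: "integrable M (\<lambda>u. (u - p) * indicator A u)" "integrable M f"
      "integrable M (\<lambda>u. g u powr q * indicator I u)"
      "integrable M (\<lambda>u. D u powr s)"
    and D: "\<And>u. u \<in> A \<Longrightarrow> D u = N * \<bar>u - p\<bar>"
  shows "N powr (1 + \<alpha>) * \<bar>\<integral>u. (f u - f p) * indicator A u \<partial>M\<bar>
     \<le> L * (\<integral>u. (3 * (1 + D u powr s) + 3 * (g u powr q * indicator I u)) * indicator A u \<partial>M)"
proof (cases "measure M A = 0")
  case True
  then have "AE u in M. u \<notin> A" by (intro AE_not_in) (auto simp: null_sets_def emeasure_eq_measure)
  then have "(\<integral>u. (f u - f p) * indicator A u \<partial>M) = 0" "(\<integral>u. (3 * (1 + D u powr s) + 3 * (g u powr q * indicator I u)) * indicator A u \<partial>M) = 0"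
    by (intro integral_eq_zero_AE; auto)+
  then show ?thesis by simp
next
  case False
  interpret weighted_holder I f \<alpha> L q g by (rule wh)
  have notAE: "\<not> (AE u in M. u \<notin> A)" 
    using False by (subst AE_iff_measurable[OF _ refl]) (auto simp: emeasure_eq_measure)
  \<comment> \<open>If \<open>p\<close> were outside the interval \<open>I\<close>, all of
    \<open>A\<close> would lie strictly on one side of it, and a vanishing integral of u - p would
    make \<open>A\<close> a null set. Null cells are therefore treated separately.\<close>
  have pI: "p \<in> I"
  proof (rule ccontr)
    assume np: "p \<notin> I"
    have "is_interval I" using convex_I by (simp add: is_interval_convex_1)
    then have "(\<forall>u\<in>A. u < p) \<or> (\<forall>u\<in>A. p < u)"
    proof (rule contrapos_pp)
      assume "\<not> ((\<forall>u\<in>A. u < p) \<or> (\<forall>u\<in>A. p < u))"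
      then obtain u v where "u \<in> A" "p \<le> u" "v \<in> A" "v \<le> p" by (auto simp: not_less)
      then have "p \<in> I" using mem_is_interval_1_I[OF \<open>is_interval I\<close>, of v u p] AI by auto
      then show "\<not> is_interval I" using np by simp
    qed
    then have "\<exists>\<tau>. (\<tau> = 1 \<or> \<tau> = -1) \<and> (\<forall>u\<in>A. 0 < \<tau> * (u - p))"
    proof
      assume "\<forall>u\<in>A. u < p"
      then show ?thesis by (intro exI[of _ "-1"]) auto
    next
      assume "\<forall>u\<in>A. p < u"
      then show ?thesis by (intro exI[of _ 1]) auto
    qed
    then obtain \<tau> :: real where \<tau>: "\<tau> = 1 \<or> \<tau> = -1" "\<forall>u\<in>A. 0 < \<tau> * (u - p)" by blast
    have "(\<integral>u. \<tau> * ((u - p) * indicator A u) \<partial>M) = 0" using stat by simp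
    moreover have "AE u in M. 0 \<le> \<tau> * ((u - p) * indicator A u)"
      using \<tau> by (intro AE_I2) (auto simp: indicator_def less_imp_le)
    moreover have "integrable M (\<lambda>u. \<tau> * ((u - p) * indicator A u))" using int(1) by simp
    ultimately have "AE u in M. \<tau> * ((u - p) * indicator A u) = 0"
      using integral_nonneg_eq_0_iff_AE by blast
    then have "AE u in M. u \<notin> A"
    proof (rule AE_mp, intro AE_I2 impI notI)
      fix u assume "\<tau> * ((u - p) * indicator A u) = 0" "u \<in> A"
      then show False using \<tau> by force
    qed
    then show False using notAE by simp
  qed
  obtain k where k: "\<And>v. v \<in> I \<Longrightarrow> g p powr q + k * (v - p) \<le> g v powr q" using subgradient[OF pI] by blast
  define c where "c = deriv f p"
  define H where "H u = (3 * (1 + D u powr s) + 3 * (g u powr q * indicator I u)) * indicator A u" for u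
  define R where "R u = (f u - f p) * indicator A u - c * ((u - p) * indicator A u)" for u
  have if_: "integrable M (\<lambda>u. (f u - f p) * indicator A u)"
    using int(2) by (intro integrable_real_mult_indicator Bochner_Integration.integrable_diff) auto
  have iR: "integrable M R" unfolding R_def using if_ int(1) by auto
  have iH: "integrable M H" unfolding H_def using int(3,4)
    by (intro integrable_real_mult_indicator) auto
  have intR: "(\<integral>u. R u \<partial>M) = (\<integral>u. (f u - f p) * indicator A u \<partial>M)"
    unfolding R_def using if_ int(1) stat by (subst Bochner_Integration.integral_diff) auto
  have pt: "N powr (1 + \<alpha>) * \<bar>R u\<bar> \<le> L * (H u - (2 * k) * ((u - p) * indicator A u))" for u
  proof (cases "u \<in> A")
    case True
    then have uI: "u \<in> I" using AI by auto
    have "N powr (1 + \<alpha>) * \<bar>R u\<bar> = N powr (1 + \<alpha>) * \<bar>f u - f p - deriv f p * (u - p)\<bar>"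
      using True by (simp add: R_def c_def)
    also have "\<dots> \<le> L * (3 * (1 + (N * \<bar>u - p\<bar>) powr s) + (2 * g p powr q + g u powr q))"
      by (rule scaled_taylor[OF pI uI N s])
    \<comment> \<open>Twice the subgradient inequality bounds 2 g(p)^q by 2 g(u)^q - 2 k (u - p);
      with the g(u)^q already present this gives the coefficient 3 in \<open>H\<close>.\<close>
    also have "\<dots> \<le> L * (H u - (2 * k) * ((u - p) * indicator A u))"
      using k[OF uI] True uI D[OF True] by (intro mult_left_mono L) (simp add: H_def)
    finally show ?thesis .
  qed (simp add: R_def H_def)
  have "N powr (1 + \<alpha>) * \<bar>\<integral>u. (f u - f p) * indicator A u \<partial>M\<bar> \<le> N powr (1 + \<alpha>) * (\<integral>u. \<bar>R u\<bar> \<partial>M)"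
    unfolding intR[symmetric] by (intro mult_left_mono integral_abs_bound) auto
  also have "\<dots> = (\<integral>u. N powr (1 + \<alpha>) * \<bar>R u\<bar> \<partial>M)" by simp
  also have "\<dots> \<le> (\<integral>u. L * (H u - (2 * k) * ((u - p) * indicator A u)) \<partial>M)"
    by (rule integral_mono) (use pt iR iH int(1) in auto)
  also have "\<dots> = L * ((\<integral>u. H u \<partial>M) - 2 * k * (\<integral>u. (u - p) * indicator A u \<partial>M))"
    using iH int(1) by simp
  also have "\<dots> = L * (\<integral>u. H u \<partial>M)" using stat by simp
  finally show ?thesis by (simp add: H_def)
qed

end

section \<open>The weak error of an optimal grid\<close>

lemma ereal_breakpoints_cover:
  fixes a :: "nat \<Rightarrow> ereal"
  assumes "a 0 = -\<infinity>" "a (K + 1) = \<infinity>"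
  obtains k where "k \<le> K" "a k < ereal u" "ereal u \<le> a (k + 1)"
proof -
  define S where "S = {k. k \<le> K \<and> a k < ereal u}"
  have S: "finite S" "0 \<in> S" using assms by (auto simp: S_def)
  define k where "k = Max S"
  have "k \<in> S" unfolding k_def using S by (intro Max_in) auto
  then have k: "k \<le> K" "a k < ereal u" by (auto simp: S_def)
  have "ereal u \<le> a (k + 1)"
  proof (rule ccontr)
    assume *: "\<not> ?thesis"
    then have "k \<noteq> K" using assms by auto
    then have "k + 1 \<in> S" using * k by (auto simp: S_def)
    then have "k + 1 \<le> k" unfolding k_def using S(1) by (rule Max_ge[rotated])
    then show False by simp
  qed
  then show ?thesis using k that by blast
qed

text \<open>
  The cells are those of the quantization cut down to the open support interval \<open>J\<close>: a Voronoi cell may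
  leave \<open>J\<close> when a midpoint of the grid does.
\<close>

definition nearest_cells :: "real set \<Rightarrow> nat \<Rightarrow> (nat \<Rightarrow> real) \<Rightarrow> (nat \<Rightarrow> real set) \<Rightarrow> bool" where
  "nearest_cells J N x A \<longleftrightarrow> inj_on x {1..N} \<and>
     (\<forall>i\<in>{1..N}. A i \<in> sets borel \<and> is_interval (A i) \<and> A i \<subseteq> J) \<and>
     disjoint_family_on A {1..N} \<and> J \<subseteq> (\<Union>i\<in>{1..N}. A i) \<and>
     (\<forall>i\<in>{1..N}. \<forall>u\<in>A i. \<bar>u - x i\<bar> = infdist u (x ` {1..N}))"

context real_distribution
begin

text \<open>This is the centroid condition in unnormalised form. By \<open>other\<close> almost
  every point outside \<open>A\<close> keeps its distance to a grid point other than
  \<open>p\<close>, so moving \<open>p\<close> by \<open>S\<close> changes the distortion by at most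
  S^2 \<mu>(A) - 2 S^2. As \<mu>(A) \<le> 1, optimality forces S = 0.\<close>

lemma optimal_set_stationary:
  assumes sq: "integrable M (\<lambda>u. u\<^sup>2)" and opt: "optimal_set M N G" and p: "p \<in> G"
    and A [measurable]: "A \<in> sets borel"
    and near: "\<And>u. u \<in> A \<Longrightarrow> \<bar>u - p\<bar> = infdist u G"
    and other: "AE u in M. u \<in> A \<or> (\<exists>g\<in>G - {p}. \<bar>u - g\<bar> = infdist u G)"
  shows "integrable M (\<lambda>u. (u - p) * indicator A u)" "(\<integral>u. (u - p) * indicator A u \<partial>M) = 0"
proof -
  have id: "integrable M (\<lambda>u. u)"
    by (rule square_integrable_imp_integrable[OF _ sq]) simp
  show int: "integrable M (\<lambda>u. (u - p) * indicator A u)"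
    using id by (intro integrable_real_mult_indicator Bochner_Integration.integrable_diff) auto
  \<comment> \<open>The competitor moves \<open>p\<close> by \<open>S\<close>.\<close>
  define S where "S = (\<integral>u. (u - p) * indicator A u \<partial>M)"
  define B where "B = insert (p + S) (G - {p})"
  have fin: "finite G" "G \<noteq> {}" "card G \<le> N" using opt by (auto simp: optimal_set_def)
  have "card B \<le> Suc (card (G - {p}))" unfolding B_def by (rule card_insert_le_m1) (use fin in auto)
  also have "\<dots> = card G" using card_Suc_Diff1[OF fin(1) p] .
  finally have "distortion M G \<le> distortion M B"
    using opt fin by (auto simp: optimal_set_def B_def)
  also have "\<dots> \<le> (\<integral>u. (infdist u G)\<^sup>2 + (- 2 * S * ((u - p) * indicator A u) + S\<^sup>2 * indicator A u) \<partial>M)"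
    unfolding distortion_def
  proof (rule integral_mono_AE)
    show "AE u in M. (infdist u B)\<^sup>2 \<le> (infdist u G)\<^sup>2 + (- 2 * S * ((u - p) * indicator A u) + S\<^sup>2 * indicator A u)"
      using other
    proof eventually_elim
      case (elim u)
      show ?case
      proof (cases "u \<in> A")
        case True
        have "infdist u B \<le> \<bar>u - (p + S)\<bar>"
          using infdist_le[of "p + S" B u] by (simp add: B_def dist_real_def)
        then have "(infdist u B)\<^sup>2 \<le> (u - (p + S))\<^sup>2"
          using power_mono[OF _ infdist_nonneg, of u B "\<bar>u - (p + S)\<bar>" 2] by simp
        also have "\<dots> = \<bar>u - p\<bar>\<^sup>2 + (- 2 * S * (u - p) + S\<^sup>2)" by (simp add: power2_eq_square algebra_simps)
        finally show ?thesis using True near[OF True] by simp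
      next
        case False
        then obtain g where g: "g \<in> G - {p}" "\<bar>u - g\<bar> = infdist u G" using elim by blast
        have "infdist u B \<le> infdist u G"
          using infdist_le[of g B u] g by (simp add: B_def dist_real_def)
        then show ?thesis using False by (simp add: power_mono infdist_nonneg)
      qed
    qed
  qed (use int integrable_infdist_sq[OF sq] fin in \<open>auto simp: B_def integrable_real_indicator emeasure_eq_measure\<close>)
  also have "\<dots> = distortion M G + (- 2 * S * S + S\<^sup>2 * measure M A)"
    unfolding distortion_def S_def[symmetric] using int integrable_infdist_sq[OF sq fin(2)]
    by (simp add: integrable_real_indicator emeasure_eq_measure S_def)
  finally have "2 * S\<^sup>2 \<le> S\<^sup>2 * measure M A" by (simp add: power2_eq_square)
  also have "\<dots> \<le> S\<^sup>2 * 1" by (intro mult_left_mono) auto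
  finally show "(\<integral>u. (u - p) * indicator A u \<partial>M) = 0" by (simp add: S_def)
qed

text \<open>The cell lies within R/N of \<open>a\<close>: the upper density bound gives it mass
  O(1/N), the Hoelder bound at \<open>a\<close> gives \<open>f\<close> an oscillation
  O(N^(-\<alpha>)), and the product has the required order with no cancellation.\<close>

lemma integral_cell_breakpoint:
  assumes wh: "weighted_holder (einterval a0 (ereal a)) f \<alpha> L1 q1 g1" "weighted_holder (einterval (ereal a) a2) f \<alpha> L2 q2 g2"
    and a02: "a0 < ereal a" "ereal a < a2"
    and db: "density_bounds M c d m b" and a: "c < a" "a < d"
    and f: "continuous_on UNIV f"
    and gi: "integrable M (\<lambda>u. g1 u powr q1 * indicator (einterval a0 (ereal a)) u)"
      "integrable M (\<lambda>u. g2 u powr q2 * indicator (einterval (ereal a) a2) u)"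
    and C: "0 \<le> C"
    and mass: "\<And>N G y. N0 \<le> N \<Longrightarrow> optimal_set M N G \<Longrightarrow>
       (infdist y G)\<^sup>2 * measure M {y - infdist y G / 4<..<y + infdist y G / 4} \<le> C / real N ^ 3"
  obtains C2 N2 where "0 \<le> C2" "\<And>N G p A. N2 \<le> N \<Longrightarrow> optimal_set M N G \<Longrightarrow> p \<in> G \<Longrightarrow> A \<in> sets borel \<Longrightarrow>
     a \<in> A \<Longrightarrow> (\<And>u. u \<in> A \<Longrightarrow> \<bar>u - p\<bar> = infdist u G) \<Longrightarrow>
     real N powr (1 + \<alpha>) * \<bar>\<integral>u. (f u - f p) * indicator A u \<partial>M\<bar> \<le> C2"
proof -
  interpret w: weighted_holder "einterval a0 (ereal a)" f \<alpha> L1 q1 g1 by (rule wh(1))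
  note \<alpha> = w.\<alpha>
  have b: "0 \<le> b" using db by (simp add: density_bounds_def)
  \<comment> \<open>The neighbouring breakpoints may be infinite, so real points in between fix the
    lengths of the one-sided neighbourhoods of \<open>a\<close>.\<close>
  obtain y0 where y0: "a0 < ereal y0" "y0 < a" using a02(1) ereal_dense2 by (metis less_ereal.simps(1))
  obtain y2 where y2: "ereal y2 < a2" "a < y2" using a02(2) ereal_dense2 by (metis less_ereal.simps(1))
  obtain K1 e1 where K1: "0 \<le> K1" "0 < e1" "\<And>t. 0 \<le> t \<Longrightarrow> t < e1 \<Longrightarrow> \<bar>f (a + -1 * t) - f a\<bar> \<le> K1 * t powr \<alpha>"
  proof (rule weighted_holder_breakpoint[OF wh(1) db a, of "-1" "a - y0"])
    show "a + -1 * t \<in> einterval a0 (ereal a)" if "0 < t" "t < a - y0" for t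
    proof -
      have "ereal y0 < ereal (a + -1 * t)" using that by simp
      then have "a0 < ereal (a + -1 * t)" by (rule less_trans[OF y0(1)])
      then show ?thesis using that unfolding einterval_iff by simp
    qed
  qed (use y0 f gi in auto)
  obtain K2 e2 where K2: "0 \<le> K2" "0 < e2" "\<And>t. 0 \<le> t \<Longrightarrow> t < e2 \<Longrightarrow> \<bar>f (a + 1 * t) - f a\<bar> \<le> K2 * t powr \<alpha>"
  proof (rule weighted_holder_breakpoint[OF wh(2) db a, of 1 "y2 - a"])
    show "a + 1 * t \<in> einterval (ereal a) a2" if "0 < t" "t < y2 - a" for t
    proof -
      have "ereal (a + 1 * t) < ereal y2" using that by simp
      then have "ereal (a + 1 * t) < a2" by (rule less_trans[OF _ y2(1)])
      then show ?thesis using that unfolding einterval_iff by simp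
    qed
  qed (use y2 f gi in auto)
  define K where "K = max K1 K2"
  define e where "e = min (min e1 e2) (min (a - c) (d - a))"
  have e: "0 < e" "e \<le> e1" "e \<le> e2" "e \<le> a - c" "e \<le> d - a" using K1 K2 a by (auto simp: e_def)
  have K: "0 \<le> K" using K1 by (simp add: K_def)
  have hol: "\<bar>f v - f a\<bar> \<le> K * \<bar>v - a\<bar> powr \<alpha>" if "\<bar>v - a\<bar> < e" for v
  proof (cases "v \<le> a")
    case True
    then have "\<bar>f v - f a\<bar> \<le> K1 * \<bar>v - a\<bar> powr \<alpha>" using K1(3)[of "a - v"] that e by simp
    also have "\<dots> \<le> K * \<bar>v - a\<bar> powr \<alpha>" by (intro mult_right_mono) (auto simp: K_def)
    finally show ?thesis .
  next
    case False
    then have "\<bar>f v - f a\<bar> \<le> K2 * \<bar>v - a\<bar> powr \<alpha>" using K2(3)[of "v - a"] that e by simp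
    also have "\<dots> \<le> K * \<bar>v - a\<bar> powr \<alpha>" by (intro mult_right_mono) (auto simp: K_def)
    finally show ?thesis .
  qed
  obtain R N1 where R: "0 < R" "\<And>N G p u. N1 \<le> N \<Longrightarrow> optimal_set M N G \<Longrightarrow> p \<in> G \<Longrightarrow>
     \<bar>a - p\<bar> = infdist a G \<Longrightarrow> \<bar>u - p\<bar> = infdist u G \<Longrightarrow> \<bar>u - a\<bar> \<le> R / real N"
    using optimal_set_local_cell[OF db a C mass] by blast
  obtain N3 :: nat where N3: "R / e < real N3" using reals_Archimedean2 by blast
  define N2 where "N2 = max (max N1 N3) 1"
  define C2 where "C2 = 2 * K * R powr \<alpha> * (2 * b * R)"
  have "0 \<le> C2" using K R b by (simp add: C2_def)
  moreover have "real N powr (1 + \<alpha>) * \<bar>\<integral>u. (f u - f p) * indicator A u \<partial>M\<bar> \<le> C2"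
    if N: "N2 \<le> N" and opt: "optimal_set M N G" and p: "p \<in> G" and A [measurable]: "A \<in> sets borel"
      and aA: "a \<in> A" and near: "\<And>u. u \<in> A \<Longrightarrow> \<bar>u - p\<bar> = infdist u G" for N G p A
  proof -
    have N': "N1 \<le> N" "N3 \<le> N" "0 < N" using N by (auto simp: N2_def)
    define r where "r = R / real N"
    have "R / e < real N" using N3 N' by linarith
    then have r: "0 < r" "r < e" using R N' e by (auto simp: r_def field_simps)
    have ur: "\<bar>u - a\<bar> \<le> r" if "u \<in> A" for u
      unfolding r_def using R(2)[OF N'(1) opt p near[OF aA] near[OF that]] .
    \<comment> \<open>\<open>p\<close> need not belong to \<open>A\<close>, but it is its own
      nearest grid point, so the cell bound covers it as well.\<close>
    have pr: "\<bar>p - a\<bar> \<le> r"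
      unfolding r_def using R(2)[OF N'(1) opt p near[OF aA], of p] p by simp
    have osc: "\<bar>f v - f a\<bar> \<le> K * r powr \<alpha>" if "\<bar>v - a\<bar> \<le> r" for v
    proof -
      have "\<bar>f v - f a\<bar> \<le> K * \<bar>v - a\<bar> powr \<alpha>" using that r by (intro hol) simp
      also have "\<dots> \<le> K * r powr \<alpha>" using that K \<alpha> by (intro mult_left_mono powr_mono2) auto
      finally show ?thesis .
    qed
    have "\<bar>\<integral>u. (f u - f p) * indicator A u \<partial>M\<bar> \<le> (\<integral>u. 2 * K * r powr \<alpha> * indicator A u \<partial>M)"
    proof (rule order_trans[OF integral_abs_bound], rule integral_mono_AE')
      show "AE u in M. \<bar>(f u - f p) * indicator A u\<bar> \<le> 2 * K * r powr \<alpha> * indicator A u"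
      proof (rule AE_I2)
        fix u
        have "\<bar>f u - f p\<bar> \<le> 2 * K * r powr \<alpha>" if "u \<in> A"
          using osc[OF ur[OF that]] osc[OF pr] by linarith
        then show "\<bar>(f u - f p) * indicator A u\<bar> \<le> 2 * K * r powr \<alpha> * indicator A u"
          by (auto simp: indicator_def)
      qed
    qed (use K in \<open>auto simp: integrable_real_indicator emeasure_eq_measure\<close>)
    also have "\<dots> = 2 * K * r powr \<alpha> * measure M A" by simp
    also have "\<dots> \<le> 2 * K * r powr \<alpha> * (2 * b * r)"
    proof (rule mult_left_mono)
      have "A \<subseteq> {a - r..a + r}" 
      proof
        fix u assume "u \<in> A"
        from ur[OF this] show "u \<in> {a - r..a + r}" unfolding atLeastAtMost_iff by linarith
      qed
      then have "measure M A \<le> measure M {a - r..a + r}" by (intro finite_measure_mono) auto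
      also have "\<dots> \<le> b * ((a + r) - (a - r))"
      proof -
        have "c \<le> a - r" "a - r \<le> a + r" "a + r \<le> d" using r e by linarith+
        then show ?thesis using db unfolding density_bounds_def by blast
      qed
      finally show "measure M A \<le> 2 * b * r" by simp
    qed (use K in auto)
    finally have "real N powr (1 + \<alpha>) * \<bar>\<integral>u. (f u - f p) * indicator A u \<partial>M\<bar>
        \<le> real N powr (1 + \<alpha>) * (2 * K * r powr \<alpha> * (2 * b * r))"
      by (intro mult_left_mono) auto
    also have "\<dots> = 2 * K * (real N powr \<alpha> * r powr \<alpha>) * (2 * b * (real N * r))"
      using N' by (simp add: powr_add)
    also have "real N powr \<alpha> * r powr \<alpha> = R powr \<alpha>"
      using N' unfolding powr_mult[symmetric] by (simp add: r_def)
    also have "real N * r = R" using N' by (simp add: r_def)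
    finally show ?thesis by (simp add: C2_def)
  qed
  ultimately show ?thesis using that by blast
qed

text \<open>The bounds for regular cells are integrals of one function \<open>H\<close> over
  disjoint cells, so they add up to a single integral bounded uniformly in \<open>N\<close>. A
  breakpoint lies in at most one cell, so its constant is paid at most once. The final 1 in
  \<open>C\<close> makes it positive.\<close>

lemma weak_error_bound:
  fixes a :: "nat \<Rightarrow> ereal" and K :: nat
  assumes supp: "AE u in M. u \<in> einterval l h"
    and db: "\<And>c d. c < d \<Longrightarrow> {c..d} \<subseteq> einterval l h \<Longrightarrow> \<exists>m b. density_bounds M c d m b"
    and sq: "integrable M (\<lambda>u. u\<^sup>2)"
    and s: "2 < s" "s < 3" and \<tau>: "s / (3 - s) < \<tau>" and int: "integrable M (\<lambda>u. \<bar>u\<bar> powr \<tau>)"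
    and f: "continuous_on UNIV f" and fi: "integrable M f"
    and a: "a 0 = -\<infinity>" "a (K + 1) = \<infinity>" "strict_mono_on {0..K + 1} a"
    and wh: "\<And>k. k \<le> K \<Longrightarrow> weighted_holder (einterval (a k) (a (k + 1))) f \<alpha> (L k) (q k) (g k)"
    and gi: "\<And>k. k \<le> K \<Longrightarrow> integrable M (\<lambda>u. g k u powr q k * indicator (einterval (a k) (a (k + 1))) u)"
    and sq_le: "\<And>k. k \<le> K \<Longrightarrow> (1 + \<alpha>) * (q k / (q k - 1)) \<le> s"
  obtains C N0 where "0 < C"
    "\<And>N x A. N0 \<le> N \<Longrightarrow> optimal_set M N (x ` {1..N}) \<Longrightarrow> nearest_cells (einterval l h) N x A \<Longrightarrow>
      real N powr (1 + \<alpha>) * \<bar>(\<integral>u. f u \<partial>M) - (\<Sum>i=1..N. f (x i) * measure M (A i))\<bar> \<le> C"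
proof -
  have L0: "0 \<le> L k" if "k \<le> K" for k using wh[OF that] by (simp add: weighted_holder_def)
  have "1 < s / (3 - s)" using s by (simp add: field_simps)
  \<comment> \<open>s > 2 gives s/(3 - s) > 2, so the law has a moment of order above 2 as the
    distortion rate requires.\<close>
  then have \<tau>2: "2 < \<tau>" using \<tau> s by (smt (verit) divide_le_eq_1_pos frac_le div_by_1)
  have nbhd: "\<exists>e>0. {y - e..y + e} \<subseteq> einterval l h" if "y \<in> einterval l h" for y
  proof -
    have "\<exists>e>0. cball y e \<subseteq> einterval l h"
      using open_contains_cball that open_einterval by blast
    then show ?thesis by (simp add: cball_eq_atLeastAtMost)
  qed
  have "einterval l h \<noteq> {}"
    using supp AE_False by force
  then obtain c d where cd: "c < d" "{c..d} \<subseteq> einterval l h"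
  proof -
    obtain y where "y \<in> einterval l h" using \<open>einterval l h \<noteq> {}\<close> by blast
    then obtain r where "0 < r" "{y - r..y + r} \<subseteq> einterval l h" using nbhd by blast
    then show thesis using that[of "y - r" "y + r"] by simp
  qed
  obtain m b where mb: "density_bounds M c d m b" using db[OF cd] by blast
  obtain C0 N0 where C0: "0 \<le> C0" "0 < N0"
    and mass: "\<And>N G y. N0 \<le> N \<Longrightarrow> optimal_set M N G \<Longrightarrow>
       (infdist y G)\<^sup>2 * measure M {y - infdist y G / 4<..<y + infdist y G / 4} \<le> C0 / real N ^ 3"
    and meet: "\<And>N G. N0 \<le> N \<Longrightarrow> optimal_set M N G \<Longrightarrow> G \<inter> {c..d} \<noteq> {}"
    using optimal_set_local_mass[OF \<tau>2 int sq mb] by blast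
  obtain C1 where C1: "0 \<le> C1"
    and Di: "\<And>N G. N0 \<le> N \<Longrightarrow> optimal_set M N G \<Longrightarrow> integrable M (\<lambda>u. (real N * infdist u G) powr s)"
    and DC: "\<And>N G. N0 \<le> N \<Longrightarrow> optimal_set M N G \<Longrightarrow> (\<integral>u. (real N * infdist u G) powr s \<partial>M) \<le> C1"
  proof (rule optimal_set_mismatch[OF s \<tau> int C0])
    fix N G y assume *: "N0 \<le> N" "optimal_set M N G"
    show "(infdist y G)\<^sup>2 * measure M {y - infdist y G / 4<..<y + infdist y G / 4} \<le> C0 / real N ^ 3" by (rule mass[OF *])
    show "G \<inter> {c..d} \<noteq> {}" by (rule meet[OF *])
  qed (rule that)
  define r where "r k = real_of_ereal (a k)" for k
  have r: "a k = ereal (r k)" if "k \<in> {1..K}" for k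
  proof -
    have "a 0 < a k" "a k < a (K + 1)" using strict_mono_onD[OF a(3), of 0 k] strict_mono_onD[OF a(3), of k "K + 1"] that by auto
    then show ?thesis using a by (cases "a k") (auto simp: r_def)
  qed
  \<comment> \<open>Cells are restricted to subsets of the support interval, so a breakpoint outside
    it lies in none of them and the constant 0 serves.\<close>
  define Q where "Q k C2 N2 \<longleftrightarrow> 0 \<le> C2 \<and> (\<forall>N G p A. N2 \<le> N \<and> optimal_set M N G \<and> p \<in> G \<and> A \<in> sets borel \<and>
     A \<subseteq> einterval l h \<and> r k \<in> A \<and> (\<forall>u\<in>A. \<bar>u - p\<bar> = infdist u G) \<longrightarrow>
     real N powr (1 + \<alpha>) * \<bar>\<integral>u. (f u - f p) * indicator A u \<partial>M\<bar> \<le> C2)" for k C2 N2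
  have "\<exists>C2 N2. Q k C2 N2" if k: "k \<in> {1..K}" for k
  proof -
    show ?thesis
    proof (cases "r k \<in> einterval l h")
      case False
      then show ?thesis unfolding Q_def by (intro exI[of _ 0]) auto
    next
      case True
      then obtain e where e: "0 < e" and sub: "{r k - e..r k + e} \<subseteq> einterval l h" using nbhd by blast
      have "r k - e < r k + e" using e by simp
      then obtain m' b' where mb': "density_bounds M (r k - e) (r k + e) m' b'" using db[OF _ sub] by blast
      have lt: "a (k - 1) < ereal (r k)" "ereal (r k) < a (k + 1)"
        using strict_mono_onD[OF a(3), of "k - 1" k] strict_mono_onD[OF a(3), of k "k + 1"] k r[OF k] by auto
      have w1: "weighted_holder (einterval (a (k - 1)) (ereal (r k))) f \<alpha> (L (k - 1)) (q (k - 1)) (g (k - 1))"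
        and g1: "integrable M (\<lambda>u. g (k - 1) u powr q (k - 1) * indicator (einterval (a (k - 1)) (ereal (r k))) u)"
        using wh[of "k - 1"] gi[of "k - 1"] k r[OF k] by auto
      have w2: "weighted_holder (einterval (ereal (r k)) (a (k + 1))) f \<alpha> (L k) (q k) (g k)"
        and g2: "integrable M (\<lambda>u. g k u powr q k * indicator (einterval (ereal (r k)) (a (k + 1))) u)"
        using wh[of k] gi[of k] k r[OF k] by auto
      have "r k - e < r k" "r k < r k + e" using e by auto
      then obtain C2 N2 where "0 \<le> C2" "\<And>N G p A. N2 \<le> N \<Longrightarrow> optimal_set M N G \<Longrightarrow> p \<in> G \<Longrightarrow> A \<in> sets borel \<Longrightarrow>
         r k \<in> A \<Longrightarrow> (\<And>u. u \<in> A \<Longrightarrow> \<bar>u - p\<bar> = infdist u G) \<Longrightarrow>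
         real N powr (1 + \<alpha>) * \<bar>\<integral>u. (f u - f p) * indicator A u \<partial>M\<bar> \<le> C2"
        using integral_cell_breakpoint[OF w1 w2 lt mb' _ _ f g1 g2 C0(1) mass] by blast
      then show ?thesis unfolding Q_def by (intro exI[of _ C2] exI[of _ N2]) blast
    qed
  qed
  then obtain C2 N2 where CN: "\<And>k. k \<in> {1..K} \<Longrightarrow> Q k (C2 k) (N2 k)" by metis
  then have C2: "\<And>k. k \<in> {1..K} \<Longrightarrow> 0 \<le> C2 k" by (simp add: Q_def)
  have brk: "\<And>k N G p A. k \<in> {1..K} \<Longrightarrow> N2 k \<le> N \<Longrightarrow> optimal_set M N G \<Longrightarrow> p \<in> G \<Longrightarrow> A \<in> sets borel \<Longrightarrow>
       A \<subseteq> einterval l h \<Longrightarrow> r k \<in> A \<Longrightarrow> (\<forall>u\<in>A. \<bar>u - p\<bar> = infdist u G) \<Longrightarrow>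
       real N powr (1 + \<alpha>) * \<bar>\<integral>u. (f u - f p) * indicator A u \<partial>M\<bar> \<le> C2 k"
    using CN unfolding Q_def by blast
  define I where "I k = einterval (a k) (a (k + 1))" for k
  define \<Lambda> where "\<Lambda> = (\<Sum>k\<le>K. L k)"
  have \<Lambda>: "0 \<le> \<Lambda>" "\<And>k. k \<le> K \<Longrightarrow> L k \<le> \<Lambda>"
  proof -
    show "0 \<le> \<Lambda>" unfolding \<Lambda>_def using L0 by (intro sum_nonneg) auto
    show "L k \<le> \<Lambda>" if "k \<le> K" for k
      unfolding \<Lambda>_def using L0 that by (intro member_le_sum) auto
  qed
  define W where "W u = (\<Sum>k\<le>K. g k u powr q k * indicator (I k) u)" for u
  have Wi: "integrable M W" unfolding W_def I_def using gi by (intro Bochner_Integration.integrable_sum) auto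
  have W0: "0 \<le> W u" for u unfolding W_def by (intro sum_nonneg) auto
  define C where "C = \<Lambda> * (3 * (1 + C1) + 3 * (\<integral>u. W u \<partial>M)) + (\<Sum>k=1..K. C2 k) + 1"
  have "0 \<le> (\<integral>u. W u \<partial>M)" using W0 by simp
  then have "0 \<le> \<Lambda> * (3 * (1 + C1) + 3 * (\<integral>u. W u \<partial>M))" using \<Lambda> C1 by simp
  moreover have "0 \<le> (\<Sum>k=1..K. C2 k)" using C2 by (intro sum_nonneg) auto
  ultimately have "0 < C" by (simp add: C_def)
  define N' where "N' = N0 + (\<Sum>k=1..K. N2 k)"
  have main: "real N powr (1 + \<alpha>) * \<bar>(\<integral>u. f u \<partial>M) - (\<Sum>i=1..N. f (x i) * measure M (A i))\<bar> \<le> C"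
    if N: "N' \<le> N" and opt: "optimal_set M N (x ` {1..N})" and cells: "nearest_cells (einterval l h) N x A"
    for N x A
  proof -
    have inj: "inj_on x {1..N}"
      and A: "\<And>i. i \<in> {1..N} \<Longrightarrow> A i \<in> sets borel \<and> is_interval (A i) \<and> A i \<subseteq> einterval l h"
      and disj: "disjoint_family_on A {1..N}" and cover: "einterval l h \<subseteq> (\<Union>i\<in>{1..N}. A i)"
      and near: "\<And>i u. i \<in> {1..N} \<Longrightarrow> u \<in> A i \<Longrightarrow> \<bar>u - x i\<bar> = infdist u (x ` {1..N})"
      using cells by (simp_all add: nearest_cells_def)
    have NN0: "N0 \<le> N" using N by (simp add: N'_def)
    have NN2: "N2 k \<le> N" if "k \<in> {1..K}" for k
      using N member_le_sum[of k "{1..K}" N2] that by (simp add: N'_def)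
    have Am [measurable]: "A i \<in> sets borel" if "i \<in> {1..N}" for i using A[OF that] by blast
    define D where "D u = real N * infdist u (x ` {1..N})" for u
    define H where "H u = 3 * (1 + D u powr s) + 3 * W u" for u
    have H0: "0 \<le> H u" for u using W0 by (simp add: H_def)
    have DI: "integrable M (\<lambda>u. D u powr s)" unfolding D_def by (rule Di[OF NN0 opt])
    have Hi: "integrable M H" unfolding H_def using DI Wi by auto
    have HC: "(\<integral>u. H u \<partial>M) \<le> 3 * (1 + C1) + 3 * (\<integral>u. W u \<partial>M)"
      using DC[OF NN0 opt] DI Wi prob_space unfolding H_def D_def[symmetric] by simp
    have ind_sum: "(\<Sum>i=1..N. indicator (A i) u) = (indicator (\<Union>i\<in>{1..N}. A i) u :: real)" for u
      by (rule indicator_UN_disjoint[OF _ disj, symmetric]) simp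
    have ind1: "AE u in M. (\<Sum>i=1..N. indicator (A i) u) = (1::real)"
      using supp
    proof (rule AE_mp, intro AE_I2 impI)
      fix u assume "u \<in> einterval l h"
      then have "u \<in> (\<Union>i\<in>{1..N}. A i)" by (rule subsetD[OF cover])
      then show "(\<Sum>i=1..N. indicator (A i) u) = (1::real)"
        using ind_sum[of u] by simp
    qed
    have fAi: "integrable M (\<lambda>u. f u * indicator (A i) u)" if "i \<in> {1..N}" for i
      using fi that by (intro integrable_real_mult_indicator) auto
    have "(\<integral>u. f u \<partial>M) = (\<integral>u. (\<Sum>i=1..N. f u * indicator (A i) u) \<partial>M)"
    proof (rule integral_cong_AE)
      show "AE u in M. f u = (\<Sum>i=1..N. f u * indicator (A i) u)"
        using ind1 by eventually_elim (simp flip: sum_distrib_left)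
    qed (use fi fAi in \<open>auto intro!: borel_measurable_integrable\<close>)
    also have "\<dots> = (\<Sum>i=1..N. \<integral>u. f u * indicator (A i) u \<partial>M)"
      by (rule Bochner_Integration.integral_sum) (use fAi in auto)
    finally have "(\<integral>u. f u \<partial>M) - (\<Sum>i=1..N. f (x i) * measure M (A i))
        = (\<Sum>i=1..N. (\<integral>u. f u * indicator (A i) u \<partial>M) - (\<integral>u. f (x i) * indicator (A i) u \<partial>M))"
      by (simp add: sum_subtractf)
    also have "\<dots> = (\<Sum>i=1..N. \<integral>u. (f u - f (x i)) * indicator (A i) u \<partial>M)"
    proof (rule sum.cong[OF refl])
      fix i assume i: "i \<in> {1..N}"
      have "integrable M (\<lambda>u. f (x i) * indicator (A i) u)"
        using Am[OF i] by (simp add: integrable_real_indicator emeasure_eq_measure)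
      then show "(\<integral>u. f u * indicator (A i) u \<partial>M) - (\<integral>u. f (x i) * indicator (A i) u \<partial>M)
          = (\<integral>u. (f u - f (x i)) * indicator (A i) u \<partial>M)"
        using fAi[OF i] by (simp add: left_diff_distrib)
    qed
    finally have "real N powr (1 + \<alpha>) * \<bar>(\<integral>u. f u \<partial>M) - (\<Sum>i=1..N. f (x i) * measure M (A i))\<bar>
        \<le> real N powr (1 + \<alpha>) * (\<Sum>i=1..N. \<bar>\<integral>u. (f u - f (x i)) * indicator (A i) u \<partial>M\<bar>)"
      by (auto intro: mult_left_mono sum_abs)
    also have "\<dots> = (\<Sum>i=1..N. real N powr (1 + \<alpha>) * \<bar>\<integral>u. (f u - f (x i)) * indicator (A i) u \<partial>M\<bar>)"
      by (simp add: sum_distrib_left)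
    \<comment> \<open>Both summands are nonnegative, and each cell needs only one: the first if it
      contains no breakpoint, the second otherwise.\<close>
    also have "\<dots> \<le> (\<Sum>i=1..N. \<Lambda> * (\<integral>u. H u * indicator (A i) u \<partial>M) + (\<Sum>k=1..K. C2 k * indicator (A i) (r k)))"
    proof (rule sum_mono)
      fix i assume i: "i \<in> {1..N}"
      have HA: "integrable M (\<lambda>u. H u * indicator (A i) u)"
        using Hi i by (intro integrable_real_mult_indicator) auto
      have nn1: "0 \<le> \<Lambda> * (\<integral>u. H u * indicator (A i) u \<partial>M)"
        using \<Lambda> H0 by (intro mult_nonneg_nonneg integral_nonneg_AE) auto
      have nn2: "0 \<le> (\<Sum>k=1..K. C2 k * indicator (A i) (r k))"
        using C2 by (intro sum_nonneg) auto
      show "real N powr (1 + \<alpha>) * \<bar>\<integral>u. (f u - f (x i)) * indicator (A i) u \<partial>M\<bar>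
          \<le> \<Lambda> * (\<integral>u. H u * indicator (A i) u \<partial>M) + (\<Sum>k=1..K. C2 k * indicator (A i) (r k))"
      proof (cases "\<exists>k\<in>{1..K}. r k \<in> A i")
        case True
        then obtain k where k: "k \<in> {1..K}" "r k \<in> A i" by blast
        have "real N powr (1 + \<alpha>) * \<bar>\<integral>u. (f u - f (x i)) * indicator (A i) u \<partial>M\<bar> \<le> C2 k"
          using A[OF i] i near k by (intro brk[OF k(1) NN2[OF k(1)] opt]) auto
        also have "\<dots> = C2 k * indicator (A i) (r k)" using k by simp
        also have "\<dots> \<le> (\<Sum>k=1..K. C2 k * indicator (A i) (r k))"
          using k C2 by (intro member_le_sum) auto
        finally show ?thesis using nn1 by simp
      next
        case False
        show ?thesis
        proof (cases "A i = {}")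
          case True
          then show ?thesis using nn1 nn2 by simp
        next
          case nonempty: False
          then obtain v where v: "v \<in> A i" by blast
          obtain k where k: "k \<le> K" "a k < ereal v" "ereal v \<le> a (k + 1)"
            using ereal_breakpoints_cover[OF a(1,2)] by blast
          \<comment> \<open>A cell that left the piece of \<open>v\<close> would, being an interval,
            contain one of the two breakpoints that bound this piece.\<close>
          have sub: "A i \<subseteq> I k"
          proof
            fix u assume u: "u \<in> A i"
            have iv: "is_interval (A i)" using A[OF i] by blast
            have "a k < ereal u"
            proof (rule ccontr)
              assume *: "\<not> ?thesis"
              then have "k \<noteq> 0" using a(1) by (cases k) auto
              then have k1: "k \<in> {1..K}" using k(1) by simp
              have "ereal u \<le> ereal (r k)" "ereal (r k) < ereal v" using * k(2) unfolding r[OF k1] by (simp_all add: not_less)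
              then have "u \<le> r k" "r k \<le> v" by simp_all
              then have "r k \<in> A i" by (rule mem_is_interval_1_I[OF iv u v])
              then show False using False k1 by blast
            qed
            moreover have "ereal u < a (k + 1)"
            proof (rule ccontr)
              assume *: "\<not> ?thesis"
              then have "k \<noteq> K" using a(2) by fastforce
              then have k1: "k + 1 \<in> {1..K}" using k(1) by simp
              have "ereal v \<le> ereal (r (k + 1))" "ereal (r (k + 1)) \<le> ereal u" using * k(3) unfolding r[OF k1] by (simp_all add: not_less)
              then have "v \<le> r (k + 1)" "r (k + 1) \<le> u" by simp_all
              then have "r (k + 1) \<in> A i" by (rule mem_is_interval_1_I[OF iv v u])
              then show False using False k1 by blast
            qed
            ultimately show "u \<in> I k" by (simp add: I_def einterval_iff)
          qed
          \<comment> \<open>Almost every point lies in some cell; if that cell is not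
            \<open>A i\<close>, injectivity of \<open>x\<close> makes its grid point different from
            \<open>x i\<close>.\<close>
          have other: "AE u in M. u \<in> A i \<or> (\<exists>g\<in>x ` {1..N} - {x i}. \<bar>u - g\<bar> = infdist u (x ` {1..N}))"
            using supp
          proof eventually_elim
            case (elim u)
            obtain j where j: "j \<in> {1..N}" "u \<in> A j" using subsetD[OF cover elim] by (rule UN_E)
            show ?case
            proof (cases "j = i")
              case False
              then have "x j \<noteq> x i" using inj_onD[OF inj] i j by blast
              then show ?thesis using j near[OF j] by blast
            qed (use j in auto)
          qed
          note st = optimal_set_stationary[OF sq opt imageI[OF i] Am[OF i] near[OF i] other]
          have "real N powr (1 + \<alpha>) * \<bar>\<integral>u. (f u - f (x i)) * indicator (A i) u \<partial>M\<bar>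
             \<le> L k * (\<integral>u. (3 * (1 + D u powr s) + 3 * (g k u powr q k * indicator (I k) u)) * indicator (A i) u \<partial>M)"
            unfolding I_def
            by (rule integral_cell_regular[OF wh[OF k(1)] Am[OF i] sub[unfolded I_def] st(2) _ sq_le[OF k(1)] st(1) fi gi[OF k(1)] DI])
               (use near i in \<open>auto simp: D_def\<close>)
          also have "\<dots> \<le> \<Lambda> * (\<integral>u. H u * indicator (A i) u \<partial>M)"
          proof (rule mult_mono)
            show "(\<integral>u. (3 * (1 + D u powr s) + 3 * (g k u powr q k * indicator (I k) u)) * indicator (A i) u \<partial>M)
                \<le> (\<integral>u. H u * indicator (A i) u \<partial>M)"
            proof (rule integral_mono_AE'[OF HA])
              have "g k u powr q k * indicator (I k) u \<le> W u" for u
                unfolding W_def using k by (intro member_le_sum) auto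
              then show "AE u in M. (3 * (1 + D u powr s) + 3 * (g k u powr q k * indicator (I k) u)) * indicator (A i) u
                  \<le> H u * indicator (A i) u"
                by (auto simp: H_def indicator_def intro!: AE_I2)
              show "AE u in M. 0 \<le> H u * indicator (A i) u" using H0 by auto
            qed
          qed (use \<Lambda> k in \<open>auto intro!: integral_nonneg_AE\<close>)
          finally show ?thesis using nn2 by simp
        qed
      qed
    qed
    also have "\<dots> = \<Lambda> * (\<Sum>i=1..N. \<integral>u. H u * indicator (A i) u \<partial>M) + (\<Sum>k=1..K. C2 k * (\<Sum>i=1..N. indicator (A i) (r k)))"
    proof -
      have "(\<Sum>i=1..N. \<Sum>k=1..K. C2 k * indicator (A i) (r k)) = (\<Sum>k=1..K. \<Sum>i=1..N. C2 k * indicator (A i) (r k) :: real)"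
        by (rule sum.swap)
      then show ?thesis by (simp only: sum.distrib sum_distrib_left)
    qed
    also have "\<dots> \<le> \<Lambda> * (3 * (1 + C1) + 3 * (\<integral>u. W u \<partial>M)) + (\<Sum>k=1..K. C2 k)"
    proof (intro add_mono mult_left_mono sum_mono)
      have "(\<Sum>i=1..N. \<integral>u. H u * indicator (A i) u \<partial>M) = (\<integral>u. (\<Sum>i=1..N. H u * indicator (A i) u) \<partial>M)"
        by (rule Bochner_Integration.integral_sum[symmetric]) (use Hi in \<open>auto intro!: integrable_real_mult_indicator\<close>)
      also have "\<dots> = (\<integral>u. H u \<partial>M)"
      proof (rule integral_cong_AE)
        show "AE u in M. (\<Sum>i=1..N. H u * indicator (A i) u) = H u"
          using ind1 by eventually_elim (simp flip: sum_distrib_left)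
      qed (use Hi in \<open>auto intro!: borel_measurable_sum borel_measurable_times borel_measurable_indicator\<close>)
      finally show "(\<Sum>i=1..N. \<integral>u. H u * indicator (A i) u \<partial>M) \<le> 3 * (1 + C1) + 3 * (\<integral>u. W u \<partial>M)"
        using HC by simp
      fix k assume k: "k \<in> {1..K}"
      have "(\<Sum>i=1..N. indicator (A i) (r k)) \<le> (1::real)"
        unfolding ind_sum by (simp add: indicator_def)
      then show "C2 k * (\<Sum>i=1..N. indicator (A i) (r k)) \<le> C2 k"
        using mult_left_mono[OF _ C2[OF k], of _ 1] by simp
    qed (use \<Lambda> in auto)
    also have "\<dots> \<le> C" by (simp add: C_def)
    finally show ?thesis .
  qed
  show ?thesis by (rule that[OF \<open>0 < C\<close>, of N']) (rule main)
qed

end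

section \<open>Supports and Voronoi cells\<close>

context real_distribution
begin

text \<open>By second countability the complement of the support is the union of countably many null
  basic open sets.\<close>

lemma null_compl_support: "- measure_support M \<in> null_sets M"
proof -
  obtain B :: "real set set" where B: "countable B" "topological_basis B"
    using ex_countable_basis by blast
  define B0 where "B0 = {b \<in> B. emeasure M b = 0}"
  have "(\<Union>b\<in>B0. b) \<in> null_sets M"
  proof (rule null_sets_UN')
    show "countable B0" unfolding B0_def using B by auto
    fix b assume b: "b \<in> B0"
    then have "open b" using B topological_basis_open by (auto simp: B0_def)
    then show "b \<in> null_sets M" using b by (auto simp: B0_def null_sets_def)
  qed
  moreover have "- measure_support M = (\<Union>b\<in>B0. b)"
  proof (intro equalityI subsetI)
    fix u assume "u \<in> - measure_support M"
    then obtain U where U: "open U" "u \<in> U" "emeasure M U = 0"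
      by (auto simp: measure_support_def)
    obtain b where b: "b \<in> B" "u \<in> b" "b \<subseteq> U" using topological_basisE[OF B(2) U(1,2)] by blast
    then have "emeasure M b \<le> emeasure M U" using U by (intro emeasure_mono) auto
    then show "u \<in> (\<Union>b\<in>B0. b)" using b U by (auto simp: B0_def)
  next
    fix u assume "u \<in> (\<Union>b\<in>B0. b)"
    then obtain b where "b \<in> B" "emeasure M b = 0" "u \<in> b" by (auto simp: B0_def)
    moreover from this have "open b" using B topological_basis_open by auto
    ultimately show "u \<in> - measure_support M" by (auto simp: measure_support_def)
  qed
  ultimately show ?thesis by simp
qed

end

lemma is_interval_einterval: "is_interval (einterval l h)"
  unfolding is_interval_1
proof (intro ballI allI impI)
  fix a b x assume "a \<in> einterval l h" "b \<in> einterval l h" "a \<le> x \<and> x \<le> b"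
  then have "l < ereal a" "ereal a \<le> ereal x" "ereal x \<le> ereal b" "ereal b < h"
    by (auto simp: einterval_iff)
  then show "x \<in> einterval l h"
    unfolding einterval_iff using less_le_trans le_less_trans by blast
qed

text \<open>Positivity and regularity of the density are given on the interior of the support, while
  the cells are cut to the open interval between its extended endpoints; this inclusion connects the
  two.\<close>

lemma einterval_subset_interior:
  fixes S :: "real set"
  assumes "connected S"
  shows "einterval (Inf (ereal ` S)) (Sup (ereal ` S)) \<subseteq> interior S"
proof (rule interior_maximal)
  show "einterval (Inf (ereal ` S)) (Sup (ereal ` S)) \<subseteq> S"
  proof
    fix u assume "u \<in> einterval (Inf (ereal ` S)) (Sup (ereal ` S))"
    then obtain s t where "s \<in> S" "s < u" "t \<in> S" "u < t"
      by (auto simp: einterval_iff Inf_less_iff less_Sup_iff)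
    then show "u \<in> S"
      using assms mem_is_interval_1_I[of S s t u] by (simp add: is_interval_connected_1)
  qed
qed simp

lemma AE_einterval_support:
  assumes "real_distribution \<mu>" and atom: "\<And>u. emeasure \<mu> {u} = 0"
  shows "AE u in \<mu>. u \<in> einterval (Inf (ereal ` measure_support \<mu>)) (Sup (ereal ` measure_support \<mu>))"
proof -
  interpret real_distribution \<mu> by fact
  define S where "S = measure_support \<mu>"
  define l where "l = Inf (ereal ` S)"
  define h where "h = Sup (ereal ` S)"
  have "AE u in \<mu>. u \<in> S" using AE_not_in[OF null_compl_support] by (simp add: S_def)
  moreover have "AE u in \<mu>. u \<notin> {v}" for v by (rule AE_not_in) (simp add: null_sets_def atom)
  \<comment> \<open>For an infinite endpoint \<open>real_of_ereal\<close> is 0; excluding that point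
    is harmless because single points are null.\<close>
  then have "AE u in \<mu>. u \<noteq> real_of_ereal l" "AE u in \<mu>. u \<noteq> real_of_ereal h" by simp_all
  ultimately have "AE u in \<mu>. u \<in> einterval l h"
  proof eventually_elim
    case (elim u)
    have "l \<le> ereal u" "ereal u \<le> h"
      unfolding l_def h_def using elim by (auto intro: Inf_lower Sup_upper)
    moreover have "l \<noteq> ereal u" "ereal u \<noteq> h" using elim by auto
    ultimately show ?case by (auto simp: einterval_iff)
  qed
  then show ?thesis by (simp add: l_def h_def S_def)
qed

lemma density_bounds_of_density:
  fixes \<phi> :: "real \<Rightarrow> real"
  assumes \<mu>: "\<mu> = density lborel (\<lambda>u. ennreal (\<phi> u))" "prob_space \<mu>"
    and \<phi> [measurable]: "\<phi> \<in> borel_measurable borel"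
    and cd: "c < d" and cont: "continuous_on {c..d} \<phi>" and pos: "\<And>u. u \<in> {c..d} \<Longrightarrow> 0 < \<phi> u"
  shows "\<exists>m b. density_bounds \<mu> c d m b"
proof -
  interpret prob_space \<mu> by fact
  obtain y where y: "y \<in> {c..d}" "\<And>u. u \<in> {c..d} \<Longrightarrow> \<phi> y \<le> \<phi> u"
    using continuous_attains_inf[OF compact_Icc _ cont] cd by auto
  obtain z where z: "z \<in> {c..d}" "\<And>u. u \<in> {c..d} \<Longrightarrow> \<phi> u \<le> \<phi> z"
    using continuous_attains_sup[OF compact_Icc _ cont] cd by auto
  have "\<phi> y * (f - e) \<le> measure \<mu> {e<..<f} \<and> measure \<mu> {e..f} \<le> \<phi> z * (f - e)"
    if ef: "c \<le> e" "e \<le> f" "f \<le> d" for e f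
  proof
    have "ennreal (\<phi> y * (f - e)) = (\<integral>\<^sup>+u. ennreal (\<phi> y) * indicator {e<..<f} u \<partial>lborel)"
      using ef pos[OF y(1)] by (subst nn_integral_cmult_indicator) (auto simp: ennreal_mult)
    also have "\<dots> \<le> (\<integral>\<^sup>+u. ennreal (\<phi> u) * indicator {e<..<f} u \<partial>lborel)"
      using y ef by (intro nn_integral_mono) (auto simp: indicator_def intro!: ennreal_leI)
    also have "\<dots> = emeasure \<mu> {e<..<f}" unfolding \<mu> by (subst emeasure_density) auto
    finally show "\<phi> y * (f - e) \<le> measure \<mu> {e<..<f}"
      by (simp add: emeasure_eq_measure)
    have "emeasure \<mu> {e..f} = (\<integral>\<^sup>+u. ennreal (\<phi> u) * indicator {e..f} u \<partial>lborel)"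
      unfolding \<mu> by (subst emeasure_density) auto
    also have "\<dots> \<le> (\<integral>\<^sup>+u. ennreal (\<phi> z) * indicator {e..f} u \<partial>lborel)"
      using z ef by (intro nn_integral_mono) (auto simp: indicator_def intro!: ennreal_leI)
    also have "\<dots> = ennreal (\<phi> z * (f - e))"
      using ef pos[OF z(1)] by (subst nn_integral_cmult_indicator) (auto simp: ennreal_mult)
    finally show "measure \<mu> {e..f} \<le> \<phi> z * (f - e)"
      using ef pos[OF z(1)] by (simp add: emeasure_eq_measure)
  qed
  then show ?thesis
    unfolding density_bounds_def using cd pos[OF y(1)] pos[OF z(1)] less_imp_le by blast
qed

lemma Min_sq_eq_infdist_sq:
  fixes x :: "nat \<Rightarrow> real"
  assumes "1 \<le> N"
  shows "(MIN i\<in>{1..N}. \<bar>u - x i\<bar>\<^sup>2) = (infdist u (x ` {1..N}))\<^sup>2"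
proof -
  obtain b where b: "b \<in> x ` {1..N}" "infdist u (x ` {1..N}) = dist u b"
    using infdist_finite_attained[of "x ` {1..N}" u] assms by auto
  show ?thesis
  proof (rule Min_eqI)
    show "(infdist u (x ` {1..N}))\<^sup>2 \<in> (\<lambda>i. \<bar>u - x i\<bar>\<^sup>2) ` {1..N}"
      using b by (auto simp: dist_real_def)
    fix y assume "y \<in> (\<lambda>i. \<bar>u - x i\<bar>\<^sup>2) ` {1..N}"
    then obtain i where "i \<in> {1..N}" "y = \<bar>u - x i\<bar>\<^sup>2" by auto
    then show "(infdist u (x ` {1..N}))\<^sup>2 \<le> y"
      using infdist_le[of "x i" "x ` {1..N}" u] infdist_nonneg[of u "x ` {1..N}"]
      by (simp only: dist_real_def power_mono imageI)
  qed simp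
qed

lemma quadratic_distortion_eq:
  assumes "X \<in> borel_measurable M" "1 \<le> N"
  shows "quadratic_distortion M X N x = distortion (distr M borel X) (x ` {1..N})"
  unfolding quadratic_distortion_def distortion_def Min_sq_eq_infdist_sq[OF assms(2)]
  by (rule integral_distr[symmetric]) (use assms in measurable)

lemma optimal_set_of_grid:
  assumes X: "X \<in> borel_measurable M" and N: "1 \<le> N" and opt: "quadratic_optimal_grid M X N x"
  shows "optimal_set (distr M borel X) N (x ` {1..N})"
  unfolding optimal_set_def
proof (intro conjI allI impI)
  show "card (x ` {1..N}) \<le> N" using card_image_le[of "{1..N}" x] by simp
  fix B :: "real set" assume B: "finite B \<and> B \<noteq> {} \<and> card B \<le> N"
  obtain y where y: "bij_betw y {1..card B} B" using ex_bij_betw_nat_finite_1 B by blast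
  have cB: "1 \<le> card B" using B by (simp add: Suc_leI card_gt_0_iff)
  \<comment> \<open>A competitor with fewer than \<open>N\<close> points becomes an
    \<open>N\<close>-tuple by repeating its first point.\<close>
  define z where "z i = (if i \<le> card B then y i else y 1)" for i
  have "z ` {1..N} = B"
  proof
    have "y 1 \<in> B" using y cB by (auto simp: bij_betw_def)
    then show "z ` {1..N} \<subseteq> B" using y by (auto simp: z_def bij_betw_def)
    have "B = z ` {1..card B}" using y by (auto simp: z_def bij_betw_def)
    also have "\<dots> \<subseteq> z ` {1..N}" using B by (intro image_mono) auto
    finally show "B \<subseteq> z ` {1..N}" .
  qed
  moreover have "quadratic_distortion M X N x \<le> quadratic_distortion M X N z"
    using opt by (simp add: quadratic_optimal_grid_def)
  ultimately show "distortion (distr M borel X) (x ` {1..N}) \<le> distortion (distr M borel X) B"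
    by (simp add: quadratic_distortion_eq[OF X N])
qed (use N in auto)

context
  fixes S :: "real set" and N :: nat and x :: "nat \<Rightarrow> real"
  assumes mono: "strict_mono_on {1..N} x"
begin

lemma grid_le: "i \<in> {1..N} \<Longrightarrow> j \<in> {1..N} \<Longrightarrow> i \<le> j \<Longrightarrow> x i \<le> x j"
  using strict_mono_onD[OF mono, of i j] by (cases "i = j") auto

lemma voronoi_cell_lower:
  assumes i: "i \<in> {1..N}" and u: "u \<in> voronoi_cell S N x i"
  shows "i = 1 \<Longrightarrow> Inf (ereal ` S) < ereal u" "1 < i \<Longrightarrow> x (i - 1) + x i < 2 * u"
  using assms by (auto simp: voronoi_cell_def voronoi_edge_def split: if_splits)

lemma voronoi_cell_upper:
  assumes i: "i \<in> {1..N}" and u: "u \<in> voronoi_cell S N x i"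
  shows "i = N \<Longrightarrow> ereal u < Sup (ereal ` S)" "i < N \<Longrightarrow> 2 * u \<le> x i + x (i + 1)"
  using assms by (auto simp: voronoi_cell_def voronoi_edge_def split: if_splits)

lemma voronoi_cell_borel [measurable]: "voronoi_cell S N x i \<in> sets borel"
  unfolding voronoi_cell_def by (cases "i < N") simp_all

lemma voronoi_cell_interval: "is_interval (voronoi_cell S N x i)"
  unfolding is_interval_1 voronoi_cell_def
  by (auto intro: less_le_trans le_less_trans order_trans simp flip: ereal_less_eq(3))

text \<open>The edges compare \<open>u\<close> only with the two neighbours of \<open>x i\<close>;
  by monotonicity of the grid all other points are at least as far away.\<close>

lemma voronoi_cell_nearest:
  assumes i: "i \<in> {1..N}" and u: "u \<in> voronoi_cell S N x i"
  shows "\<bar>u - x i\<bar> = infdist u (x ` {1..N})"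
proof (rule antisym)
  show "\<bar>u - x i\<bar> \<le> infdist u (x ` {1..N})"
  proof (rule infdist_greatest)
    fix b assume "b \<in> x ` {1..N}"
    then obtain j where j: "j \<in> {1..N}" "b = x j" by auto
    consider "j = i" | "j < i" | "i < j" by linarith
    then show "\<bar>u - x i\<bar> \<le> dist u b"
    proof cases
      case 2
      then have "x (i - 1) + x i < 2 * u" "x j \<le> x (i - 1)" "x j \<le> x i"
        using voronoi_cell_lower(2)[OF i u] grid_le[of j "i - 1"] grid_le[of j i] i j by auto
      then show ?thesis unfolding j dist_real_def by linarith
    next
      case 3
      then have "2 * u \<le> x i + x (i + 1)" "x (i + 1) \<le> x j" "x i \<le> x j"
        using voronoi_cell_upper(2)[OF i u] grid_le[of "i + 1" j] grid_le[of i j] i j by auto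
      then show ?thesis unfolding j dist_real_def by linarith
    qed (simp add: j dist_real_def)
  qed (use i in auto)
  show "infdist u (x ` {1..N}) \<le> \<bar>u - x i\<bar>"
    using infdist_le[of "x i" "x ` {1..N}" u] i by (simp add: dist_real_def)
qed

lemma voronoi_cell_disjoint: "disjoint_family_on (voronoi_cell S N x) {1..N}"
proof -
  have aux: "voronoi_cell S N x i \<inter> voronoi_cell S N x j = {}" if ij: "i \<in> {1..N}" "j \<in> {1..N}" "i < j" for i j
  proof (rule ccontr)
    assume "\<not> ?thesis"
    then obtain u where u: "u \<in> voronoi_cell S N x i" "u \<in> voronoi_cell S N x j" by auto
    have "2 * u \<le> x i + x (i + 1)" using voronoi_cell_upper(2)[OF ij(1) u(1)] ij by auto
    moreover have "x (j - 1) + x j < 2 * u" using voronoi_cell_lower(2)[OF ij(2) u(2)] ij by auto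
    moreover have "x i \<le> x (j - 1)" "x (i + 1) \<le> x j"
      using grid_le[of i "j - 1"] grid_le[of "i + 1" j] ij by auto
    ultimately show False by linarith
  qed
  show ?thesis unfolding disjoint_family_on_def
    using aux by (metis inf_commute linorder_neqE_nat)
qed

lemma voronoi_cell_cover:
  assumes N: "1 \<le> N" and u: "u \<in> einterval (Inf (ereal ` S)) (Sup (ereal ` S))"
  shows "\<exists>i\<in>{1..N}. u \<in> voronoi_cell S N x i"
proof -
  define P where "P i \<longleftrightarrow> 1 \<le> i \<and> (i = N \<or> ereal u \<le> voronoi_edge S N x i)" for i
  define i where "i = (LEAST i. P i)"
  have "P N" using N by (simp add: P_def)
  then have Pi: "P i" and iN: "i \<le> N" unfolding i_def by (auto intro: LeastI Least_le)
  have "voronoi_edge S N x (i - 1) < ereal u"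
  proof (cases "i = 1")
    case True
    then show ?thesis using u by (simp add: voronoi_edge_def einterval_iff)
  next
    case False
    have "1 \<le> i" using Pi by (simp add: P_def)
    with False have i1: "i - 1 < i" "1 \<le> i - 1" by auto
    have "\<not> P (i - 1)" using not_less_Least[of "i - 1" P] i1(1) unfolding i_def[symmetric] .
    then show ?thesis using i1 unfolding P_def by (metis not_le)
  qed
  moreover have "ereal u \<le> voronoi_edge S N x i" if "i < N" using Pi that by (simp add: P_def)
  moreover have "ereal u < voronoi_edge S N x i" if "i = N"
    using u that N by (simp add: voronoi_edge_def einterval_iff)
  ultimately have "u \<in> voronoi_cell S N x i" using iN by (auto simp: voronoi_cell_def)
  then show ?thesis using iN Pi by (auto simp: P_def)
qed

end

section \<open>Transfer from the law to the random variable\<close>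

lemma integral_quantization:
  fixes f :: "real \<Rightarrow> real"
  assumes M: "prob_space M" and X: "X \<in> borel_measurable M"
    and mono: "strict_mono_on {1..N} x" and N: "1 \<le> N" and f: "f \<in> borel_measurable borel"
  defines "S \<equiv> measure_support (distr M borel X)"
  defines "J \<equiv> einterval (Inf (ereal ` S)) (Sup (ereal ` S))"
  assumes J: "AE u in distr M borel X. u \<in> J"
  shows "(\<integral>\<omega>. f (quantization M X N x \<omega>) \<partial>M)
     = (\<Sum>i=1..N. f (x i) * measure (distr M borel X) (voronoi_cell S N x i \<inter> J))"
proof -
  interpret M: prob_space M by fact
  interpret D: prob_space "distr M borel X" by (rule M.prob_space_distr[OF X])
  have cm [measurable]: "voronoi_cell S N x i \<in> sets borel" for i by (rule voronoi_cell_borel[OF mono])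
  have Jm [measurable]: "J \<in> sets borel" by (simp add: J_def)
  define Q where "Q u = (\<Sum>i=1..N. x i * indicator (voronoi_cell S N x i) u)" for u
  have Qm [measurable]: "Q \<in> borel_measurable borel" unfolding Q_def by measurable
  have "(\<integral>\<omega>. f (quantization M X N x \<omega>) \<partial>M) = (\<integral>\<omega>. f (Q (X \<omega>)) \<partial>M)"
    by (simp add: quantization_def Q_def S_def)
  also have "\<dots> = (\<integral>u. f (Q u) \<partial>distr M borel X)"
    by (rule integral_distr[symmetric]) (use X f in measurable)
  also have "\<dots> = (\<integral>u. (\<Sum>i=1..N. f (x i) * indicator (voronoi_cell S N x i \<inter> J) u) \<partial>distr M borel X)"
  proof (rule integral_cong_AE)
    show "AE u in distr M borel X. f (Q u) = (\<Sum>i=1..N. f (x i) * indicator (voronoi_cell S N x i \<inter> J) u)"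
      using J
    proof eventually_elim
      case (elim u)
      obtain i where i: "i \<in> {1..N}" "u \<in> voronoi_cell S N x i"
        using voronoi_cell_cover[OF mono N elim[unfolded J_def]] by blast
      \<comment> \<open>For \<open>u\<close> in \<open>J\<close> exactly one indicator is 1, so
        applying \<open>f\<close> commutes with the sum. A point in no cell would have quantization
        0, which is why the identity is stated almost everywhere.\<close>
      have *: "(\<Sum>j=1..N. h j * indicator (voronoi_cell S N x j) u) = (h i :: real)" for h
      proof -
        have "(\<Sum>j=1..N. h j * indicator (voronoi_cell S N x j) u) = (\<Sum>j=1..N. if j = i then h j else 0)"
        proof (rule sum.cong[OF refl])
          fix j assume "j \<in> {1..N}"
          then have *: "u \<notin> voronoi_cell S N x j" if "j \<noteq> i"
            using voronoi_cell_disjoint[OF mono, of S] i that unfolding disjoint_family_on_def by blast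
          show "h j * indicator (voronoi_cell S N x j) u = (if j = i then h j else 0)"
            using i * by (cases "j = i") simp_all
        qed
        then show ?thesis using i by simp
      qed
      show ?case using *[of x] *[of "\<lambda>j. f (x j)"] elim by (simp add: Q_def indicator_inter_arith)
    qed
  qed (use f in measurable)
  also have "\<dots> = (\<Sum>i=1..N. f (x i) * measure (distr M borel X) (voronoi_cell S N x i \<inter> J))"
    by (subst Bochner_Integration.integral_sum) (auto simp: integrable_real_indicator D.emeasure_eq_measure)
  finally show ?thesis .
qed

text \<open>Allowing \<alpha> = 1 covers both statements, as 3/(2 - \<alpha>) is then 3. The
  constant is fixed before the grids, so one \<open>C\<close> serves every sequence of optimal
  grids.\<close>

lemma limsup_weak_error:
  fixes M :: "'w measure" and X :: "'w \<Rightarrow> real" and \<phi> f :: "real \<Rightarrow> real"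
    and K :: nat and a :: "nat \<Rightarrow> ereal"
    and \<alpha> s \<delta> :: real and L q :: "nat \<Rightarrow> real" and g :: "nat \<Rightarrow> real \<Rightarrow> real"
  assumes M: "prob_space M"
    and X: "X \<in> borel_measurable M"
    and X2: "integrable M (\<lambda>\<omega>. (X \<omega>)\<^sup>2)"
    and \<phi>0: "\<forall>u. 0 \<le> \<phi> u"
    and dist: "distributed M lborel X (\<lambda>u. ennreal (\<phi> u))"
    and conn: "connected (measure_support (distr M borel X))"
    and lip: "\<forall>A. compact A \<and> A \<subseteq> interior (measure_support (distr M borel X)) \<longrightarrow>
               (\<forall>u\<in>A. 0 < \<phi> u) \<and> (\<exists>L. L-lipschitz_on A \<phi>)"
    and f: "continuous_on UNIV f"
    and f2: "integrable M (\<lambda>\<omega>. (f (X \<omega>))\<^sup>2)"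
    and a: "a 0 = -\<infinity>" "a (K + 1) = \<infinity>" "strict_mono_on {0..K + 1} a"
    and diff: "\<forall>k\<in>{0..K}. \<forall>u\<in>einterval (a k) (a (k + 1)). f differentiable (at u)"
    and \<alpha>: "0 < \<alpha>" "\<alpha> \<le> 1"
    and piece: "\<forall>k\<in>{0..K}.
           0 \<le> L k \<and> 3 / (2 - \<alpha>) < q k \<and>
           (\<forall>u\<in>einterval (a k) (a (k + 1)). 0 \<le> g k u) \<and>
           convex_on (einterval (a k) (a (k + 1))) (\<lambda>u. g k u powr q k) \<and>
           integrable M (\<lambda>\<omega>. g k (X \<omega>) powr q k *
                              indicator (einterval (a k) (a (k + 1))) (X \<omega>)) \<and>
           (\<forall>u\<in>einterval (a k) (a (k + 1)). \<forall>v\<in>einterval (a k) (a (k + 1)).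
              \<bar>deriv f u - deriv f v\<bar> \<le> L k * \<bar>u - v\<bar> powr \<alpha> * (g k u + g k v))"
    and s: "2 < s" "s < 3" "s \<ge> (1 + \<alpha>) * (MAX k\<in>{0..K}. q k / (q k - 1))"
    and \<delta>: "0 < \<delta>" "integrable M (\<lambda>\<omega>. \<bar>X \<omega>\<bar> powr (s / (3 - s) + \<delta>))"
  shows "\<exists>C>0. \<forall>x :: nat \<Rightarrow> nat \<Rightarrow> real.
           (\<forall>N\<ge>1. quadratic_optimal_grid M X N (x N)) \<longrightarrow>
           limsup (\<lambda>N. ereal (real N powr (1 + \<alpha>) *
             \<bar>(\<integral>\<omega>. f (X \<omega>) \<partial>M) - (\<integral>\<omega>. f (quantization M X N (x N) \<omega>) \<partial>M)\<bar>)) \<le> ereal C"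
proof -
  interpret M: prob_space M by fact
  define \<mu> where "\<mu> = distr M borel X"
  have rd: "real_distribution \<mu>"
    unfolding \<mu>_def by (rule M.real_distribution_distr) (rule X)
  interpret \<mu>: real_distribution \<mu> by fact
  define S where "S = measure_support \<mu>"
  define l where "l = Inf (ereal ` S)"
  define h where "h = Sup (ereal ` S)"
  define \<tau> where "\<tau> = s / (3 - s) + \<delta>"
  have \<phi>m [measurable]: "\<phi> \<in> borel_measurable borel"
  proof -
    have "(\<lambda>u. ennreal (\<phi> u)) \<in> borel_measurable borel"
      using dist by (simp add: distributed_def)
    then have "(\<lambda>u. enn2real (ennreal (\<phi> u))) \<in> borel_measurable borel" by measurable
    then show ?thesis using \<phi>0 by simp
  qed
  have \<mu>d: "\<mu> = density lborel (\<lambda>u. ennreal (\<phi> u))"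
  proof -
    have "\<mu> = distr M lborel X" unfolding \<mu>_def by (rule distr_cong) auto
    then show ?thesis using dist by (simp add: distributed_def)
  qed
  have atom: "emeasure \<mu> {u} = 0" for u
  proof -
    have "emeasure \<mu> {u} = (\<integral>\<^sup>+v. ennreal (\<phi> v) * indicator {u} v \<partial>lborel)"
      unfolding \<mu>d by (subst emeasure_density) auto
    also have "\<dots> = 0" by (subst nn_integral_0_iff_AE) (auto intro!: AE_I[of _ _ "{u}"] simp: indicator_def)
    finally show ?thesis .
  qed
  have supp: "AE u in \<mu>. u \<in> einterval l h"
    unfolding l_def h_def S_def by (rule AE_einterval_support[OF rd atom])
  have conS: "connected S" using conn by (simp add: S_def \<mu>_def)
  have db: "\<exists>m b. density_bounds \<mu> c d m b" if cd: "c < d" "{c..d} \<subseteq> einterval l h" for c d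
  proof -
    have "{c..d} \<subseteq> interior S"
      using cd(2) einterval_subset_interior[OF conS] unfolding l_def h_def by blast
    then have *: "(\<forall>u\<in>{c..d}. 0 < \<phi> u)" "\<exists>L. L-lipschitz_on {c..d} \<phi>"
      using lip unfolding S_def \<mu>_def by (metis compact_Icc)+
    then show ?thesis
      by (intro density_bounds_of_density[OF \<mu>d \<mu>.prob_space_axioms \<phi>m cd(1)])
         (auto intro: lipschitz_on_continuous_on)
  qed
  have sq: "integrable \<mu> (\<lambda>u. u\<^sup>2)"
    unfolding \<mu>_def using X X2 by (subst integrable_distr_eq) auto
  have int: "integrable \<mu> (\<lambda>u. \<bar>u\<bar> powr \<tau>)"
    unfolding \<mu>_def using X \<delta> by (subst integrable_distr_eq) (auto simp: \<tau>_def)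
  have fm [measurable]: "f \<in> borel_measurable borel"
    using f by (rule borel_measurable_continuous_onI)
  have fX: "integrable M (\<lambda>\<omega>. f (X \<omega>))"
    by (rule M.square_integrable_imp_integrable[OF _ f2]) (use X in measurable)
  have fi: "integrable \<mu> f"
    unfolding \<mu>_def using X fX by (subst integrable_distr_eq) auto
  have fint: "(\<integral>\<omega>. f (X \<omega>) \<partial>M) = (\<integral>u. f u \<partial>\<mu>)"
    unfolding \<mu>_def by (rule integral_distr[symmetric]) (use X in measurable)
  have wh: "weighted_holder (einterval (a k) (a (k + 1))) f \<alpha> (L k) (q k) (g k)" if k: "k \<le> K" for k
  proof -
    have k': "k \<in> {0..K}" using k by simp
    have "1 < 3 / (2 - \<alpha>)" using \<alpha> by (simp add: field_simps)
    also have "3 / (2 - \<alpha>) < q k" using bspec[OF piece k'] by (elim conjE)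
    finally have "1 < q k" .
    then show ?thesis
      using bspec[OF piece k'] bspec[OF diff k'] \<alpha> by unfold_locales auto
  qed
  have gi: "integrable \<mu> (\<lambda>u. g k u powr q k * indicator (einterval (a k) (a (k + 1))) u)" if k: "k \<le> K" for k
    proof -
    have "integrable M (\<lambda>\<omega>. g k (X \<omega>) powr q k * indicator (einterval (a k) (a (k + 1))) (X \<omega>))"
      using bspec[OF piece, of k] k by simp
    then show ?thesis
      unfolding \<mu>_def by (subst integrable_distr_eq[OF X weighted_holder.measurable_g[OF wh[OF k]]])
  qed
  have sq_le: "(1 + \<alpha>) * (q k / (q k - 1)) \<le> s" if k: "k \<le> K" for k
  proof -
    have "q k / (q k - 1) \<le> (MAX k\<in>{0..K}. q k / (q k - 1))" using k by (intro Max_ge) auto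
    then have "(1 + \<alpha>) * (q k / (q k - 1)) \<le> (1 + \<alpha>) * (MAX k\<in>{0..K}. q k / (q k - 1))"
      using \<alpha> by (intro mult_left_mono) auto
    then show ?thesis using s(3) by linarith
  qed
  have \<tau>s: "s / (3 - s) < \<tau>" using \<delta> by (simp add: \<tau>_def)
  obtain C N0 where C: "0 < C"
    and bound: "\<And>N x A. N0 \<le> N \<Longrightarrow> optimal_set \<mu> N (x ` {1..N}) \<Longrightarrow> nearest_cells (einterval l h) N x A \<Longrightarrow>
      real N powr (1 + \<alpha>) * \<bar>(\<integral>u. f u \<partial>\<mu>) - (\<Sum>i=1..N. f (x i) * measure \<mu> (A i))\<bar> \<le> C"
  proof (rule \<mu>.weak_error_bound[OF supp _ sq s(1,2) \<tau>s int f fi a])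
    show "\<exists>m b. density_bounds \<mu> c d m b" if "c < d" "{c..d} \<subseteq> einterval l h" for c d by (rule db[OF that])
    show "weighted_holder (einterval (a k) (a (k + 1))) f \<alpha> (L k) (q k) (g k)" if "k \<le> K" for k by (rule wh[OF that])
    show "integrable \<mu> (\<lambda>u. g k u powr q k * indicator (einterval (a k) (a (k + 1))) u)" if "k \<le> K" for k by (rule gi[OF that])
    show "(1 + \<alpha>) * (q k / (q k - 1)) \<le> s" if "k \<le> K" for k by (rule sq_le[OF that])
  qed (rule that)
  have main: "real N powr (1 + \<alpha>) * \<bar>(\<integral>\<omega>. f (X \<omega>) \<partial>M) - (\<integral>\<omega>. f (quantization M X N x \<omega>) \<partial>M)\<bar> \<le> C"
    if N: "N0 \<le> N" "1 \<le> N" and opt: "quadratic_optimal_grid M X N x" for N x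
  proof -
    have mono: "strict_mono_on {1..N} x" using opt by (simp add: quadratic_optimal_grid_def)
    have Q: "(\<integral>\<omega>. f (quantization M X N x \<omega>) \<partial>M)
       = (\<Sum>i=1..N. f (x i) * measure \<mu> (voronoi_cell S N x i \<inter> einterval l h))"
      unfolding S_def l_def h_def \<mu>_def
      by (rule integral_quantization[OF M X mono N(2) fm supp[unfolded l_def h_def S_def \<mu>_def]])
    show ?thesis unfolding Q fint
    proof (rule bound[OF N(1)])
      show "optimal_set \<mu> N (x ` {1..N})" unfolding \<mu>_def by (rule optimal_set_of_grid[OF X N(2) opt])
      have "is_interval (voronoi_cell S N x i \<inter> einterval l h)" for i
        using voronoi_cell_interval[OF mono] is_interval_einterval by (rule is_interval_Int)
      moreover have "disjoint_family_on (\<lambda>i. voronoi_cell S N x i \<inter> einterval l h) {1..N}"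
        using voronoi_cell_disjoint[OF mono, of S] unfolding disjoint_family_on_def by blast
      moreover have "einterval l h \<subseteq> (\<Union>i\<in>{1..N}. voronoi_cell S N x i \<inter> einterval l h)"
        using voronoi_cell_cover[OF mono N(2), of _ S] unfolding l_def h_def by blast
      ultimately show "nearest_cells (einterval l h) N x (\<lambda>i. voronoi_cell S N x i \<inter> einterval l h)"
        unfolding nearest_cells_def
        using strict_mono_on_imp_inj_on[OF mono] voronoi_cell_borel[OF mono] voronoi_cell_nearest[OF mono] by auto
    qed
  qed
  show ?thesis
  proof (intro exI[of _ C] conjI C allI impI)
    fix x :: "nat \<Rightarrow> nat \<Rightarrow> real"
    assume opt: "\<forall>N\<ge>1. quadratic_optimal_grid M X N (x N)"
    show "limsup (\<lambda>N. ereal (real N powr (1 + \<alpha>) *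
             \<bar>(\<integral>\<omega>. f (X \<omega>) \<partial>M) - (\<integral>\<omega>. f (quantization M X N (x N) \<omega>) \<partial>M)\<bar>)) \<le> ereal C"
    proof (rule Limsup_bounded)
      show "\<forall>\<^sub>F N in sequentially. ereal (real N powr (1 + \<alpha>) *
             \<bar>(\<integral>\<omega>. f (X \<omega>) \<partial>M) - (\<integral>\<omega>. f (quantization M X N (x N) \<omega>) \<partial>M)\<bar>) \<le> ereal C"
        using eventually_ge_at_top[of "max N0 1"]
        by eventually_elim (use main opt in auto)
    qed
  qed
qed

theorem proposition2p9:
  fixes M :: "'w measure"
    and X :: "'w \<Rightarrow> real"
    and \<phi> :: "real \<Rightarrow> real"
    and f :: "real \<Rightarrow> real"
    and K :: nat
    and a :: "nat \<Rightarrow> ereal"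
  assumes "prob_space M"
    and "X \<in> borel_measurable M"
    and "integrable M (\<lambda>\<omega>. (X \<omega>)\<^sup>2)"
    and "\<forall>u. 0 \<le> \<phi> u"
    and "distributed M lborel X (\<lambda>u. ennreal (\<phi> u))"
    and "connected (measure_support (distr M borel X))"
    and "\<forall>A. compact A \<and> A \<subseteq> interior (measure_support (distr M borel X)) \<longrightarrow>
               (\<forall>u\<in>A. 0 < \<phi> u) \<and> (\<exists>L. L-lipschitz_on A \<phi>)"
    and "continuous_on UNIV f"
    and "integrable M (\<lambda>\<omega>. (f (X \<omega>))\<^sup>2)"
    and "a 0 = -\<infinity>"
    and "a (K + 1) = \<infinity>"
    and "strict_mono_on {0..K + 1} a"
    and "\<forall>k\<in>{0..K}. \<forall>u\<in>einterval (a k) (a (k + 1)). f differentiable (at u)"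
  shows
    "(\<forall>(L :: nat \<Rightarrow> real) (q :: nat \<Rightarrow> real) (g :: nat \<Rightarrow> real \<Rightarrow> real) (s :: real) (\<delta> :: real).
        (\<forall>k\<in>{0..K}.
           0 \<le> L k \<and> 3 < q k \<and>
           (\<forall>u\<in>einterval (a k) (a (k + 1)). 0 \<le> g k u) \<and>
           convex_on (einterval (a k) (a (k + 1))) (\<lambda>u. g k u powr q k) \<and>
           integrable M (\<lambda>\<omega>. g k (X \<omega>) powr q k *
                              indicator (einterval (a k) (a (k + 1))) (X \<omega>)) \<and>
           (\<forall>u\<in>einterval (a k) (a (k + 1)). \<forall>v\<in>einterval (a k) (a (k + 1)).
              \<bar>deriv f u - deriv f v\<bar> \<le> L k * \<bar>u - v\<bar> * (g k u + g k v))) \<and>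
        2 < s \<and> s < 3 \<and>
        s \<ge> 2 * (MAX k\<in>{0..K}. q k / (q k - 1)) \<and>
        0 < \<delta> \<and>
        integrable M (\<lambda>\<omega>. \<bar>X \<omega>\<bar> powr (s / (3 - s) + \<delta>)) \<longrightarrow>
        (\<exists>C>0. \<forall>x :: nat \<Rightarrow> nat \<Rightarrow> real.
           (\<forall>N\<ge>1. quadratic_optimal_grid M X N (x N)) \<longrightarrow>
           limsup (\<lambda>N. ereal ((real N)\<^sup>2 *
             \<bar>(\<integral>\<omega>. f (X \<omega>) \<partial>M) - (\<integral>\<omega>. f (quantization M X N (x N) \<omega>) \<partial>M)\<bar>)) \<le> ereal C))
     \<and>
     (\<forall>(\<alpha> :: real) (L :: nat \<Rightarrow> real) (q :: nat \<Rightarrow> real) (g :: nat \<Rightarrow> real \<Rightarrow> real)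
        (s :: real) (\<delta> :: real).
        0 < \<alpha> \<and> \<alpha> < 1 \<and>
        (\<forall>k\<in>{0..K}.
           0 \<le> L k \<and> 3 / (2 - \<alpha>) < q k \<and>
           (\<forall>u\<in>einterval (a k) (a (k + 1)). 0 \<le> g k u) \<and>
           convex_on (einterval (a k) (a (k + 1))) (\<lambda>u. g k u powr q k) \<and>
           integrable M (\<lambda>\<omega>. g k (X \<omega>) powr q k *
                              indicator (einterval (a k) (a (k + 1))) (X \<omega>)) \<and>
           (\<forall>u\<in>einterval (a k) (a (k + 1)). \<forall>v\<in>einterval (a k) (a (k + 1)).
              \<bar>deriv f u - deriv f v\<bar> \<le> L k * \<bar>u - v\<bar> powr \<alpha> * (g k u + g k v))) \<and>
        2 < s \<and> s < 3 \<and>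
        s \<ge> (1 + \<alpha>) * (MAX k\<in>{0..K}. q k / (q k - 1)) \<and>
        0 < \<delta> \<and>
        integrable M (\<lambda>\<omega>. \<bar>X \<omega>\<bar> powr (s / (3 - s) + \<delta>)) \<longrightarrow>
        (\<exists>C>0. \<forall>x :: nat \<Rightarrow> nat \<Rightarrow> real.
           (\<forall>N\<ge>1. quadratic_optimal_grid M X N (x N)) \<longrightarrow>
           limsup (\<lambda>N. ereal (real N powr (1 + \<alpha>) *
             \<bar>(\<integral>\<omega>. f (X \<omega>) \<partial>M) - (\<integral>\<omega>. f (quantization M X N (x N) \<omega>) \<partial>M)\<bar>)) \<le> ereal C))"
proof (intro conjI allI impI; elim conjE)
  fix L q :: "nat \<Rightarrow> real" and g :: "nat \<Rightarrow> real \<Rightarrow> real" and s \<delta> :: real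
  assume piece: "\<forall>k\<in>{0..K}.
           0 \<le> L k \<and> 3 < q k \<and>
           (\<forall>u\<in>einterval (a k) (a (k + 1)). 0 \<le> g k u) \<and>
           convex_on (einterval (a k) (a (k + 1))) (\<lambda>u. g k u powr q k) \<and>
           integrable M (\<lambda>\<omega>. g k (X \<omega>) powr q k *
                              indicator (einterval (a k) (a (k + 1))) (X \<omega>)) \<and>
           (\<forall>u\<in>einterval (a k) (a (k + 1)). \<forall>v\<in>einterval (a k) (a (k + 1)).
              \<bar>deriv f u - deriv f v\<bar> \<le> L k * \<bar>u - v\<bar> * (g k u + g k v))"
    and s: "2 < s" "s < 3" "s \<ge> 2 * (MAX k\<in>{0..K}. q k / (q k - 1))"
    and \<delta>: "0 < \<delta>" "integrable M (\<lambda>\<omega>. \<bar>X \<omega>\<bar> powr (s / (3 - s) + \<delta>))"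
  \<comment> \<open>Valid also at N = 0, where both sides vanish because 0 \<open>powr\<close> 2 is
    0.\<close>
  have pow: "(real N)\<^sup>2 = real N powr (1 + 1)" for N by (cases N) auto
  show "\<exists>C>0. \<forall>x :: nat \<Rightarrow> nat \<Rightarrow> real.
           (\<forall>N\<ge>1. quadratic_optimal_grid M X N (x N)) \<longrightarrow>
           limsup (\<lambda>N. ereal ((real N)\<^sup>2 *
             \<bar>(\<integral>\<omega>. f (X \<omega>) \<partial>M) - (\<integral>\<omega>. f (quantization M X N (x N) \<omega>) \<partial>M)\<bar>)) \<le> ereal C"
    unfolding pow
    by (rule limsup_weak_error[OF assms, of 1 L q g s \<delta>]) (use piece s \<delta> in auto)
next
  fix \<alpha> s \<delta> :: real and L q :: "nat \<Rightarrow> real" and g :: "nat \<Rightarrow> real \<Rightarrow> real"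
  assume "0 < \<alpha>" "\<alpha> < 1" and rest: "\<forall>k\<in>{0..K}.
           0 \<le> L k \<and> 3 / (2 - \<alpha>) < q k \<and>
           (\<forall>u\<in>einterval (a k) (a (k + 1)). 0 \<le> g k u) \<and>
           convex_on (einterval (a k) (a (k + 1))) (\<lambda>u. g k u powr q k) \<and>
           integrable M (\<lambda>\<omega>. g k (X \<omega>) powr q k *
                              indicator (einterval (a k) (a (k + 1))) (X \<omega>)) \<and>
           (\<forall>u\<in>einterval (a k) (a (k + 1)). \<forall>v\<in>einterval (a k) (a (k + 1)).
              \<bar>deriv f u - deriv f v\<bar> \<le> L k * \<bar>u - v\<bar> powr \<alpha> * (g k u + g k v))"
    "2 < s" "s < 3" "s \<ge> (1 + \<alpha>) * (MAX k\<in>{0..K}. q k / (q k - 1))"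
    "0 < \<delta>" "integrable M (\<lambda>\<omega>. \<bar>X \<omega>\<bar> powr (s / (3 - s) + \<delta>))"
  then have "\<alpha> \<le> 1" by simp
  then show "\<exists>C>0. \<forall>x :: nat \<Rightarrow> nat \<Rightarrow> real.
           (\<forall>N\<ge>1. quadratic_optimal_grid M X N (x N)) \<longrightarrow>
           limsup (\<lambda>N. ereal (real N powr (1 + \<alpha>) *
             \<bar>(\<integral>\<omega>. f (X \<omega>) \<partial>M) - (\<integral>\<omega>. f (quantization M X N (x N) \<omega>) \<partial>M)\<bar>)) \<le> ereal C"
    by (rule limsup_weak_error[OF assms \<open>0 < \<alpha>\<close> _ rest])
qed

end
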